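(* Let $f\in L^1(\Omega)$. Then the solution found by approximation of $$X^*(A(x)Xu)=f\ \text{ in }\Omega,\qquad u=0\ \text{ on }\partial\Omega$$ is unique and does not depend on the approximating sequence. That is: if $(f_n)_n$ and $(g_n)_n$ are sequences in $L^{\frac{2Q}{Q+2}}(\Omega)$ converging to $f$ in $L^1(\Omega)$, and $u$ and $v$ are solutions found by approximation obtained from $(f_n)_n$ and $(g_n)_n$ respectively (possibly $(f_n)_n=(g_n)_n$, along different subsequences), then $u=v$ almost everywhere in $\Omega$.
   Context: Setting. $N\ge2$, $\Omega\subset\mathbb R^N$ is open and bounded, and $X=\{X_1,\dots,X_m\}$ is a fixed family of locally Lipschitz vector fields on $\mathbb R^N$, $X_j=\sum_{k=1}^N c_{jk}\partial_{x_k}$; for $u\in C^1$, $Xu=(X_1u,\dots,X_mu)$ is the $X$-gradient. An absolutely continuous path $\gamma:[0,T]\to\mathbb R^N$ is $X$-subunit if $\dot\gamma(t)=\sum_{j}\theta_j(t)X_j(\gamma(t))$ with $\sum_j\theta_j^2(t)\le1$ for a.e. $t$. It is assumed that any two points of $\Omega$ are joined by an $X$-subunit path in $\Omega$; $d_X(x,y)$ is the infimum of all $T>0$ for which there is an $X$-subunit $\gamma:[0,T]\to\mathbb R^N$ with $\gamma(0)=x$, $\gamma(T)=y$; $B_r$ denotes a $d_X$-ball of radius $r$ and $B_{cr}$ the concentric ball of radius $cr$. Standing assumptions: (i) $|y-x|\to0$ implies $d_X(x,y)\to0$; (ii) $(\Omega,d_X,\mathcal L^N)$ is doubling: there is $Q>2$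 with $0<\mathcal L^N(B_{2r})\le2^Q\mathcal L^N(B_r)$; (iii) there are $C_P,\nu>0$ such that $\frac1{|B_r|}\int_{B_r}|u-u_r|\,dx\le C_P\,r\,\frac1{|B_{\nu r}|}\int_{B_{\nu r}}|Xu|\,dx$ for every $d_X$-ball $B_r$ and $u\in C^1(\overline{B_{\nu r}})$, with $u_r=\frac1{|B_r|}\int_{B_r}u\,dx$. $W^{1,p}_0(\Omega,X)$ is the closure of $C^\infty_c(\Omega)$ under the norm $\|Xu\|_{L^p(\Omega)}$ (with $Xu$ the $L^p$-limit of the $X$-gradients of approximating functions). Known fact (Sobolev inequality): for $1\le p<Q$ there is a constant $\mathcal S_p$ with $\|u\|_{L^{p^*}(\Omega)}\le\mathcal S_p\|Xu\|_{L^p(\Omega)}$ for all $u\in W^{1,p}_0(\Omega,X)$, $p^*=\frac{pQ}{Q-p}$. $A:\Omega\to\mathbb R^{m\times m}$ is measurable with bounded entries (not necessarily symmetric) and there are $0<\alpha<\beta$ with $\alpha|\eta|^2\le A(x)\eta\cdot\eta\le\beta|\eta|^2$ for all $\eta\in\mathbb R^m$. $X^*$ is the formal adjoint: $\langle X^*F,v\rangle=\int_\Omega F\cdot Xv$. Weak solution. For $h\in L^{\frac{2Q}{Q+2}}(\Omega)$, the weak solution of $X^*(AXu)=h$ in $\Omega$, $u=0$ on $\partial\Omega$, is the unique (Lax–Milgram) $u\in W^{1,2}_0(\Omega,X)$ with $\int_\Omega A\,Xu\cdot Xv=\int_\Omega h\,v$ for all $v\in W^{1,2}_0(\Omega,X)$.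 Solution found by approximation. Given $f\in L^1(\Omega)$ and a sequence $(f_n)_n\subset L^{\frac{2Q}{Q+2}}(\Omega)$ converging to $f$ in $L^1(\Omega)$ (for instance the truncations $f_n=\max\{-n,\min\{f,n\}\}$), let $u_n$ be the weak solution with datum $f_n$. A solution found by approximation is a function $u$ which is the limit of a subsequence of $(u_n)_n$, weakly in $W^{1,q}_0(\Omega,X)$ for every $1<q<\frac Q{Q-1}$ and strongly in $L^s(\Omega)$ for every $1\le s<\frac Q{Q-2}$. *)

theory Defs
  imports "HOL-Analysis.Analysis"
begin

text \<open>
  The family \<open>X\<close> of vector fields on \<open>real ^ 'n\<close>, indexed by the finite type \<open>'m\<close>, is given by
  \<open>X j x $ k = c\<^sub>j\<^sub>k(x)\<close>.  All function spaces over \<open>\<Omega>\<close> consist of total functions considered with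
  respect to \<open>lebesgue_on \<Omega>\<close>; they are not quotiented by almost everywhere equality.
\<close>

subsection \<open>Differentiable functions and the X-gradient\<close>

fun Ck_on :: "nat \<Rightarrow> (real ^ 'n \<Rightarrow> real) \<Rightarrow> (real ^ 'n) set \<Rightarrow> bool" where
  "Ck_on 0 u S \<longleftrightarrow> continuous_on S u"
| "Ck_on (Suc k) u S \<longleftrightarrow> (\<forall>x\<in>S. u differentiable (at x)) \<and>
     (\<forall>i. Ck_on k (\<lambda>x. frechet_derivative u (at x) (axis i 1)) S)"

definition test_functions :: "(real ^ 'n) set \<Rightarrow> (real ^ 'n \<Rightarrow> real) set" where
  "test_functions \<Omega> = {\<phi>. (\<forall>k. Ck_on k \<phi> UNIV) \<and>
     compact (closure {x. \<phi> x \<noteq> 0}) \<and> closure {x. \<phi> x \<noteq> 0} \<subseteq> \<Omega>}"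

definition X_grad :: "('m \<Rightarrow> real ^ 'n \<Rightarrow> real ^ 'n) \<Rightarrow> (real ^ 'n \<Rightarrow> real) \<Rightarrow> real ^ 'n \<Rightarrow> real ^ 'm" where
  "X_grad X u x = (\<chi> j. \<Sum>k\<in>UNIV. X j x $ k * frechet_derivative u (at x) (axis k 1))"

subsection \<open>Subunit paths and the Carnot-Caratheodory distance\<close>

definition absolutely_continuous_path :: "real \<Rightarrow> real \<Rightarrow> (real \<Rightarrow> 'a::real_normed_vector) \<Rightarrow> bool" where
  "absolutely_continuous_path a b \<gamma> \<longleftrightarrow>
     (\<forall>\<epsilon>>0. \<exists>\<delta>>0. \<forall>D :: (real \<times> real) set.
        finite D \<and> (\<forall>(s, t)\<in>D. a \<le> s \<and> s \<le> t \<and> t \<le> b) \<and>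
        disjoint_family_on (\<lambda>(s, t). {s<..<t}) D \<and> (\<Sum>(s, t)\<in>D. t - s) < \<delta>
        \<longrightarrow> (\<Sum>(s, t)\<in>D. norm (\<gamma> t - \<gamma> s)) < \<epsilon>)"

definition subunit_path :: "('m::finite \<Rightarrow> real ^ 'n \<Rightarrow> real ^ 'n) \<Rightarrow> real \<Rightarrow> (real \<Rightarrow> real ^ 'n) \<Rightarrow> bool" where
  "subunit_path X T \<gamma> \<longleftrightarrow> absolutely_continuous_path 0 T \<gamma> \<and>
     (\<exists>\<theta> :: 'm \<Rightarrow> real \<Rightarrow> real. AE t in lebesgue_on {0..T}.
        (\<gamma> has_vector_derivative (\<Sum>j\<in>UNIV. \<theta> j t *\<^sub>R X j (\<gamma> t))) (at t within {0..T}) \<and>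
        (\<Sum>j\<in>UNIV. (\<theta> j t)\<^sup>2) \<le> 1)"

text \<open>Only used for points that are joined by a subunit path, so that the infimum is over a
  nonempty set.\<close>

definition cc_dist :: "('m::finite \<Rightarrow> real ^ 'n \<Rightarrow> real ^ 'n) \<Rightarrow> real ^ 'n \<Rightarrow> real ^ 'n \<Rightarrow> real" where
  "cc_dist X x y = Inf {T. T > 0 \<and> (\<exists>\<gamma>. subunit_path X T \<gamma> \<and> \<gamma> 0 = x \<and> \<gamma> T = y)}"

definition X_connected :: "(real ^ 'n) set \<Rightarrow> ('m::finite \<Rightarrow> real ^ 'n \<Rightarrow> real ^ 'n) \<Rightarrow> bool" where
  "X_connected \<Omega> X \<longleftrightarrow> (\<forall>x\<in>\<Omega>. \<forall>y\<in>\<Omega>. \<exists>T>0. \<exists>\<gamma>.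
     subunit_path X T \<gamma> \<and> \<gamma> 0 = x \<and> \<gamma> T = y \<and> \<gamma> ` {0..T} \<subseteq> \<Omega>)"

text \<open>The balls are those of the metric space \<open>(\<Omega>, d\<^sub>X)\<close>.\<close>

definition cc_ball :: "(real ^ 'n) set \<Rightarrow> ('m::finite \<Rightarrow> real ^ 'n \<Rightarrow> real ^ 'n) \<Rightarrow>
    real ^ 'n \<Rightarrow> real \<Rightarrow> (real ^ 'n) set" where
  "cc_ball \<Omega> X x r = {y\<in>\<Omega>. cc_dist X x y < r}"

definition cc_doubling :: "(real ^ 'n) set \<Rightarrow> ('m::finite \<Rightarrow> real ^ 'n \<Rightarrow> real ^ 'n) \<Rightarrow> real \<Rightarrow> bool" where
  "cc_doubling \<Omega> X Q \<longleftrightarrow> (\<forall>x\<in>\<Omega>. \<forall>r>0.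
     0 < measure lebesgue (cc_ball \<Omega> X x (2 * r)) \<and>
     measure lebesgue (cc_ball \<Omega> X x (2 * r)) \<le> 2 powr Q * measure lebesgue (cc_ball \<Omega> X x r))"

definition average :: "(real ^ 'n) set \<Rightarrow> (real ^ 'n \<Rightarrow> real) \<Rightarrow> real" where
  "average B u = (1 / measure lebesgue B) * (\<integral>x. u x \<partial>lebesgue_on B)"

text \<open>\<open>u \<in> C\<^sup>1(closure B)\<close> is understood as \<open>C\<^sup>1\<close> on an open neighbourhood of the closure.\<close>

definition cc_poincare :: "(real ^ 'n) set \<Rightarrow> ('m::finite \<Rightarrow> real ^ 'n \<Rightarrow> real ^ 'n) \<Rightarrow>
    real \<Rightarrow> real \<Rightarrow> bool" where
  "cc_poincare \<Omega> X C\<^sub>P \<nu> \<longleftrightarrow> (\<forall>x\<in>\<Omega>. \<forall>r>0. \<forall>u U.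
     open U \<and> closure (cc_ball \<Omega> X x (\<nu> * r)) \<subseteq> U \<and> Ck_on 1 u U \<longrightarrow>
     average (cc_ball \<Omega> X x r) (\<lambda>y. \<bar>u y - average (cc_ball \<Omega> X x r) u\<bar>)
       \<le> C\<^sub>P * r * average (cc_ball \<Omega> X x (\<nu> * r)) (\<lambda>y. norm (X_grad X u y)))"

subsection \<open>Lebesgue and Sobolev spaces\<close>

definition Lp_space :: "real \<Rightarrow> 'a::euclidean_space set \<Rightarrow> ('a \<Rightarrow> 'b::euclidean_space) set" where
  "Lp_space p \<Omega> = {f. f \<in> borel_measurable (lebesgue_on \<Omega>) \<and>
     integrable (lebesgue_on \<Omega>) (\<lambda>x. norm (f x) powr p)}"

definition Lp_norm :: "real \<Rightarrow> 'a::euclidean_space set \<Rightarrow> ('a \<Rightarrow> 'b::euclidean_space) \<Rightarrow> real" where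
  "Lp_norm p \<Omega> f = (\<integral>x. norm (f x) powr p \<partial>lebesgue_on \<Omega>) powr (1 / p)"

definition Lp_tendsto :: "real \<Rightarrow> 'a::euclidean_space set \<Rightarrow>
    (nat \<Rightarrow> 'a \<Rightarrow> 'b::euclidean_space) \<Rightarrow> ('a \<Rightarrow> 'b) \<Rightarrow> bool" where
  "Lp_tendsto p \<Omega> fs f \<longleftrightarrow> (\<forall>n. fs n \<in> Lp_space p \<Omega>) \<and> f \<in> Lp_space p \<Omega> \<and>
     (\<lambda>n. Lp_norm p \<Omega> (\<lambda>x. fs n x - f x)) \<longlonglongrightarrow> 0"

text \<open>
  \<open>W0_grad p \<Omega> X u G\<close>: \<open>u\<close> belongs to \<open>W\<^sub>0\<^sup>1\<^sup>,\<^sup>p(\<Omega>, X)\<close> and its \<open>X\<close>-gradient is \<open>G\<close>.  Elements of the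
  closure under \<open>\<phi> \<mapsto> \<parallel>X\<phi>\<parallel>\<^sub>p\<close> become functions through the Sobolev inequality: if \<open>X\<phi>\<^sub>k\<close> is Cauchy in
  \<open>L\<^sup>p\<close> then \<open>\<phi>\<^sub>k\<close> converges in \<open>L\<close> of the Sobolev exponent, hence in \<open>L\<^sup>p\<close> as \<open>\<Omega>\<close> is bounded.  The
  convergence \<open>\<phi>\<^sub>k \<longlonglongrightarrow> u\<close> in \<open>L\<^sup>p\<close> below records this identification.
\<close>

definition W0_grad :: "real \<Rightarrow> (real ^ 'n) set \<Rightarrow> ('m::finite \<Rightarrow> real ^ 'n \<Rightarrow> real ^ 'n) \<Rightarrow>
    (real ^ 'n \<Rightarrow> real) \<Rightarrow> (real ^ 'n \<Rightarrow> real ^ 'm) \<Rightarrow> bool" where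
  "W0_grad p \<Omega> X u G \<longleftrightarrow> (\<exists>\<phi> :: nat \<Rightarrow> real ^ 'n \<Rightarrow> real.
     (\<forall>k. \<phi> k \<in> test_functions \<Omega>) \<and> Lp_tendsto p \<Omega> \<phi> u \<and> Lp_tendsto p \<Omega> (\<lambda>k. X_grad X (\<phi> k)) G)"

definition W0 :: "real \<Rightarrow> (real ^ 'n) set \<Rightarrow> ('m::finite \<Rightarrow> real ^ 'n \<Rightarrow> real ^ 'n) \<Rightarrow>
    (real ^ 'n \<Rightarrow> real) set" where
  "W0 p \<Omega> X = {u. \<exists>G. W0_grad p \<Omega> X u G}"

definition W0_dual :: "real \<Rightarrow> (real ^ 'n) set \<Rightarrow> ('m::finite \<Rightarrow> real ^ 'n \<Rightarrow> real ^ 'n) \<Rightarrow>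
    ((real ^ 'n \<Rightarrow> real) \<Rightarrow> real) set" where
  "W0_dual p \<Omega> X = {l.
     (\<forall>u\<in>W0 p \<Omega> X. \<forall>v\<in>W0 p \<Omega> X. l (\<lambda>x. u x + v x) = l u + l v) \<and>
     (\<forall>u\<in>W0 p \<Omega> X. \<forall>c. l (\<lambda>x. c * u x) = c * l u) \<and>
     (\<exists>C. \<forall>u G. W0_grad p \<Omega> X u G \<longrightarrow> \<bar>l u\<bar> \<le> C * Lp_norm p \<Omega> G)}"

definition W0_weakly_tendsto :: "real \<Rightarrow> (real ^ 'n) set \<Rightarrow> ('m::finite \<Rightarrow> real ^ 'n \<Rightarrow> real ^ 'n) \<Rightarrow>
    (nat \<Rightarrow> real ^ 'n \<Rightarrow> real) \<Rightarrow> (real ^ 'n \<Rightarrow> real) \<Rightarrow> bool" where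
  "W0_weakly_tendsto p \<Omega> X us u \<longleftrightarrow> (\<forall>n. us n \<in> W0 p \<Omega> X) \<and> u \<in> W0 p \<Omega> X \<and>
     (\<forall>l\<in>W0_dual p \<Omega> X. (\<lambda>n. l (us n)) \<longlonglongrightarrow> l u)"

subsection \<open>Solutions of the Dirichlet problem\<close>

definition elliptic_matrix :: "(real ^ 'n) set \<Rightarrow> (real ^ 'n \<Rightarrow> real ^ 'm::finite ^ 'm) \<Rightarrow>
    real \<Rightarrow> real \<Rightarrow> bool" where
  "elliptic_matrix \<Omega> A \<alpha> \<beta> \<longleftrightarrow> A \<in> borel_measurable (lebesgue_on \<Omega>) \<and>
     (\<exists>M. \<forall>x\<in>\<Omega>. \<forall>i j. \<bar>A x $ i $ j\<bar> \<le> M) \<and>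
     (\<forall>x\<in>\<Omega>. \<forall>\<eta>. \<alpha> * (norm \<eta>)\<^sup>2 \<le> (A x *v \<eta>) \<bullet> \<eta> \<and> (A x *v \<eta>) \<bullet> \<eta> \<le> \<beta> * (norm \<eta>)\<^sup>2)"

definition weak_solution :: "(real ^ 'n) set \<Rightarrow> ('m::finite \<Rightarrow> real ^ 'n \<Rightarrow> real ^ 'n) \<Rightarrow>
    (real ^ 'n \<Rightarrow> real ^ 'm ^ 'm) \<Rightarrow> (real ^ 'n \<Rightarrow> real) \<Rightarrow> (real ^ 'n \<Rightarrow> real) \<Rightarrow> bool" where
  "weak_solution \<Omega> X A h u \<longleftrightarrow> (\<exists>G. W0_grad 2 \<Omega> X u G \<and>
     (\<forall>v H. W0_grad 2 \<Omega> X v H \<longrightarrow>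
        (\<integral>x. (A x *v G x) \<bullet> H x \<partial>lebesgue_on \<Omega>) = (\<integral>x. h x * v x \<partial>lebesgue_on \<Omega>)))"

text \<open>\<open>u\<close> is a solution found by approximation obtained from the sequence of data \<open>fs\<close>.  That \<open>fs\<close> lies
  in the dual Sobolev exponent space and converges to the datum in \<open>L\<^sup>1\<close> is required separately.  One
  subsequence serves for all exponents.\<close>

definition approx_solution :: "(real ^ 'n) set \<Rightarrow> ('m::finite \<Rightarrow> real ^ 'n \<Rightarrow> real ^ 'n) \<Rightarrow> real \<Rightarrow>
    (real ^ 'n \<Rightarrow> real ^ 'm ^ 'm) \<Rightarrow> (nat \<Rightarrow> real ^ 'n \<Rightarrow> real) \<Rightarrow>
    (real ^ 'n \<Rightarrow> real) \<Rightarrow> bool" where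
  "approx_solution \<Omega> X Q A fs u \<longleftrightarrow>
     (\<exists>us (\<sigma> :: nat \<Rightarrow> nat). (\<forall>n. weak_solution \<Omega> X A (fs n) (us n)) \<and> strict_mono \<sigma> \<and>
        (\<forall>q. 1 < q \<and> q < Q / (Q - 1) \<longrightarrow> W0_weakly_tendsto q \<Omega> X (us \<circ> \<sigma>) u) \<and>
        (\<forall>s. 1 \<le> s \<and> s < Q / (Q - 2) \<longrightarrow> Lp_tendsto s \<Omega> (us \<circ> \<sigma>) u))"

end

theory Submission
  imports Defs
begin

text \<open>
  Let \<open>u\<^sub>n\<close> and \<open>v\<^sub>n\<close> be the weak solutions with data \<open>f\<^sub>n\<close> and \<open>g\<^sub>n\<close> along the two subsequences.  By
  linearity \<open>w\<^sub>n = u\<^sub>n - v\<^sub>n\<close> is a weak solution whose datum \<open>f\<^sub>n - g\<^sub>n\<close> tends to \<open>0\<close> in \<open>L\<^sup>1\<close>.  Testing its equation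
  with a bounded increasing function of \<open>w\<^sub>n\<close> gives an energy estimate in which only the \<open>L\<^sup>1\<close> norm of
  the datum appears.  Here that function is the hyperbolic tangent: \<open>tanh\<close> of a test function is again a
  test function, because \<open>tanh' = 1 - tanh\<^sup>2\<close>, so it suffices to approximate \<open>w\<^sub>n\<close> by test functions
  \<open>\<phi>\<close> and to use \<open>tanh \<phi>\<close> (\<open>tanh_energy_estimate\<close>).  The outcome is a sequence of test
  functions that converges in \<open>L\<^sup>1\<close> to \<open>tanh (u - v)\<close> while their \<open>X\<close>-gradients converge to \<open>0\<close> in
  \<open>L\<^sup>2\<close>.  Everything is thereby reduced to a Liouville property of the closure of the test functions:
  such a limit is \<open>0\<close> almost everywhere (\<open>vanishing_X_grad_limit_eq_0\<close>).

  The Liouville property is a qualitative form of the Sobolev inequality and is proved directly.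
  A doubling space of finite measure is bounded, since far away there would be balls with measure
  bounded from below (\<open>cc_doubling_imp_bounded_cc_dist\<close>).  So \<open>\<Omega>\<close> is a single ball, and the Poincare
  inequality on it shows that the limit is a constant \<open>c\<close>.  That \<open>c = 0\<close> is where the boundary condition
  enters.  If \<open>c \<noteq> 0\<close>, then the indicator function of \<open>\<Omega>\<close>, as a function on the whole space, has a vanishing
  \<open>X\<close>-gradient in the weak sense (\<open>weak_transport_complement\<close>), so that being almost everywhere inside \<open>\<Omega>\<close>
  is transported along subunit paths: if \<open>ball (\<gamma> 0) r\<close> lies in \<open>\<Omega>\<close>, then \<open>ball (\<gamma> T) (r exp (-K T))\<close> lies
  in \<open>\<Omega>\<close> up to a null set (\<open>path_keeps_ball\<close>).  As all points of \<open>\<Omega>\<close> are reached in bounded time, there is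
  one radius that works for all centres in \<open>\<Omega>\<close>; this is absurd for a centre one of whose coordinates comes
  within half of that radius of its supremum over \<open>\<Omega>\<close>.
\<close>

section \<open>Absolutely continuous paths\<close>

definition interval_family :: "real \<Rightarrow> real \<Rightarrow> real \<Rightarrow> (real \<times> real) set \<Rightarrow> bool" where
  "interval_family a b d D \<longleftrightarrow> finite D \<and> (\<forall>(s, t)\<in>D. a \<le> s \<and> s \<le> t \<and> t \<le> b) \<and>
     disjoint_family_on (\<lambda>(s, t). {s<..<t}) D \<and> (\<Sum>(s, t)\<in>D. t - s) < d"

lemma absolutely_continuous_path_iff:
  "absolutely_continuous_path a b \<gamma> \<longleftrightarrow>
     (\<forall>e>0. \<exists>d>0. \<forall>D. interval_family a b d D \<longrightarrow> (\<Sum>(s, t)\<in>D. norm (\<gamma> t - \<gamma> s)) < e)"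
  unfolding absolutely_continuous_path_def interval_family_def ..

text \<open>
  A Cousin-type argument instead of Lebesgue differentiation theory.  At a good point \<open>t\<close> the function increases by at
  most \<open>e (s' - s)\<close> on short intervals \<open>[s, s']\<close> around \<open>t\<close>.  The bad points lie in an open set of small
  measure, so the intervals of a fine tagged division with bad tags have a small total length, and absolute
  continuity makes their contribution small.  Summing the increments over the division telescopes.
\<close>

lemma absolutely_continuous_path_nonincreasing:
  fixes h :: "real \<Rightarrow> real"
  assumes "a \<le> b" and ac: "absolutely_continuous_path a b h"
    and ae: "AE t in lebesgue_on {a..b}. \<exists>D\<le>0. (h has_vector_derivative D) (at t within {a..b})"
  shows "h b \<le> h a"
proof -
  define good where "good t \<longleftrightarrow> (\<exists>D\<le>0. (h has_vector_derivative D) (at t within {a..b}))" for t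
  define N where "N = {t\<in>{a..b}. \<not> good t}"
  have N: "negligible N"
  proof -
    have "AE t in lebesgue. t \<in> {a..b} \<longrightarrow> good t"
      using ae unfolding good_def[symmetric] by (subst (asm) AE_restrict_space_iff) auto
    then show ?thesis
      by (auto simp: N_def eventually_ae_filter_negligible elim!: negligible_subset)
  qed
  have key: "h b - h a \<le> e * (b - a) + e" if "e > 0" for e
  proof -
    obtain d where "d > 0" and d: "\<forall>D. interval_family a b d D
        \<longrightarrow> (\<Sum>(s, t)\<in>D. norm (h t - h s)) < e"
      using ac[unfolded absolutely_continuous_path_iff, rule_format, OF \<open>e > 0\<close>] by blast
    obtain V where V: "open V" "N \<subseteq> V" "V \<in> lmeasurable" "measure lebesgue V < d"
    proof -
      obtain T where T: "open T" "N \<subseteq> T" "T - N \<in> lmeasurable" "emeasure lebesgue (T - N) < ennreal d"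
        using sets_lebesgue_outer_open[OF _ \<open>d > 0\<close>, of N] N negligible_imp_sets by blast
      have eq: "T = (T - N) \<union> (N \<inter> T)" by auto
      have "N \<inter> T \<in> null_sets lebesgue"
        using N by (simp add: negligible_Int negligible_iff_null_sets[symmetric])
      then have "emeasure lebesgue T = emeasure lebesgue (T - N)"
        using T(3) by (subst eq, subst emeasure_Un_null_set) auto
      then have "emeasure lebesgue T < ennreal d" using T(4) by simp
      moreover from this have "T \<in> lmeasurable"
        using \<open>open T\<close> by (auto intro!: fmeasurableI order_less_trans[OF _ ennreal_less_top])
      ultimately show ?thesis
        using that[of T] T(1,2) by (simp add: emeasure_eq_measure2 ennreal_less_iff)
    qed
    have "\<exists>\<rho>>0. (t \<in> N \<longrightarrow> ball t \<rho> \<subseteq> V) \<and> (t \<in> {a..b} - N \<longrightarrow>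
        (\<forall>s\<in>{a..b}. \<forall>s'\<in>{a..b}. s \<le> t \<and> t \<le> s' \<and> {s..s'} \<subseteq> ball t \<rho> \<longrightarrow> h s' - h s \<le> e * (s' - s)))" for t
    proof (cases "t \<in> {a..b} - N")
      case False
      then show ?thesis using V open_contains_ball[of V] by (metis subsetD zero_less_one)
    next
      case True
      then obtain D where "D \<le> 0" "(h has_vector_derivative D) (at t within {a..b})"
        unfolding N_def good_def by auto
      then obtain \<rho> where "\<rho> > 0" and \<rho>: "\<And>s. s \<in> {a..b} \<Longrightarrow> norm (s - t) < \<rho> \<Longrightarrow>
          norm (h s - h t - (s - t) *\<^sub>R D) \<le> e * norm (s - t)"
        using \<open>e > 0\<close> unfolding has_vector_derivative_def has_derivative_within_alt by blast
      have "h s' - h s \<le> e * (s' - s)"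
        if "s \<in> {a..b}" "s' \<in> {a..b}" "s \<le> t" "t \<le> s'" "{s..s'} \<subseteq> ball t \<rho>" for s s'
      proof -
        have "s \<in> ball t \<rho>" "s' \<in> ball t \<rho>"
          using that(3,4) subsetD[OF that(5), of s] subsetD[OF that(5), of s'] by simp_all
        then have "\<bar>h s - h t - (s - t) * D\<bar> \<le> e * \<bar>s - t\<bar>" "\<bar>h s' - h t - (s' - t) * D\<bar> \<le> e * \<bar>s' - t\<bar>"
          using \<rho>[of s] \<rho>[of s'] that by (auto simp: dist_real_def)
        moreover have "(s' - t) * D \<le> 0" "(s - t) * D \<ge> 0"
          using \<open>D \<le> 0\<close> that by (auto simp: mult_le_0_iff zero_le_mult_iff)
        ultimately show ?thesis using that by (simp add: abs_le_iff algebra_simps)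
      qed
      then show ?thesis using \<open>\<rho> > 0\<close> True by blast
    qed
    then obtain \<rho> where \<rho>0: "\<And>t. \<rho> t > 0" and \<rho>N: "\<And>t. t \<in> N \<Longrightarrow> ball t (\<rho> t) \<subseteq> V"
      and \<rho>g: "\<And>t s s'. t \<in> {a..b} - N \<Longrightarrow> s \<in> {a..b} \<Longrightarrow> s' \<in> {a..b} \<Longrightarrow> s \<le> t \<Longrightarrow> t \<le> s' \<Longrightarrow>
          {s..s'} \<subseteq> ball t (\<rho> t) \<Longrightarrow> h s' - h s \<le> e * (s' - s)"
      by metis
    have "gauge (\<lambda>t. ball t (\<rho> t))" using \<rho>0 by (auto intro: gauge_ball_dependent)
    then obtain p where p: "p tagged_division_of {a..b}" and fine: "(\<lambda>t. ball t (\<rho> t)) fine p"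
      using fine_division_exists_real by blast
    have fin: "finite p" using p by auto
    have K: "\<exists>s s'. K = {s..s'} \<and> s \<le> s' \<and> a \<le> s \<and> s' \<le> b \<and> s \<le> x \<and> x \<le> s' \<and> Inf K = s \<and> Sup K = s' \<and> K \<subseteq> ball x (\<rho> x)"
      if xK: "(x, K) \<in> p" for x K
    proof -
      obtain s s' where "K = cbox s s'" using tagged_division_ofD(4)[OF p xK] by auto
      moreover have "x \<in> K" "K \<subseteq> {a..b}" using tagged_division_ofD(2,3)[OF p xK] by auto
      moreover have "K \<subseteq> ball x (\<rho> x)" using fine xK unfolding fine_def by blast
      ultimately show ?thesis by (intro exI[of _ s] exI[of _ s']) auto
    qed
    define P where "P = {(x, K) \<in> p. x \<in> N}"
    have P: "P \<subseteq> p" "finite P" using fin unfolding P_def by (auto intro: finite_subset)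
    have "(\<Sum>(x, K)\<in>p - P. h (Sup K) - h (Inf K)) \<le> (\<Sum>(x, K)\<in>p - P. e * (Sup K - Inf K))"
    proof (rule sum_mono, clarify)
      fix x L assume "(x, L) \<in> p" "(x, L) \<notin> P"
      then have "x \<notin> N" unfolding P_def by auto
      obtain s s' where s: "L = {s..s'}" "s \<le> s'" "a \<le> s" "s' \<le> b" "s \<le> x" "x \<le> s'" "Inf L = s" "Sup L = s'" "L \<subseteq> ball x (\<rho> x)"
        using K[OF \<open>(x, L) \<in> p\<close>] by auto
      show "h (Sup L) - h (Inf L) \<le> e * (Sup L - Inf L)"
        unfolding s(7,8) using s \<open>x \<notin> N\<close> by (intro \<rho>g[of x]) auto
    qed
    also have "\<dots> \<le> (\<Sum>(x, K)\<in>p. e * (Sup K - Inf K))"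
      using fin K \<open>e > 0\<close> by (intro sum_mono2) (fastforce intro!: mult_nonneg_nonneg)+
    also have "\<dots> = e * (b - a)"
      using additive_tagged_division_1[OF \<open>a \<le> b\<close> p, of "\<lambda>x. x"]
      by (simp add: sum_distrib_left[symmetric] case_prod_unfold)
    finally have good_part: "(\<Sum>(x, K)\<in>p - P. h (Sup K) - h (Inf K)) \<le> e * (b - a)" .
    \<comment> \<open>Distinct tags may carry the same interval, but then this interval is degenerate and contributes nothing.\<close>
    define ends where "ends = (\<lambda>(x::real, K::real set). (Inf K, Sup K))"
    define D where "D = ends ` P"
    have degenerate: "Inf K = Sup K"
      if "(x, K) \<in> P" "(x', K') \<in> P" "(x, K) \<noteq> (x', K')" "ends (x, K) = ends (x', K')" for x K x' K'
    proof -
      have pp: "(x, K) \<in> p" "(x', K') \<in> p" using that P by auto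
      obtain s s' where "K = {s..s'}" "Inf K = s" "Sup K = s'" "s \<le> s'" using K[OF pp(1)] by blast
      moreover obtain t t' where "K' = {t..t'}" "Inf K' = t" "Sup K' = t'" using K[OF pp(2)] by blast
      moreover have "interior K \<inter> interior K' = {}" using tagged_division_ofD(5)[OF p pp that(3)] .
      ultimately show ?thesis using that(4) by (auto simp: ends_def)
    qed
    have reindex: "(\<Sum>(s, t)\<in>D. f s t) = (\<Sum>(x, K)\<in>P. f (Inf K) (Sup K))" if "\<And>s. f s s = 0" for f :: "real \<Rightarrow> real \<Rightarrow> real"
      unfolding D_def
    proof (subst sum.reindex_nontrivial)
      show "finite P" by fact
      fix q q' assume q: "q \<in> P" "q' \<in> P" "q \<noteq> q'" "ends q = ends q'"
      then have "Inf (snd q) = Sup (snd q)"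
        using degenerate[of "fst q" "snd q" "fst q'" "snd q'"] by auto
      then show "(case ends q of (s, t) \<Rightarrow> f s t) = 0"
        by (simp add: ends_def case_prod_unfold that)
    qed (simp add: ends_def case_prod_unfold)
    have Dfin: "finite D" using P D_def by auto
    have Din: "a \<le> s \<and> s \<le> t \<and> t \<le> b \<and> {s..t} \<subseteq> V" if st: "(s, t) \<in> D" for s t
    proof -
      obtain x K' where "(x, K') \<in> P" "s = Inf K'" "t = Sup K'"
        using st unfolding D_def ends_def by (force simp: case_prod_unfold)
      then have "(x, K') \<in> p" "x \<in> N" unfolding P_def by auto
      then obtain u u' where "K' = {u..u'}" "u \<le> u'" "a \<le> u" "u' \<le> b" "Inf K' = u" "Sup K' = u'" "K' \<subseteq> ball x (\<rho> x)"
        using K by blast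
      then show ?thesis using \<rho>N[OF \<open>x \<in> N\<close>] \<open>s = Inf K'\<close> \<open>t = Sup K'\<close> by simp
    qed
    have Ddisj: "disjoint_family_on (\<lambda>(s, t). {s<..<t}) D"
    proof (unfold disjoint_family_on_def, intro ballI impI)
      fix q q' assume "q \<in> D" "q' \<in> D" "q \<noteq> q'"
      then obtain z z' where z: "z \<in> P" "z' \<in> P" "q = ends z" "q' = ends z'" unfolding D_def by blast
      obtain x K1 x' K2 where zK: "z = (x, K1)" "z' = (x', K2)" by (metis surj_pair)
      have k: "(x, K1) \<in> p" "(x', K2) \<in> p" "(x, K1) \<noteq> (x', K2)"
        using z zK P(1) \<open>q \<noteq> q'\<close> by auto
      have "interior K1 \<inter> interior K2 = {}" by (rule tagged_division_ofD(5)[OF p k])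
      moreover obtain s s' where "K1 = {s..s'}" "Inf K1 = s" "Sup K1 = s'" using K[OF k(1)] by blast
      moreover obtain t t' where "K2 = {t..t'}" "Inf K2 = t" "Sup K2 = t'" using K[OF k(2)] by blast
      ultimately show "(case q of (s, t) \<Rightarrow> {s<..<t}) \<inter> (case q' of (s, t) \<Rightarrow> {s<..<t}) = {}"
        unfolding z zK ends_def by simp
    qed
    have "(\<Sum>(s, t)\<in>D. t - s) = (\<Sum>i\<in>D. measure lebesgue (case i of (s, t) \<Rightarrow> {s<..<t}))"
      using Din by (intro sum.cong) auto
    also have "\<dots> = measure lebesgue (\<Union>i\<in>D. case i of (s, t) \<Rightarrow> {s<..<t})"
      using Ddisj Dfin
      by (intro measure_finite_Union[symmetric]) (auto dest!: Din)
    also have "\<dots> \<le> measure lebesgue V"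
    proof (rule measure_mono_fmeasurable)
      have "{s<..<t} \<subseteq> V" if "(s, t) \<in> D" for s t
        using Din[OF that] greaterThanLessThan_subseteq_atLeastAtMost_iff[of s t s t] by blast
      then show "(\<Union>i\<in>D. case i of (s, t) \<Rightarrow> {s<..<t}) \<subseteq> V" by auto
    qed (use V Dfin in auto)
    also have "\<dots> < d" by fact
    finally have "(\<Sum>(s, t)\<in>D. norm (h t - h s)) < e"
      using d[rule_format, of D] Dfin Ddisj Din unfolding interval_family_def by fast
    then have "(\<Sum>(x, K)\<in>P. norm (h (Sup K) - h (Inf K))) < e" by (subst (asm) reindex) auto
    moreover have "(\<Sum>(x, K)\<in>P. h (Sup K) - h (Inf K)) \<le> (\<Sum>(x, K)\<in>P. norm (h (Sup K) - h (Inf K)))"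
      by (intro sum_mono) auto
    ultimately have bad_part: "(\<Sum>(x, K)\<in>P. h (Sup K) - h (Inf K)) \<le> e" by linarith
    have "h b - h a = (\<Sum>(x, K)\<in>p. h (Sup K) - h (Inf K))"
      using additive_tagged_division_1[OF \<open>a \<le> b\<close> p, of h] by simp
    also have "\<dots> = (\<Sum>(x, K)\<in>p - P. h (Sup K) - h (Inf K)) + (\<Sum>(x, K)\<in>P. h (Sup K) - h (Inf K))"
      using sum.subset_diff[OF P(1) fin] by blast
    finally show ?thesis using good_part bad_part by linarith
  qed
  have "h b - h a \<le> 0"
  proof (rule field_le_epsilon)
    fix e :: real assume "e > 0"
    define e' where "e' = e / (b - a + 1)"
    have "e' > 0" "e' * (b - a + 1) = e" using \<open>e > 0\<close> \<open>a \<le> b\<close> by (auto simp: e'_def)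
    with key[of e'] show "h b - h a \<le> 0 + e" by (simp add: distrib_left)
  qed
  then show ?thesis by simp
qed

lemma lipschitz_imp_absolutely_continuous_path:
  assumes "C-lipschitz_on {a..b} \<gamma>"
  shows "absolutely_continuous_path a b \<gamma>"
  unfolding absolutely_continuous_path_iff
proof (intro allI impI)
  fix e :: real assume "e > 0"
  have C: "C \<ge> 0" using assms lipschitz_on_nonneg by blast
  show "\<exists>\<delta>>0. \<forall>D. interval_family a b \<delta> D
        \<longrightarrow> (\<Sum>(s, t)\<in>D. norm (\<gamma> t - \<gamma> s)) < e"
  proof (intro exI[of _ "e / (C + 1)"] conjI allI impI)
    show "e / (C + 1) > 0" using \<open>e > 0\<close> C by auto
    fix D :: "(real \<times> real) set"
    assume D: "interval_family a b (e / (C + 1)) D"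
    have "norm (\<gamma> t - \<gamma> s) \<le> C * (t - s)" if "(s, t) \<in> D" for s t
    proof -
      have "s \<in> {a..b}" "t \<in> {a..b}" "s \<le> t" using D that by (auto simp: interval_family_def)
      then show ?thesis
        using lipschitz_onD[OF assms, of t s] by (simp add: dist_norm)
    qed
    then have "(\<Sum>(s, t)\<in>D. norm (\<gamma> t - \<gamma> s)) \<le> (\<Sum>(s, t)\<in>D. C * (t - s))"
      by (intro sum_mono) auto
    also have "\<dots> = C * (\<Sum>(s, t)\<in>D. t - s)" by (simp add: sum_distrib_left case_prod_unfold)
    also have "\<dots> \<le> (C + 1) * (\<Sum>(s, t)\<in>D. t - s)"
      using D by (intro mult_right_mono sum_nonneg) (auto simp: interval_family_def)
    also have "\<dots> < (C + 1) * (e / (C + 1))"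
      using D C by (intro mult_strict_left_mono) (auto simp: interval_family_def)
    finally show "(\<Sum>(s, t)\<in>D. norm (\<gamma> t - \<gamma> s)) < e" using C by simp
  qed
qed

text \<open>
  With a suitable choice of the two dominating paths this covers sums, scalar components and products with bounded factors.
\<close>

lemma absolutely_continuous_path_dominated:
  assumes f: "absolutely_continuous_path a b f" and g: "absolutely_continuous_path a b g"
    and le: "\<And>s t. a \<le> s \<Longrightarrow> s \<le> t \<Longrightarrow> t \<le> b \<Longrightarrow> norm (h t - h s) \<le> norm (f t - f s) + norm (g t - g s)"
  shows "absolutely_continuous_path a b h"
  unfolding absolutely_continuous_path_iff
proof (intro allI impI)
  fix e :: real assume "e > 0"
  then have "e / 2 > 0" by simp
  obtain d1 where "d1 > 0" and d1: "\<forall>D. interval_family a b d1 D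
        \<longrightarrow> (\<Sum>(s, t)\<in>D. norm (f t - f s)) < e / 2"
    using f[unfolded absolutely_continuous_path_iff, rule_format, OF \<open>e / 2 > 0\<close>] by blast
  obtain d2 where "d2 > 0" and d2: "\<forall>D. interval_family a b d2 D
        \<longrightarrow> (\<Sum>(s, t)\<in>D. norm (g t - g s)) < e / 2"
    using g[unfolded absolutely_continuous_path_iff, rule_format, OF \<open>e / 2 > 0\<close>] by blast
  show "\<exists>\<delta>>0. \<forall>D. interval_family a b \<delta> D
        \<longrightarrow> (\<Sum>(s, t)\<in>D. norm (h t - h s)) < e"
  proof (intro exI[of _ "min d1 d2"] conjI allI impI)
    show "min d1 d2 > 0" using \<open>d1 > 0\<close> \<open>d2 > 0\<close> by simp
    fix D :: "(real \<times> real) set"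
    assume D: "interval_family a b (min d1 d2) D"
    have "(\<Sum>(s, t)\<in>D. norm (h t - h s)) \<le> (\<Sum>(s, t)\<in>D. norm (f t - f s) + norm (g t - g s))"
      using D le by (intro sum_mono) (auto simp: interval_family_def)
    also have "\<dots> = (\<Sum>(s, t)\<in>D. norm (f t - f s)) + (\<Sum>(s, t)\<in>D. norm (g t - g s))"
      by (simp add: case_prod_unfold sum.distrib)
    also have "\<dots> < e / 2 + e / 2"
      by (intro add_strict_mono d1[rule_format] d2[rule_format]) (use D in \<open>auto simp: interval_family_def\<close>)
    finally show "(\<Sum>(s, t)\<in>D. norm (h t - h s)) < e" by simp
  qed
qed

lemma absolutely_continuous_path_subinterval:
  assumes "absolutely_continuous_path a b f" "a \<le> c" "d \<le> b"
  shows "absolutely_continuous_path c d f"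
  unfolding absolutely_continuous_path_iff
proof (intro allI impI)
  fix e :: real assume "e > 0"
  obtain d1 where "d1 > 0" and d1: "\<forall>D. interval_family a b d1 D
        \<longrightarrow> (\<Sum>(s, t)\<in>D. norm (f t - f s)) < e"
    using assms(1)[unfolded absolutely_continuous_path_iff, rule_format, OF \<open>e > 0\<close>] by blast
  show "\<exists>\<delta>>0. \<forall>D. interval_family c d \<delta> D
        \<longrightarrow> (\<Sum>(s, t)\<in>D. norm (f t - f s)) < e"
    using \<open>d1 > 0\<close> assms(2,3)
    by (intro exI[of _ d1] conjI allI impI d1[rule_format]) (auto simp: interval_family_def)
qed

lemma absolutely_continuous_path_imp_continuous_on:
  assumes "absolutely_continuous_path a b f"
  shows "continuous_on {a..b} f"
  unfolding continuous_on_iff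
proof (intro ballI allI impI)
  fix x e :: real assume x: "x \<in> {a..b}" and "e > 0"
  obtain d1 where "d1 > 0" and d1: "\<forall>D. interval_family a b d1 D
        \<longrightarrow> (\<Sum>(s, t)\<in>D. norm (f t - f s)) < e"
    using assms[unfolded absolutely_continuous_path_iff, rule_format, OF \<open>e > 0\<close>] by blast
  have "dist (f y) (f x) < e" if y: "y \<in> {a..b}" "dist y x < d1" for y
    using d1[rule_format, of "{(min x y, max x y)}"] x y
    by (cases "x \<le> y") (auto simp: interval_family_def disjoint_family_on_def dist_norm norm_minus_commute)
  then show "\<exists>d>0. \<forall>x'\<in>{a..b}. dist x' x < d \<longrightarrow> dist (f x') (f x) < e"
    using \<open>d1 > 0\<close> by blast
qed

text \<open>
  The scalar case is the monotonicity of \<open>u \<bullet> \<gamma> t - M t\<close> for a unit vector \<open>u\<close>; the choice of \<open>u\<close> in the direction of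
  \<open>\<gamma> t - \<gamma> s\<close> recovers the norm of the increment.
\<close>

lemma absolutely_continuous_path_bounded_deriv_imp_lipschitz:
  fixes \<gamma> :: "real \<Rightarrow> 'a::euclidean_space"
  assumes ac: "absolutely_continuous_path a b \<gamma>" and "M \<ge> 0"
    and N: "negligible N"
    and deriv: "\<And>t. t \<in> {a..b} - N \<Longrightarrow> \<exists>D. norm D \<le> M \<and> (\<gamma> has_vector_derivative D) (at t within {a..b})"
  shows "M-lipschitz_on {a..b} \<gamma>"
proof (rule lipschitz_onI)
  have le: "norm (\<gamma> t - \<gamma> s) \<le> M * (t - s)" if st: "a \<le> s" "s \<le> t" "t \<le> b" for s t
  proof (cases "\<gamma> t = \<gamma> s")
    case True
    then show ?thesis using st \<open>M \<ge> 0\<close> by simp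
  next
    case False
    define u where "u = sgn (\<gamma> t - \<gamma> s)"
    have u: "norm u = 1" unfolding u_def norm_sgn using False by simp
    define h where "h = (\<lambda>\<tau>. u \<bullet> \<gamma> \<tau> - M * \<tau>)"
    have "absolutely_continuous_path s t h"
    proof (rule absolutely_continuous_path_dominated)
      show "absolutely_continuous_path s t \<gamma>"
        using ac st by (rule_tac absolutely_continuous_path_subinterval) auto
      show "absolutely_continuous_path s t (\<lambda>\<tau>. M * \<tau>)"
      proof (rule lipschitz_imp_absolutely_continuous_path, rule lipschitz_onI)
        show "dist (M * x) (M * y) \<le> M * dist x y" for x y
          using \<open>M \<ge> 0\<close> by (metis abs_mult abs_of_nonneg dist_real_def order_refl right_diff_distrib)
      qed fact
      fix s' t' :: real
      have "norm (h t' - h s') = \<bar>u \<bullet> (\<gamma> t' - \<gamma> s') - (M * t' - M * s')\<bar>"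
        by (simp add: h_def inner_diff_right algebra_simps)
      also have "\<dots> \<le> \<bar>u \<bullet> (\<gamma> t' - \<gamma> s')\<bar> + \<bar>M * t' - M * s'\<bar>" by linarith
      also have "\<bar>u \<bullet> (\<gamma> t' - \<gamma> s')\<bar> \<le> norm (\<gamma> t' - \<gamma> s')"
        using Cauchy_Schwarz_ineq2[of u "\<gamma> t' - \<gamma> s'"] u by simp
      finally show "norm (h t' - h s') \<le> norm (\<gamma> t' - \<gamma> s') + norm (M * t' - M * s')" by simp
    qed
    moreover have "AE \<tau> in lebesgue_on {s..t}. \<exists>D\<le>0. (h has_vector_derivative D) (at \<tau> within {s..t})"
    proof -
      have "\<exists>D\<le>0. (h has_vector_derivative D) (at \<tau> within {s..t})" if \<tau>: "\<tau> \<in> {s..t} - N" for \<tau>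
      proof -
        obtain D where D: "norm D \<le> M" "(\<gamma> has_vector_derivative D) (at \<tau> within {a..b})"
          using deriv[of \<tau>] \<tau> st by auto
        have "(\<gamma> has_vector_derivative D) (at \<tau> within {s..t})"
          using D(2) st by (rule_tac has_vector_derivative_within_subset) auto
        then have "(h has_vector_derivative (u \<bullet> D - M)) (at \<tau> within {s..t})"
          unfolding h_def
          by (auto intro!: derivative_eq_intros bounded_linear.has_vector_derivative[OF bounded_linear_inner_right])
        moreover have "u \<bullet> D - M \<le> 0"
          using Cauchy_Schwarz_ineq2[of u D] u D(1) by auto
        ultimately show ?thesis by blast
      qed
      then have "AE \<tau> in lebesgue. \<tau> \<in> {s..t} \<longrightarrow> (\<exists>D\<le>0. (h has_vector_derivative D) (at \<tau> within {s..t}))"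
        unfolding eventually_ae_filter_negligible using N by blast
      then show ?thesis by (subst AE_restrict_space_iff) auto
    qed
    ultimately have "h t \<le> h s"
      using absolutely_continuous_path_nonincreasing st(2) by blast
    then have "u \<bullet> (\<gamma> t - \<gamma> s) \<le> M * (t - s)" by (simp add: h_def inner_diff_right algebra_simps)
    moreover have "u \<bullet> (\<gamma> t - \<gamma> s) = norm (\<gamma> t - \<gamma> s)"
      using False by (simp add: u_def sgn_div_norm dot_square_norm power2_eq_square)
    ultimately show ?thesis by simp
  qed
  fix x y assume "x \<in> {a..b}" "y \<in> {a..b}"
  then show "dist (\<gamma> x) (\<gamma> y) \<le> M * dist x y"
    using le[of x y] le[of y x]
    by (cases "x \<le> y") (auto simp: dist_norm norm_minus_commute dist_real_def)
qed (fact \<open>M \<ge> 0\<close>)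

section \<open>Subunit paths and the Carnot-Caratheodory distance\<close>

definition subunit_vectors :: "('m::finite \<Rightarrow> real ^ 'n \<Rightarrow> real ^ 'n) \<Rightarrow> real ^ 'n \<Rightarrow> (real ^ 'n) set" where
  "subunit_vectors X x = {\<Sum>j\<in>UNIV. \<theta> j *\<^sub>R X j x | \<theta>. (\<Sum>j\<in>UNIV. (\<theta> j)\<^sup>2) \<le> 1}"

lemma subunit_coefficient_le_1:
  fixes \<theta> :: "'m::finite \<Rightarrow> real"
  assumes "(\<Sum>j\<in>UNIV. (\<theta> j)\<^sup>2) \<le> 1"
  shows "\<bar>\<theta> j\<bar> \<le> 1"
proof -
  have "(\<theta> j)\<^sup>2 \<le> (\<Sum>j\<in>UNIV. (\<theta> j)\<^sup>2)" by (rule member_le_sum) auto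
  then show ?thesis using assms abs_square_le_1[of "\<theta> j"] by linarith
qed

lemma uminus_subunit_vectors: "v \<in> subunit_vectors X x \<Longrightarrow> - v \<in> subunit_vectors X x"
  unfolding subunit_vectors_def
proof clarify
  fix \<theta> :: "'b \<Rightarrow> real" assume "(\<Sum>j\<in>UNIV. (\<theta> j)\<^sup>2) \<le> 1"
  then show "\<exists>\<theta>'. - (\<Sum>j\<in>UNIV. \<theta> j *\<^sub>R X j x) = (\<Sum>j\<in>UNIV. \<theta>' j *\<^sub>R X j x) \<and> (\<Sum>j\<in>UNIV. (\<theta>' j)\<^sup>2) \<le> 1"
    by (intro exI[of _ "\<lambda>j. - \<theta> j"]) (simp add: sum_negf)
qed

text \<open>
  The velocity of a subunit path is bounded by the fields on its compact image, so the path is Lipschitz.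
  Lipschitz continuity, unlike absolute continuity, is trivially stable under reversal and concatenation; with this
  characterization the pseudometric properties of the distance become routine.
\<close>

lemma subunit_path_iff:
  fixes X :: "'m::finite \<Rightarrow> real ^ 'n \<Rightarrow> real ^ 'n"
  assumes cont: "\<And>j. continuous_on UNIV (X j)"
  shows "subunit_path X T \<gamma> \<longleftrightarrow> (\<exists>C. C-lipschitz_on {0..T} \<gamma>) \<and>
    (\<exists>N. negligible N \<and> (\<forall>t\<in>{0..T} - N. \<exists>v\<in>subunit_vectors X (\<gamma> t). (\<gamma> has_vector_derivative v) (at t within {0..T})))"
    (is "_ \<longleftrightarrow> ?L \<and> ?D")
proof
  assume su: "subunit_path X T \<gamma>"
  then have ac: "absolutely_continuous_path 0 T \<gamma>" unfolding subunit_path_def by auto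
  obtain \<theta> :: "'m \<Rightarrow> real \<Rightarrow> real" where "AE t in lebesgue_on {0..T}.
        (\<gamma> has_vector_derivative (\<Sum>j\<in>UNIV. \<theta> j t *\<^sub>R X j (\<gamma> t))) (at t within {0..T}) \<and>
        (\<Sum>j\<in>UNIV. (\<theta> j t)\<^sup>2) \<le> 1"
    using su unfolding subunit_path_def by auto
  then have "AE t in lebesgue. t \<in> {0..T} \<longrightarrow>
        (\<gamma> has_vector_derivative (\<Sum>j\<in>UNIV. \<theta> j t *\<^sub>R X j (\<gamma> t))) (at t within {0..T}) \<and>
        (\<Sum>j\<in>UNIV. (\<theta> j t)\<^sup>2) \<le> 1"
    by (subst (asm) AE_restrict_space_iff) auto
  then obtain N where N: "negligible N" and N': "{t. \<not> (t \<in> {0..T} \<longrightarrow>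
        (\<gamma> has_vector_derivative (\<Sum>j\<in>UNIV. \<theta> j t *\<^sub>R X j (\<gamma> t))) (at t within {0..T}) \<and>
        (\<Sum>j\<in>UNIV. (\<theta> j t)\<^sup>2) \<le> 1)} \<subseteq> N"
    unfolding eventually_ae_filter_negligible by blast
  have *: "\<exists>v\<in>subunit_vectors X (\<gamma> t). (\<gamma> has_vector_derivative v) (at t within {0..T})" if "t \<in> {0..T} - N" for t
  proof -
    have "(\<gamma> has_vector_derivative (\<Sum>j\<in>UNIV. \<theta> j t *\<^sub>R X j (\<gamma> t))) (at t within {0..T})"
      "(\<Sum>j\<in>UNIV. (\<theta> j t)\<^sup>2) \<le> 1" using that N' by blast+
    then show ?thesis unfolding subunit_vectors_def by auto
  qed
  define S where "S x = (\<Sum>j\<in>UNIV. norm (X j x))" for x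
  have "continuous_on {0..T} (\<lambda>t. S (\<gamma> t))"
    unfolding S_def
    by (intro continuous_intros continuous_on_compose2[OF cont] absolutely_continuous_path_imp_continuous_on[OF ac]) auto
  then have "bounded ((\<lambda>t. S (\<gamma> t)) ` {0..T})"
    by (intro compact_imp_bounded compact_continuous_image) auto
  then obtain M where M: "\<And>t. t \<in> {0..T} \<Longrightarrow> \<bar>S (\<gamma> t)\<bar> \<le> M"
    unfolding bounded_iff by force
  have bound: "norm v \<le> max M 0" if "t \<in> {0..T}" "v \<in> subunit_vectors X (\<gamma> t)" for t v
  proof -
    obtain \<theta>' :: "'m \<Rightarrow> real" where "v = (\<Sum>j\<in>UNIV. \<theta>' j *\<^sub>R X j (\<gamma> t))" "(\<Sum>j\<in>UNIV. (\<theta>' j)\<^sup>2) \<le> 1"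
      using \<open>v \<in> _\<close> unfolding subunit_vectors_def by auto
    then have "norm v \<le> (\<Sum>j\<in>UNIV. \<bar>\<theta>' j\<bar> * norm (X j (\<gamma> t)))"
      by (simp add: sum_norm_le)
    also have "\<dots> \<le> S (\<gamma> t)"
      unfolding S_def using subunit_coefficient_le_1 \<open>(\<Sum>j\<in>UNIV. (\<theta>' j)\<^sup>2) \<le> 1\<close>
      by (intro sum_mono mult_left_le_one_le) auto
    finally show ?thesis using M[OF \<open>t \<in> _\<close>] by simp
  qed
  have "(max M 0)-lipschitz_on {0..T} \<gamma>"
  proof (rule absolutely_continuous_path_bounded_deriv_imp_lipschitz[OF ac _ N])
    fix t assume "t \<in> {0..T} - N"
    then show "\<exists>D. norm D \<le> max M 0 \<and> (\<gamma> has_vector_derivative D) (at t within {0..T})"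
      using *[of t] bound[of t] by blast
  qed simp
  then show "?L \<and> ?D" using * N by blast
next
  assume LD: "?L \<and> ?D"
  then obtain N where N: "negligible N" "\<And>t. t \<in> {0..T} - N \<Longrightarrow> \<exists>v\<in>subunit_vectors X (\<gamma> t). (\<gamma> has_vector_derivative v) (at t within {0..T})"
    by blast
  have "\<exists>\<theta> :: 'm \<Rightarrow> real. t \<in> {0..T} - N \<longrightarrow>
     (\<gamma> has_vector_derivative (\<Sum>j\<in>UNIV. \<theta> j *\<^sub>R X j (\<gamma> t))) (at t within {0..T}) \<and> (\<Sum>j\<in>UNIV. (\<theta> j)\<^sup>2) \<le> 1" for t
    using N(2)[of t] unfolding subunit_vectors_def by fast
  then obtain \<theta> :: "real \<Rightarrow> 'm \<Rightarrow> real" where \<theta>: "\<And>t. t \<in> {0..T} - N \<longrightarrow>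
     (\<gamma> has_vector_derivative (\<Sum>j\<in>UNIV. \<theta> t j *\<^sub>R X j (\<gamma> t))) (at t within {0..T}) \<and> (\<Sum>j\<in>UNIV. (\<theta> t j)\<^sup>2) \<le> 1"
    by metis
  have "AE t in lebesgue. t \<in> {0..T} \<longrightarrow>
        (\<gamma> has_vector_derivative (\<Sum>j\<in>UNIV. \<theta> t j *\<^sub>R X j (\<gamma> t))) (at t within {0..T}) \<and>
        (\<Sum>j\<in>UNIV. (\<theta> t j)\<^sup>2) \<le> 1"
    unfolding eventually_ae_filter_negligible using N(1) \<theta> by blast
  then have "AE t in lebesgue_on {0..T}.
        (\<gamma> has_vector_derivative (\<Sum>j\<in>UNIV. \<theta> t j *\<^sub>R X j (\<gamma> t))) (at t within {0..T}) \<and>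
        (\<Sum>j\<in>UNIV. (\<theta> t j)\<^sup>2) \<le> 1"
    by (subst AE_restrict_space_iff) auto
  then show "subunit_path X T \<gamma>"
    unfolding subunit_path_def using LD lipschitz_imp_absolutely_continuous_path
    by (intro conjI exI[of _ "\<lambda>j t. \<theta> t j"]) blast+
qed

lemma negligible_affine_image:
  fixes N :: "real set"
  assumes "negligible N" and "c \<noteq> 0"
  shows "negligible ((\<lambda>t. c * t + d) ` N)"
  by (rule negligible_differentiable_image_negligible[OF _ assms(1)])
     (auto intro!: derivative_intros simp: differentiable_on_def)

lemma subunit_path_reverse:
  fixes X :: "'m::finite \<Rightarrow> real ^ 'n \<Rightarrow> real ^ 'n"
  assumes cont: "\<And>j. continuous_on UNIV (X j)"
    and su: "subunit_path X T \<gamma>"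
  shows "subunit_path X T (\<lambda>t. \<gamma> (T - t))"
proof -
  obtain C N where C: "C-lipschitz_on {0..T} \<gamma>" and N: "negligible N"
    and deriv: "\<And>t. t \<in> {0..T} - N \<Longrightarrow> \<exists>v\<in>subunit_vectors X (\<gamma> t). (\<gamma> has_vector_derivative v) (at t within {0..T})"
    using su unfolding subunit_path_iff[OF cont] by blast
  have "C-lipschitz_on {0..T} (\<lambda>t. \<gamma> (T - t))"
  proof (rule lipschitz_onI)
    show "dist (\<gamma> (T - x)) (\<gamma> (T - y)) \<le> C * dist x y" if "x \<in> {0..T}" "y \<in> {0..T}" for x y
      using lipschitz_onD[OF C, of "T - x" "T - y"] that by (simp add: dist_real_def abs_minus_commute)
  qed (use C lipschitz_on_nonneg in blast)
  moreover define N' where "N' = (\<lambda>t. -1 * t + T) ` N"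
  have "negligible N'" unfolding N'_def by (intro negligible_affine_image N) simp
  moreover have "\<exists>v\<in>subunit_vectors X (\<gamma> (T - t)). ((\<lambda>t. \<gamma> (T - t)) has_vector_derivative v) (at t within {0..T})"
    if t: "t \<in> {0..T} - N'" for t
  proof -
    have "T - t \<notin> N" using t unfolding N'_def by (auto simp: image_iff)
    then obtain v where v: "v \<in> subunit_vectors X (\<gamma> (T - t))" "(\<gamma> has_vector_derivative v) (at (T - t) within {0..T})"
      using deriv[of "T - t"] t by auto
    have im: "(\<lambda>t. T - t) ` {0..T} = {0..T}" by (auto simp: image_iff intro!: bexI[of _ "T - _"])
    have "((\<lambda>t. T - t) has_vector_derivative -1) (at t within {0..T})"
      by (auto intro!: derivative_eq_intros)
    then have "(\<gamma> \<circ> (\<lambda>t. T - t) has_vector_derivative (-1) *\<^sub>R v) (at t within {0..T})"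
      by (rule vector_diff_chain_within) (simp only: im v)
    then show ?thesis using uminus_subunit_vectors[OF v(1)] by (auto simp: o_def)
  qed
  ultimately show ?thesis unfolding subunit_path_iff[OF cont] by blast
qed

lemma subunit_path_concat:
  fixes X :: "'m::finite \<Rightarrow> real ^ 'n \<Rightarrow> real ^ 'n"
  assumes cont: "\<And>j. continuous_on UNIV (X j)"
    and su1: "subunit_path X T \<gamma>" and su2: "subunit_path X S \<eta>"
    and "T \<ge> 0" "S \<ge> 0" and joint: "\<gamma> T = \<eta> 0"
  shows "subunit_path X (T + S) (\<lambda>t. if t \<le> T then \<gamma> t else \<eta> (t - T))" (is "subunit_path X _ ?c")
proof -
  obtain C N where C: "C-lipschitz_on {0..T} \<gamma>" and N: "negligible N"
    and deriv: "\<And>t. t \<in> {0..T} - N \<Longrightarrow> \<exists>v\<in>subunit_vectors X (\<gamma> t). (\<gamma> has_vector_derivative v) (at t within {0..T})"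
    using su1 unfolding subunit_path_iff[OF cont] by blast
  obtain C' N' where C': "C'-lipschitz_on {0..S} \<eta>" and N': "negligible N'"
    and deriv': "\<And>t. t \<in> {0..S} - N' \<Longrightarrow> \<exists>v\<in>subunit_vectors X (\<eta> t). (\<eta> has_vector_derivative v) (at t within {0..S})"
    using su2 unfolding subunit_path_iff[OF cont] by blast
  have "C'-lipschitz_on {T..T + S} (\<lambda>t. \<eta> (t - T))"
  proof (rule lipschitz_onI)
    show "dist (\<eta> (x - T)) (\<eta> (y - T)) \<le> C' * dist x y" if "x \<in> {T..T + S}" "y \<in> {T..T + S}" for x y
      using lipschitz_onD[OF C', of "x - T" "y - T"] that by (simp add: dist_real_def)
  qed (use C' lipschitz_on_nonneg in blast)
  then have "(max C C')-lipschitz_on {0..T + S} ?c"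
    using C joint by (intro lipschitz_on_concat_max) auto
  moreover define M where "M = N \<union> (\<lambda>t. 1 * t + T) ` N' \<union> {T}"
  have "negligible M"
    unfolding M_def by (intro negligible_Un N negligible_affine_image[OF N']) auto
  moreover have "\<exists>v\<in>subunit_vectors X (?c t). (?c has_vector_derivative v) (at t within {0..T + S})"
    if t: "t \<in> {0..T + S} - M" for t
  proof (cases "t < T")
    case True
    then obtain v where v: "v \<in> subunit_vectors X (\<gamma> t)" "(\<gamma> has_vector_derivative v) (at t within {0..T})"
      using deriv[of t] t unfolding M_def by auto
    have "at t within {0..T + S} = at t within {0..T}"
      by (rule at_within_nhd[of _ "{..<T}"]) (use True \<open>S \<ge> 0\<close> in auto)
    then have "(\<gamma> has_vector_derivative v) (at t within {0..T + S})" using v(2) by simp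
    then have "(?c has_vector_derivative v) (at t within {0..T + S})"
      by (rule has_vector_derivative_transform_within[where d="T - t"]) (use True t in \<open>auto simp: dist_real_def\<close>)
    then show ?thesis using v(1) True by auto
  next
    case False
    then have tT: "t > T" using t unfolding M_def by auto
    have "t - T \<notin> N'" using t unfolding M_def by (auto simp: image_iff)
    then obtain v where v: "v \<in> subunit_vectors X (\<eta> (t - T))" "(\<eta> has_vector_derivative v) (at (t - T) within {0..S})"
      using deriv'[of "t - T"] t tT by auto
    have im: "(\<lambda>t. t - T) ` {T..T + S} = {0..S}" by (auto simp: image_iff intro!: bexI[of _ "_ + T"])
    have "((\<lambda>t. t - T) has_vector_derivative 1) (at t within {T..T + S})"
      by (auto intro!: derivative_eq_intros)
    then have "(\<eta> \<circ> (\<lambda>t. t - T) has_vector_derivative 1 *\<^sub>R v) (at t within {T..T + S})"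
      by (rule vector_diff_chain_within) (simp only: im v)
    moreover have "at t within {0..T + S} = at t within {T..T + S}"
      by (rule at_within_nhd[of _ "{T<..}"]) (use tT \<open>T \<ge> 0\<close> in auto)
    ultimately have "((\<lambda>t. \<eta> (t - T)) has_vector_derivative v) (at t within {0..T + S})" by (simp add: o_def)
    then have "(?c has_vector_derivative v) (at t within {0..T + S})"
      by (rule has_vector_derivative_transform_within[where d="t - T"]) (use tT t in \<open>auto simp: dist_real_def\<close>)
    then show ?thesis using v(1) tT by auto
  qed
  ultimately show ?thesis unfolding subunit_path_iff[OF cont] by blast
qed

definition joining_times :: "('m::finite \<Rightarrow> real ^ 'n \<Rightarrow> real ^ 'n) \<Rightarrow> real ^ 'n \<Rightarrow> real ^ 'n \<Rightarrow> real set" where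
  "joining_times X x y = {T. T > 0 \<and> (\<exists>\<gamma>. subunit_path X T \<gamma> \<and> \<gamma> 0 = x \<and> \<gamma> T = y)}"

lemma cc_dist_eq_Inf: "cc_dist X x y = Inf (joining_times X x y)"
  by (simp add: cc_dist_def joining_times_def)

lemma bdd_below_joining_times: "bdd_below (joining_times X x y)"
  by (rule bdd_belowI[of _ 0]) (auto simp: joining_times_def)

lemma joining_times_nonempty:
  assumes "X_connected \<Omega> X" "x \<in> \<Omega>" "y \<in> \<Omega>"
  shows "joining_times X x y \<noteq> {}"
  using assms unfolding X_connected_def joining_times_def by blast

lemma joining_times_commute:
  assumes cont: "\<And>j. continuous_on UNIV (X j)"
  shows "joining_times X x y = joining_times X y x"
proof -
  have "joining_times X x y \<subseteq> joining_times X y x" for x y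
    unfolding joining_times_def
  proof clarify
    fix T \<gamma> assume "T > 0" "subunit_path X T \<gamma>"
    then show "\<exists>\<gamma>'. subunit_path X T \<gamma>' \<and> \<gamma>' 0 = \<gamma> T \<and> \<gamma>' T = \<gamma> 0"
      using subunit_path_reverse[where X=X, OF cont] by (intro exI[of _ "\<lambda>t. \<gamma> (T - t)"]) auto
  qed
  then show ?thesis by blast
qed

lemma cc_dist_commute:
  assumes "\<And>j. continuous_on UNIV (X j)"
  shows "cc_dist X x y = cc_dist X y x"
  using joining_times_commute[where X=X, OF assms] by (simp add: cc_dist_eq_Inf)

lemma cc_dist_triangle:
  assumes cont: "\<And>j. continuous_on UNIV (X j)"
    and conn: "X_connected \<Omega> X" and "x \<in> \<Omega>" "y \<in> \<Omega>" "z \<in> \<Omega>"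
  shows "cc_dist X x z \<le> cc_dist X x y + cc_dist X y z"
proof -
  have *: "cc_dist X x z \<le> T + S" if "T \<in> joining_times X x y" "S \<in> joining_times X y z" for T S
  proof -
    obtain \<gamma> \<eta> where "T > 0" "subunit_path X T \<gamma>" "\<gamma> 0 = x" "\<gamma> T = y"
      "S > 0" "subunit_path X S \<eta>" "\<eta> 0 = y" "\<eta> S = z"
      using \<open>T \<in> _\<close> \<open>S \<in> _\<close> unfolding joining_times_def by blast
    then have "T + S \<in> joining_times X x z"
      unfolding joining_times_def
      using subunit_path_concat[where X=X and T=T and \<gamma>=\<gamma> and S=S and \<eta>=\<eta>, OF cont] 
      by (intro CollectI conjI exI[of _ "\<lambda>t. if t \<le> T then \<gamma> t else \<eta> (t - T)"]) auto
    then show ?thesis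
      unfolding cc_dist_eq_Inf by (intro cInf_lower bdd_below_joining_times)
  qed
  have "cc_dist X x z - S \<le> cc_dist X x y" if "S \<in> joining_times X y z" for S
    unfolding cc_dist_eq_Inf[of X x y]
    using *[OF _ that] by (intro cInf_greatest joining_times_nonempty[OF conn]) (use assms in \<open>auto simp: algebra_simps\<close>)
  then have "cc_dist X x z - cc_dist X x y \<le> cc_dist X y z"
    unfolding cc_dist_eq_Inf[of X y z]
    by (intro cInf_greatest joining_times_nonempty[OF conn]) (use assms in \<open>auto simp: algebra_simps\<close>)
  then show ?thesis by simp
qed

lemma cc_dist_lessE:
  assumes "X_connected \<Omega> X" "x \<in> \<Omega>" "y \<in> \<Omega>" "cc_dist X x y < R"
  obtains T \<gamma> where "0 < T" "T < R" "subunit_path X T \<gamma>" "\<gamma> 0 = x" "\<gamma> T = y"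
proof -
  obtain T where "T \<in> joining_times X x y" "T < R"
    using cInf_lessD[OF joining_times_nonempty[OF assms(1-3)]] assms(4) unfolding cc_dist_eq_Inf by blast
  then show ?thesis using that unfolding joining_times_def by blast
qed

text \<open>
  In the doubling condition positivity of the measure carries measurability: \<open>measure\<close> is \<open>0\<close> on
  sets that are not measurable and on sets of infinite measure.
\<close>

lemma cc_doubling_imp_lmeasurable:
  assumes "cc_doubling \<Omega> X Q" "x \<in> \<Omega>" "r > 0"
  shows "cc_ball \<Omega> X x r \<in> lmeasurable" and "measure lebesgue (cc_ball \<Omega> X x r) > 0"
proof -
  have "measure lebesgue (cc_ball \<Omega> X x (2 * (r / 2))) > 0"
    using assms unfolding cc_doubling_def by (meson half_gt_zero)
  then show pos: "measure lebesgue (cc_ball \<Omega> X x r) > 0" by simp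
  show "cc_ball \<Omega> X x r \<in> lmeasurable"
  proof (rule fmeasurableI)
    show "cc_ball \<Omega> X x r \<in> sets lebesgue" using pos measure_notin_sets by fastforce
    show "emeasure lebesgue (cc_ball \<Omega> X x r) < \<infinity>"
      using pos by (auto simp: measure_def less_top[symmetric])
  qed
qed

text \<open>
  If \<open>y\<close> has distance \<open>R \<ge> 1\<close> from \<open>x\<close>, then \<open>B(y, R/2)\<close> misses \<open>B(x, R/2)\<close>, whereas \<open>B(y, 2R)\<close> contains \<open>B(x, 1)\<close>.
  Two doublings bound the measure of \<open>B(x, 1)\<close> by a multiple of the measure of \<open>\<Omega> - B(x, R/2)\<close>, which tends to \<open>0\<close> as \<open>R\<close>
  grows because \<open>\<Omega>\<close> has finite measure.
\<close>

lemma cc_doubling_imp_bounded_cc_dist: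
  fixes \<Omega> :: "(real ^ 'n) set" and X :: "'m::finite \<Rightarrow> real ^ 'n \<Rightarrow> real ^ 'n"
  assumes cont: "\<And>j. continuous_on UNIV (X j)" and conn: "X_connected \<Omega> X"
    and dbl: "cc_doubling \<Omega> X Q" and \<Omega>: "\<Omega> \<in> lmeasurable" and x: "x \<in> \<Omega>"
  shows "\<exists>D>0. \<forall>y\<in>\<Omega>. cc_dist X x y < D"
proof (rule ccontr)
  assume no: "\<not> ?thesis"
  have far: "\<exists>y\<in>\<Omega>. cc_dist X x y \<ge> D" if D: "D > 0" for D
    using no D by (meson not_less)
  define \<mu> where "\<mu> = (measure lebesgue :: (real ^ 'n) set \<Rightarrow> real)"
  define B where "B = cc_ball \<Omega> X"
  define tail where "tail k = \<Omega> - B x (real (Suc k))" for k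
  have Bmeas: "B y r \<in> lmeasurable" if "y \<in> \<Omega>" "r > 0" for y r
    unfolding B_def using cc_doubling_imp_lmeasurable(1)[OF dbl that] .
  have tail_meas: "tail k \<in> lmeasurable" for k
    unfolding tail_def using \<Omega> Bmeas[OF x] by (intro fmeasurable_Diff) auto
  have "\<mu> (B x 1) \<le> (2 powr Q) * (2 powr Q) * \<mu> (tail k)" for k
  proof -
    define d where "d = 2 * real (Suc k)"
    have "d > 0" by (simp add: d_def)
    obtain y where y: "y \<in> \<Omega>" "cc_dist X x y \<ge> d" using far[OF \<open>d > 0\<close>] by blast
    define R where "R = cc_dist X x y"
    have R: "R \<ge> 2" "R / 2 \<ge> real (Suc k)" using y(2) by (auto simp: R_def d_def)
    have d2: "\<mu> (B y (2 * r)) \<le> 2 powr Q * \<mu> (B y r)" if "r > 0" for r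
      using dbl y(1) that unfolding cc_doubling_def \<mu>_def B_def by blast
    have "B x 1 \<subseteq> B y (2 * R)"
    proof
      fix z assume "z \<in> B x 1"
      then have z: "z \<in> \<Omega>" "cc_dist X x z < 1" by (auto simp: B_def cc_ball_def)
      have "cc_dist X y z \<le> cc_dist X y x + cc_dist X x z" using cc_dist_triangle[where X=X, OF cont conn y(1) x z(1)] .
      then have "cc_dist X y z < 2 * R" using z(2) R cc_dist_commute[where X=X, OF cont, of y x] by (simp add: R_def)
      then show "z \<in> B y (2 * R)" using z by (simp add: B_def cc_ball_def)
    qed
    then have "\<mu> (B x 1) \<le> \<mu> (B y (2 * R))"
      unfolding \<mu>_def using Bmeas x y R by (intro measure_mono_fmeasurable) (auto intro: fmeasurableD)
    also have "\<dots> \<le> 2 powr Q * \<mu> (B y (2 * (R / 2)))" using d2[of R] R by simp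
    also have "\<dots> \<le> 2 powr Q * (2 powr Q * \<mu> (B y (R / 2)))"
      using d2[of "R / 2"] R by (intro mult_left_mono) auto
    also have "B y (R / 2) \<subseteq> tail k"
    proof
      fix z assume "z \<in> B y (R / 2)"
      then have z: "z \<in> \<Omega>" "cc_dist X y z < R / 2" by (auto simp: B_def cc_ball_def)
      have "R \<le> cc_dist X x z + cc_dist X z y" using cc_dist_triangle[where X=X, OF cont conn x z(1) y(1)] by (simp add: R_def)
      then have "cc_dist X x z \<ge> real (Suc k)" using z(2) R cc_dist_commute[where X=X, OF cont, of z y] by simp
      then show "z \<in> tail k" using z by (simp add: tail_def B_def cc_ball_def)
    qed
    then have "\<mu> (B y (R / 2)) \<le> \<mu> (tail k)"
      unfolding \<mu>_def using Bmeas y R tail_meas by (intro measure_mono_fmeasurable) (auto intro: fmeasurableD)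
    finally show ?thesis by (simp add: mult.assoc)
  qed
  moreover have "(\<lambda>k. \<mu> (tail k)) \<longlonglongrightarrow> \<mu> (\<Inter>k. tail k)"
    unfolding \<mu>_def
  proof (rule Lim_measure_decseq)
    show "range tail \<subseteq> sets lebesgue" using tail_meas by (auto intro: fmeasurableD)
    show "decseq tail" unfolding decseq_def tail_def B_def cc_ball_def by (auto intro: less_le_trans)
    show "emeasure lebesgue (tail i) \<noteq> \<infinity>" for i
      using tail_meas[of i] by (auto simp: fmeasurable_def)
  qed
  moreover have "(\<Inter>k. tail k) = {}"
  proof -
    have "\<exists>k. z \<notin> tail k" for z
    proof -
      obtain k where "cc_dist X x z < real k" using reals_Archimedean2 by blast
      then show ?thesis by (intro exI[of _ k]) (auto simp: tail_def B_def cc_ball_def)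
    qed
    then show ?thesis by auto
  qed
  ultimately have "\<mu> (B x 1) \<le> (2 powr Q) * (2 powr Q) * 0"
    by (intro LIMSEQ_le_const[OF tendsto_mult_left]) (auto simp: \<mu>_def)
  then show False
    using cc_doubling_imp_lmeasurable(2)[OF dbl x, of 1] by (simp add: \<mu>_def B_def)
qed

section \<open>Integration by parts against Lipschitz vector fields\<close>

text \<open>
  Dominated convergence of the difference quotients.  The derivative is taken within \<open>S\<close>, which covers the
  endpoints of an interval.
\<close>

lemma has_real_derivative_integral:
  fixes F :: "real \<Rightarrow> 'a \<Rightarrow> real"
  assumes int: "\<And>s. s \<in> S \<Longrightarrow> integrable M (F s)" and t: "t \<in> S"
    and F': "F' \<in> borel_measurable M"
    and der: "\<And>y. y \<in> space M \<Longrightarrow> ((\<lambda>s. F s y) has_real_derivative F' y) (at t within S)"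
    and b: "integrable M b"
    and bound: "\<And>s y. s \<in> S \<Longrightarrow> y \<in> space M \<Longrightarrow> \<bar>F s y - F t y\<bar> \<le> b y * \<bar>s - t\<bar>"
  shows "((\<lambda>s. \<integral>y. F s y \<partial>M) has_real_derivative (\<integral>y. F' y \<partial>M)) (at t within S)"
  unfolding has_field_derivative_iff tendsto_at_iff_sequentially comp_def
proof (intro allI impI)
  fix s assume s: "\<forall>i. s i \<in> S - {t}" "s \<longlonglongrightarrow> t"
  have "(\<lambda>i. \<integral>y. (F (s i) y - F t y) / (s i - t) \<partial>M) \<longlonglongrightarrow> (\<integral>y. F' y \<partial>M)"
  proof (rule integral_dominated_convergence[OF F' _ b])
    show "(\<lambda>y. (F (s i) y - F t y) / (s i - t)) \<in> borel_measurable M" for i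
      using int s t by (intro borel_measurable_divide borel_measurable_diff) (auto intro: borel_measurable_integrable)
    show "AE y in M. (\<lambda>i. (F (s i) y - F t y) / (s i - t)) \<longlonglongrightarrow> F' y"
    proof (rule AE_I2)
      fix y assume "y \<in> space M"
      from der[OF this] show "(\<lambda>i. (F (s i) y - F t y) / (s i - t)) \<longlonglongrightarrow> F' y"
        unfolding has_field_derivative_iff tendsto_at_iff_sequentially comp_def using s by blast
    qed
    show "AE y in M. norm ((F (s i) y - F t y) / (s i - t)) \<le> b y" for i
    proof (rule AE_I2)
      fix y assume "y \<in> space M"
      then show "norm ((F (s i) y - F t y) / (s i - t)) \<le> b y"
        using bound[of "s i" y] s(1) by (auto simp: field_simps)
    qed
  qed
  moreover have "(\<lambda>i. \<integral>y. (F (s i) y - F t y) / (s i - t) \<partial>M) =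
      (\<lambda>i. ((\<integral>y. F (s i) y \<partial>M) - (\<integral>y. F t y \<partial>M)) / (s i - t))"
    using int s(1) t by (intro ext) (simp add: Bochner_Integration.integral_diff)
  ultimately show "(\<lambda>i. ((\<integral>y. F (s i) y \<partial>M) - (\<integral>y. F t y \<partial>M)) / (s i - t)) \<longlonglongrightarrow> (\<integral>y. F' y \<partial>M)"
    by (simp only:)
qed

lemma integrable_continuous_compact_support:
  fixes f :: "'a::euclidean_space \<Rightarrow> real"
  assumes "continuous_on UNIV f" and "\<And>y. norm y > R \<Longrightarrow> f y = 0"
  shows "integrable lborel f"
proof -
  have "integrable lborel (\<lambda>x. indicator (cball 0 R) x *\<^sub>R f x)"
    using assms(1) by (intro borel_integrable_compact) (auto intro: continuous_on_subset)
  moreover have "(\<lambda>x. indicator (cball 0 R) x *\<^sub>R f x) = f"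
    using assms(2) by (force simp: indicator_def)
  ultimately show ?thesis by simp
qed

lemma bounded_continuous_compact_support:
  fixes f :: "'a::euclidean_space \<Rightarrow> 'b::real_normed_vector"
  assumes "continuous_on UNIV f" and "\<And>y. norm y > R \<Longrightarrow> f y = 0"
  shows "\<exists>B\<ge>0. \<forall>y. norm (f y) \<le> B"
proof -
  have "bounded (f ` cball 0 R)"
    using assms(1) by (intro compact_imp_bounded compact_continuous_image) (auto intro: continuous_on_subset)
  then obtain B where "B > 0" and B: "\<And>y. y \<in> cball 0 R \<Longrightarrow> norm (f y) \<le> B" 
    unfolding bounded_pos by force
  have "norm (f y) \<le> B" for y
    using B[of y] assms(2)[of y] \<open>B > 0\<close> by (cases "norm y > R") auto
  then show ?thesis using \<open>B > 0\<close> by (intro exI[of _ B]) auto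
qed

lemma gradient_eq_0_outside_support:
  fixes w :: "'a::euclidean_space \<Rightarrow> real"
  assumes w: "\<And>x. (w has_derivative (\<lambda>h. W x \<bullet> h)) (at x)"
    and "open U" "x \<in> U" "\<And>y. y \<in> U \<Longrightarrow> w y = 0"
  shows "W x = 0"
proof -
  have "((\<lambda>_. 0) has_derivative (\<lambda>h. W x \<bullet> h)) (at x)"
    by (rule has_derivative_transform_within_open[OF w assms(2,3)]) (use assms(4) in auto)
  then have "(\<lambda>h. W x \<bullet> h) = (\<lambda>h. 0)"
    by (rule has_derivative_unique) (rule has_derivative_const)
  then show ?thesis using inner_eq_zero_iff by metis
qed

lemma compactly_supported_C1_lipschitz:
  fixes w :: "'a::euclidean_space \<Rightarrow> real"
  assumes w: "\<And>x. (w has_derivative (\<lambda>h. W x \<bullet> h)) (at x)" and W: "continuous_on UNIV W"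
    and R: "\<And>y. norm y > R \<Longrightarrow> w y = 0"
  shows "\<exists>B\<ge>0. \<forall>x y. \<bar>w x - w y\<bar> \<le> B * norm (x - y)"
proof -
  have "W y = 0" if "norm y > R" for y
    by (rule gradient_eq_0_outside_support[OF w, of "- cball 0 R"]) (use R that in auto)
  then obtain B where "B \<ge> 0" and B: "\<And>y. norm (W y) \<le> B"
    using bounded_continuous_compact_support[OF W] by blast
  have "norm (w x - w y) \<le> B * norm (x - y)" for x y
  proof (rule differentiable_bound[OF convex_UNIV])
    show "(w has_derivative (\<lambda>h. W x \<bullet> h)) (at x within UNIV)" for x using w by simp
    show "onorm (\<lambda>h. W x \<bullet> h) \<le> B" for x
    proof (rule onorm_le)
      fix h have "norm (W x \<bullet> h) \<le> norm (W x) * norm h" using Cauchy_Schwarz_ineq2 by simp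
      also have "\<dots> \<le> B * norm h" using B by (simp add: mult_right_mono)
      finally show "norm (W x \<bullet> h) \<le> B * norm h" .
    qed
  qed auto
  then show ?thesis using \<open>B \<ge> 0\<close> by auto
qed

lemma lborel_integral_translation:
  fixes f :: "'a::euclidean_space \<Rightarrow> real"
  assumes "f \<in> borel_measurable borel"
  shows "(\<integral>y. f (c + y) \<partial>lborel) = (\<integral>y. f y \<partial>lborel)"
proof -
  have "(\<integral>y. f y \<partial>lborel) = (\<integral>y. f y \<partial>distr lborel borel ((+) c))" by (simp add: lborel_distr_plus)
  also have "\<dots> = (\<integral>y. f (c + y) \<partial>lborel)" using assms by (intro integral_distr) auto
  finally show ?thesis by simp
qed

text \<open>
  Integration by parts for a coefficient that is only Lipschitz, without Rademacher's theorem: the integral is the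
  derivative at \<open>0\<close> of \<open>\<integral> a(y) w(y + t e) dy\<close>.  By translation invariance the difference quotients of this function
  equal \<open>\<integral> (a(y - t e) - a(y)) / t w(y) dy\<close>, and these are bounded by \<open>L \<integral> |w|\<close>.
\<close>

lemma integral_lipschitz_mult_partial_deriv_le:
  fixes w a :: "'a::euclidean_space \<Rightarrow> real" and L :: real
  assumes a: "L-lipschitz_on UNIV a"
    and w: "\<And>x. (w has_derivative (\<lambda>h. W x \<bullet> h)) (at x)" and W: "continuous_on UNIV W"
    and R: "\<And>y. norm y > R \<Longrightarrow> w y = 0" and e: "norm e = 1"
  shows "\<bar>\<integral>y. a y * (W y \<bullet> e) \<partial>lborel\<bar> \<le> L * (\<integral>y. \<bar>w y\<bar> \<partial>lborel)"
proof -
  have ca: "continuous_on UNIV a" using a by (rule lipschitz_on_continuous_on)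
  have cw: "continuous_on UNIV w" by (rule has_derivative_continuous_on) (use w in simp)
  obtain B where "B \<ge> 0" and B: "\<And>x y. \<bar>w x - w y\<bar> \<le> B * norm (x - y)"
    using compactly_supported_C1_lipschitz[OF w W R] by blast
  define I where "I t = (\<integral>y. a y * w (y + t *\<^sub>R e) \<partial>lborel)" for t
  have far: "w (y + t *\<^sub>R e) = 0" if "norm y > R + 1" "t \<in> {-1<..<1}" for y t
  proof (rule R)
    have "norm y \<le> norm (y + t *\<^sub>R e) + norm (t *\<^sub>R e)"
      using norm_triangle_ineq4[of "y + t *\<^sub>R e" "t *\<^sub>R e"] by simp
    then show "norm (y + t *\<^sub>R e) > R" using that e by auto
  qed
  have int: "integrable lborel (\<lambda>y. a y * w (y + t *\<^sub>R e))" if "t \<in> {-1<..<1}" for t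
    by (rule integrable_continuous_compact_support[where R="R+1"])
       (use far that in \<open>auto intro!: continuous_intros ca continuous_on_compose2[OF cw]\<close>)
  have "(I has_real_derivative (\<integral>y. a y * (W y \<bullet> e) \<partial>lborel)) (at 0 within {-1<..<1})"
    unfolding I_def
  proof (rule has_real_derivative_integral[where b="\<lambda>y. indicator (cball 0 (R + 1)) y *\<^sub>R (\<bar>a y\<bar> * B)"])
    show "integrable lborel (\<lambda>y. indicator (cball 0 (R + 1)) y *\<^sub>R (\<bar>a y\<bar> * B))"
      by (intro borel_integrable_compact) (auto intro!: continuous_intros continuous_on_subset[OF ca])
    have "(\<lambda>y. a y * (W y \<bullet> e)) \<in> borel_measurable borel"
      by (intro borel_measurable_continuous_onI continuous_intros ca W)
    then show "(\<lambda>y. a y * (W y \<bullet> e)) \<in> borel_measurable lborel" by simp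
    fix y
    have "((\<lambda>t. w (y + t *\<^sub>R e)) has_derivative (\<lambda>t. W (y + 0 *\<^sub>R e) \<bullet> (t *\<^sub>R e))) (at 0 within {-1<..<1})"
      by (rule has_derivative_compose[OF _ w]) (auto intro!: derivative_eq_intros)
    then have "((\<lambda>t. w (y + t *\<^sub>R e)) has_real_derivative (W y \<bullet> e)) (at 0 within {-1<..<1})"
      by (simp add: has_field_derivative_def mult.commute[of _ "W y \<bullet> e"] mult_commute_abs)
    then show "((\<lambda>t. a y * w (y + t *\<^sub>R e)) has_real_derivative a y * (W y \<bullet> e)) (at 0 within {-1<..<1})"
      by (rule DERIV_cmult)
    fix t :: real assume t: "t \<in> {-1<..<1}"
    show "\<bar>a y * w (y + t *\<^sub>R e) - a y * w (y + 0 *\<^sub>R e)\<bar> \<le> indicator (cball 0 (R + 1)) y *\<^sub>R (\<bar>a y\<bar> * B) * \<bar>t - 0\<bar>"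
    proof (cases "norm y > R + 1")
      case True
      then show ?thesis using far[OF True t] far[OF True, of 0] by simp
    next
      case False
      have "\<bar>a y * w (y + t *\<^sub>R e) - a y * w (y + 0 *\<^sub>R e)\<bar> = \<bar>a y\<bar> * \<bar>w (y + t *\<^sub>R e) - w y\<bar>"
        by (simp add: right_diff_distrib[symmetric] abs_mult)
      also have "\<dots> \<le> \<bar>a y\<bar> * (B * norm (t *\<^sub>R e))"
        using B[of "y + t *\<^sub>R e" y] by (intro mult_left_mono) auto
      finally show ?thesis using False e by (simp add: mult.assoc)
    qed
  qed (use int in auto)
  then have lim: "((\<lambda>t. (I t - I 0) / t) \<longlongrightarrow> (\<integral>y. a y * (W y \<bullet> e) \<partial>lborel)) (at 0)"
    by (simp add: has_field_derivative_iff at_within_open[of 0 "{-1<..<1}"])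
  have bound: "\<bar>I t - I 0\<bar> \<le> L * (\<integral>y. \<bar>w y\<bar> \<partial>lborel) * \<bar>t\<bar>" if t: "t \<in> {-1<..<1}" for t
  proof -
    have intw: "integrable lborel (\<lambda>y. \<bar>w y\<bar>)"
      by (rule integrable_continuous_compact_support[where R=R]) (use R cw in \<open>auto intro!: continuous_intros\<close>)
    have int2: "integrable lborel (\<lambda>y. a (- (t *\<^sub>R e) + y) * w y)"
      by (rule integrable_continuous_compact_support[where R=R])
         (use R in \<open>auto intro!: continuous_intros cw continuous_on_compose2[OF ca]\<close>)
    have "I t = (\<integral>y. a (- (t *\<^sub>R e) + y) * w (- (t *\<^sub>R e) + y + t *\<^sub>R e) \<partial>lborel)"
      unfolding I_def
      by (rule lborel_integral_translation[symmetric])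
         (auto intro!: borel_measurable_continuous_onI continuous_intros ca continuous_on_compose2[OF cw])
    also have "\<dots> = (\<integral>y. a (- (t *\<^sub>R e) + y) * w y \<partial>lborel)" by simp
    finally have "I t - I 0 = (\<integral>y. a (- (t *\<^sub>R e) + y) * w y \<partial>lborel) - (\<integral>y. a y * w y \<partial>lborel)"
      by (simp add: I_def)
    also have "\<dots> = (\<integral>y. a (- (t *\<^sub>R e) + y) * w y - a y * w y \<partial>lborel)"
      using int2 int[of 0] by (simp add: Bochner_Integration.integral_diff)
    also have "\<bar>\<dots>\<bar> \<le> (\<integral>y. \<bar>a (- (t *\<^sub>R e) + y) * w y - a y * w y\<bar> \<partial>lborel)"
      by (rule integral_abs_bound)
    also have "\<dots> \<le> (\<integral>y. (L * \<bar>t\<bar>) * \<bar>w y\<bar> \<partial>lborel)"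
    proof (rule integral_mono)
      show "integrable lborel (\<lambda>y. \<bar>a (- (t *\<^sub>R e) + y) * w y - a y * w y\<bar>)"
        using int2 int[of 0] by (intro integrable_abs Bochner_Integration.integrable_diff) auto
      show "integrable lborel (\<lambda>y. (L * \<bar>t\<bar>) * \<bar>w y\<bar>)" using intw by simp
      fix y
      have "\<bar>a (- (t *\<^sub>R e) + y) - a y\<bar> \<le> L * \<bar>t\<bar>"
        using lipschitz_onD[OF a, of "- (t *\<^sub>R e) + y" y] e by (simp add: dist_norm)
      then have "\<bar>a (- (t *\<^sub>R e) + y) - a y\<bar> * \<bar>w y\<bar> \<le> L * \<bar>t\<bar> * \<bar>w y\<bar>" by (rule mult_right_mono) simp
      then show "\<bar>a (- (t *\<^sub>R e) + y) * w y - a y * w y\<bar> \<le> L * \<bar>t\<bar> * \<bar>w y\<bar>"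
        by (simp add: left_diff_distrib[symmetric] abs_mult)
    qed
    finally show ?thesis by (simp add: mult_ac)
  qed
  have "eventually (\<lambda>t. \<bar>(I t - I 0) / t\<bar> \<le> L * (\<integral>y. \<bar>w y\<bar> \<partial>lborel)) (at (0::real))"
    unfolding eventually_at
  proof (intro exI[of _ 1] conjI ballI impI)
    fix t :: real assume t: "t \<noteq> 0 \<and> dist t 0 < 1"
    then have "\<bar>I t - I 0\<bar> \<le> L * (\<integral>y. \<bar>w y\<bar> \<partial>lborel) * \<bar>t\<bar>" by (intro bound) auto
    then show "\<bar>(I t - I 0) / t\<bar> \<le> L * (\<integral>y. \<bar>w y\<bar> \<partial>lborel)" using t by (simp add: field_simps)
  qed simp
  then show ?thesis
    by (rule tendsto_upperbound[OF tendsto_rabs[OF lim]]) simp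
qed

lemma integral_lipschitz_inner_gradient_le:
  fixes w :: "'a::euclidean_space \<Rightarrow> real" and Y :: "'a \<Rightarrow> 'a" and L :: real
  assumes Y: "L-lipschitz_on UNIV Y"
    and w: "\<And>x. (w has_derivative (\<lambda>h. W x \<bullet> h)) (at x)" and W: "continuous_on UNIV W"
    and R: "\<And>y. norm y > R \<Longrightarrow> w y = 0"
  shows "\<bar>\<integral>y. Y y \<bullet> W y \<partial>lborel\<bar> \<le> DIM('a) * L * (\<integral>y. \<bar>w y\<bar> \<partial>lborel)"
proof -
  have W0: "W y = 0" if "norm y > R" for y
    by (rule gradient_eq_0_outside_support[OF w, of "- cball 0 R"]) (use R that in auto)
  have lip: "L-lipschitz_on UNIV (\<lambda>y. Y y \<bullet> b)" if "b \<in> Basis" for b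
  proof (rule lipschitz_onI)
    fix x y
    have "dist (Y x \<bullet> b) (Y y \<bullet> b) = \<bar>(Y x - Y y) \<bullet> b\<bar>" by (simp add: dist_real_def inner_diff_left)
    also have "\<dots> \<le> dist (Y x) (Y y)" using Basis_le_norm[OF that] by (simp add: dist_norm)
    also have "\<dots> \<le> L * dist x y" using lipschitz_onD[OF Y] by simp
    finally show "dist (Y x \<bullet> b) (Y y \<bullet> b) \<le> L * dist x y" .
  qed (use Y lipschitz_on_nonneg in blast)
  have int: "integrable lborel (\<lambda>y. (Y y \<bullet> b) * (W y \<bullet> b))" if "b \<in> Basis" for b
    by (rule integrable_continuous_compact_support[where R=R])
       (use W0 W lipschitz_on_continuous_on[OF Y] in \<open>auto intro!: continuous_intros\<close>)
  have "(\<integral>y. Y y \<bullet> W y \<partial>lborel) = (\<integral>y. (\<Sum>b\<in>Basis. (Y y \<bullet> b) * (W y \<bullet> b)) \<partial>lborel)"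
    by (subst euclidean_inner) simp
  also have "\<dots> = (\<Sum>b\<in>Basis. \<integral>y. (Y y \<bullet> b) * (W y \<bullet> b) \<partial>lborel)"
    using int by (rule Bochner_Integration.integral_sum)
  also have "\<bar>\<dots>\<bar> \<le> (\<Sum>b\<in>(Basis::'a set). \<bar>\<integral>y. (Y y \<bullet> b) * (W y \<bullet> b) \<partial>lborel\<bar>)" by (rule sum_abs)
  also have "\<dots> \<le> (\<Sum>b\<in>(Basis::'a set). L * (\<integral>y. \<bar>w y\<bar> \<partial>lborel))"
    by (intro sum_mono integral_lipschitz_mult_partial_deriv_le[OF lip w W R]) auto
  finally show ?thesis by simp
qed

text \<open>
  The functions \<open>1 - \<psi> n / c\<close> converge to the indicator \<open>g\<close> of the complement of \<open>\<Omega>\<close> and their derivatives along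
  \<open>Y\<close> converge to \<open>0\<close>.  So \<open>g\<close> is invariant along \<open>Y\<close> in the weak sense, and the derivative in \<open>\<integral> g Y(\<zeta>)\<close> can be
  moved from \<open>\<zeta>\<close> to the coefficients of \<open>Y\<close>, at the price of their Lipschitz constant.  The
  estimate is obtained by applying the integration by parts inequality to \<open>(1 - \<psi> n / c) \<zeta>\<close>.
\<close>

lemma weak_transport_complement:
  fixes \<psi> :: "nat \<Rightarrow> 'a::euclidean_space \<Rightarrow> real" and Y :: "'a \<Rightarrow> 'a" and L :: real
  assumes Y: "L-lipschitz_on UNIV Y" and \<Omega>: "open \<Omega>"
    and \<psi>: "\<And>n x. (\<psi> n has_derivative (\<lambda>h. P n x \<bullet> h)) (at x)" and P: "\<And>n. continuous_on UNIV (P n)"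
    and \<psi>0: "\<And>n x. x \<notin> \<Omega> \<Longrightarrow> \<psi> n x = 0" and "c \<noteq> 0"
    and int\<psi>: "\<And>n. integrable lborel (\<lambda>y. indicator \<Omega> y * \<bar>\<psi> n y - c\<bar>)"
    and lim\<psi>: "(\<lambda>n. \<integral>y. indicator \<Omega> y * \<bar>\<psi> n y - c\<bar> \<partial>lborel) \<longlonglongrightarrow> 0"
    and intP: "\<And>n. integrable lborel (\<lambda>y. \<bar>Y y \<bullet> P n y\<bar>)"
    and limP: "(\<lambda>n. \<integral>y. \<bar>Y y \<bullet> P n y\<bar> \<partial>lborel) \<longlonglongrightarrow> 0"
    and \<zeta>: "\<And>x. (\<zeta> has_derivative (\<lambda>h. Z x \<bullet> h)) (at x)" and Z: "continuous_on UNIV Z"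
    and \<zeta>R: "\<And>y. norm y > R \<Longrightarrow> \<zeta> y = 0" and \<zeta>pos: "\<And>y. \<zeta> y \<ge> 0"
  shows "\<bar>\<integral>y. indicator (- \<Omega>) y * (Y y \<bullet> Z y) \<partial>lborel\<bar> \<le> DIM('a) * L * (\<integral>y. indicator (- \<Omega>) y * \<zeta> y \<partial>lborel)"
proof -
  have Z0: "Z y = 0" if "norm y > R" for y
    by (rule gradient_eq_0_outside_support[OF \<zeta>, of "- cball 0 R"]) (use \<zeta>R that in auto)
  have cY: "continuous_on UNIV Y" using Y by (rule lipschitz_on_continuous_on)
  have c\<zeta>: "continuous_on UNIV \<zeta>" by (rule has_derivative_continuous_on) (use \<zeta> in simp)
  have c\<psi>: "continuous_on UNIV (\<psi> n)" for n by (rule has_derivative_continuous_on) (use \<psi> in simp)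
  define w where "w n y = (1 - \<psi> n y / c) * \<zeta> y" for n y
  define W where "W n y = (1 - \<psi> n y / c) *\<^sub>R Z y - (\<zeta> y / c) *\<^sub>R P n y" for n y
  have w: "(w n has_derivative (\<lambda>h. W n x \<bullet> h)) (at x)" for n x
    unfolding w_def W_def using \<open>c \<noteq> 0\<close>
    by (auto intro!: derivative_eq_intros \<psi> \<zeta> simp: inner_diff_left algebra_simps divide_simps)
  have W: "continuous_on UNIV (W n)" for n
    unfolding W_def using \<open>c \<noteq> 0\<close> by (auto intro!: continuous_intros c\<psi> c\<zeta> Z P)
  have wR: "w n y = 0" if "norm y > R" for n y using \<zeta>R[OF that] by (simp add: w_def)
  have main: "\<bar>\<integral>y. Y y \<bullet> W n y \<partial>lborel\<bar> \<le> DIM('a) * L * (\<integral>y. \<bar>w n y\<bar> \<partial>lborel)" for n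
    by (rule integral_lipschitz_inner_gradient_le[OF Y w W wR])
  have diff: "(1 - \<psi> n y / c) - indicator (- \<Omega>) y = indicator \<Omega> y * ((c - \<psi> n y) / c)" for n y
    using \<psi>0[of y n] \<open>c \<noteq> 0\<close> by (auto simp: indicator_def divide_simps)
  \<comment> \<open>multiplication by a bounded function preserves the convergence of \<open>1 - \<psi> n / c\<close> to the indicator of the complement\<close>
  have lim_mult: "(\<lambda>n. \<integral>y. \<bar>1 - \<psi> n y / c\<bar> * k y \<partial>lborel) \<longlonglongrightarrow> (\<integral>y. indicator (- \<Omega>) y * k y \<partial>lborel)"
    "(\<lambda>n. \<integral>y. (1 - \<psi> n y / c) * k y \<partial>lborel) \<longlonglongrightarrow> (\<integral>y. indicator (- \<Omega>) y * k y \<partial>lborel)"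
    if k: "continuous_on UNIV k" and kR: "\<And>y. norm y > R \<Longrightarrow> k y = 0" for k :: "'a \<Rightarrow> real"
  proof -
    obtain B where "B \<ge> 0" and B: "\<And>y. \<bar>k y\<bar> \<le> B"
      using bounded_continuous_compact_support[OF k kR] by auto
    have i0: "integrable lborel (\<lambda>y. indicator (- \<Omega>) y * k y)"
      using integrable_real_mult_indicator[OF _ integrable_continuous_compact_support[OF k kR], of "- \<Omega>"] \<Omega>
      by (simp add: mult.commute)
    have i1: "integrable lborel (\<lambda>y. \<bar>1 - \<psi> n y / c\<bar> * k y)" "integrable lborel (\<lambda>y. (1 - \<psi> n y / c) * k y)" for n
      by (rule integrable_continuous_compact_support[where R=R];
          use kR k c\<psi> \<open>c \<noteq> 0\<close> in \<open>auto intro!: continuous_intros\<close>)+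
    have i2: "integrable lborel (\<lambda>y. B / \<bar>c\<bar> * (indicator \<Omega> y * \<bar>\<psi> n y - c\<bar>))" for n using int\<psi>[of n] by simp
    have bd: "\<bar>(1 - \<psi> n y / c) * k y - indicator (- \<Omega>) y * k y\<bar> \<le> B / \<bar>c\<bar> * (indicator \<Omega> y * \<bar>\<psi> n y - c\<bar>)"
      "\<bar>\<bar>1 - \<psi> n y / c\<bar> * k y - indicator (- \<Omega>) y * k y\<bar> \<le> B / \<bar>c\<bar> * (indicator \<Omega> y * \<bar>\<psi> n y - c\<bar>)" for n y
    proof -
      have "\<bar>(1 - \<psi> n y / c) - indicator (- \<Omega>) y\<bar> * \<bar>k y\<bar> \<le> (indicator \<Omega> y * \<bar>\<psi> n y - c\<bar> / \<bar>c\<bar>) * B"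
        unfolding diff using B[of y] by (intro mult_mono) (auto simp: abs_mult abs_minus_commute)
      then have *: "\<bar>(1 - \<psi> n y / c) - indicator (- \<Omega>) y\<bar> * \<bar>k y\<bar> \<le> B / \<bar>c\<bar> * (indicator \<Omega> y * \<bar>\<psi> n y - c\<bar>)"
        by (simp add: mult_ac)
      then show "\<bar>(1 - \<psi> n y / c) * k y - indicator (- \<Omega>) y * k y\<bar> \<le> B / \<bar>c\<bar> * (indicator \<Omega> y * \<bar>\<psi> n y - c\<bar>)"
        by (simp add: left_diff_distrib[symmetric] abs_mult)
      have "\<bar>\<bar>1 - \<psi> n y / c\<bar> - indicator (- \<Omega>) y\<bar> \<le> \<bar>(1 - \<psi> n y / c) - indicator (- \<Omega>) y\<bar>"
        using abs_triangle_ineq3[of "1 - \<psi> n y / c" "indicator (- \<Omega>) y"] by simp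
      then have "\<bar>\<bar>1 - \<psi> n y / c\<bar> - indicator (- \<Omega>) y\<bar> * \<bar>k y\<bar> \<le> \<bar>(1 - \<psi> n y / c) - indicator (- \<Omega>) y\<bar> * \<bar>k y\<bar>"
        by (rule mult_right_mono) simp
      with * show "\<bar>\<bar>1 - \<psi> n y / c\<bar> * k y - indicator (- \<Omega>) y * k y\<bar> \<le> B / \<bar>c\<bar> * (indicator \<Omega> y * \<bar>\<psi> n y - c\<bar>)"
        by (simp add: left_diff_distrib[symmetric] abs_mult)
    qed
    have lim0: "(\<lambda>n. B / \<bar>c\<bar> * (\<integral>y. indicator \<Omega> y * \<bar>\<psi> n y - c\<bar> \<partial>lborel)) \<longlonglongrightarrow> 0"
      using tendsto_mult_left[OF lim\<psi>, of "B / \<bar>c\<bar>"] by simp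
    have conv: "(\<lambda>n. \<integral>y. f n y \<partial>lborel) \<longlonglongrightarrow> (\<integral>y. g y \<partial>lborel)"
      if "\<And>n. integrable lborel (f n)" "integrable lborel g"
        "\<And>n y. \<bar>f n y - g y\<bar> \<le> B / \<bar>c\<bar> * (indicator \<Omega> y * \<bar>\<psi> n y - c\<bar>)" for f :: "nat \<Rightarrow> 'a \<Rightarrow> real" and g
    proof (rule Lim_transform[OF tendsto_const], rule Lim_null_comparison[OF _ lim0], intro always_eventually allI)
      fix n
      have "norm ((\<integral>y. f n y \<partial>lborel) - (\<integral>y. g y \<partial>lborel)) = \<bar>\<integral>y. f n y - g y \<partial>lborel\<bar>"
        using that by simp
      also have "\<dots> \<le> (\<integral>y. \<bar>f n y - g y\<bar> \<partial>lborel)" by (rule integral_abs_bound)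
      also have "\<dots> \<le> (\<integral>y. B / \<bar>c\<bar> * (indicator \<Omega> y * \<bar>\<psi> n y - c\<bar>) \<partial>lborel)"
        using that i2[of n] by (intro integral_mono) (auto simp: abs_minus_commute)
      finally show "norm ((\<integral>y. f n y \<partial>lborel) - (\<integral>y. g y \<partial>lborel)) \<le> B / \<bar>c\<bar> * (\<integral>y. indicator \<Omega> y * \<bar>\<psi> n y - c\<bar> \<partial>lborel)"
        by simp
    qed
    show "(\<lambda>n. \<integral>y. \<bar>1 - \<psi> n y / c\<bar> * k y \<partial>lborel) \<longlonglongrightarrow> (\<integral>y. indicator (- \<Omega>) y * k y \<partial>lborel)"
      "(\<lambda>n. \<integral>y. (1 - \<psi> n y / c) * k y \<partial>lborel) \<longlonglongrightarrow> (\<integral>y. indicator (- \<Omega>) y * k y \<partial>lborel)"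
      by (rule conv[OF i1(1) i0 bd(2)], rule conv[OF i1(2) i0 bd(1)])
  qed
  obtain B where "B \<ge> 0" and B: "\<And>y. \<bar>\<zeta> y\<bar> \<le> B"
    using bounded_continuous_compact_support[OF c\<zeta> \<zeta>R] by auto
  have i\<zeta>P: "integrable lborel (\<lambda>y. \<zeta> y / c * (Y y \<bullet> P n y))" for n
    by (rule integrable_continuous_compact_support[where R=R])
       (use \<zeta>R c\<zeta> cY P \<open>c \<noteq> 0\<close> in \<open>auto intro!: continuous_intros\<close>)
  have lim\<zeta>P: "(\<lambda>n. \<integral>y. \<zeta> y / c * (Y y \<bullet> P n y) \<partial>lborel) \<longlonglongrightarrow> 0"
  proof (rule Lim_null_comparison, intro always_eventually allI)
    fix n
    have "norm (\<integral>y. \<zeta> y / c * (Y y \<bullet> P n y) \<partial>lborel) \<le> (\<integral>y. \<bar>\<zeta> y / c * (Y y \<bullet> P n y)\<bar> \<partial>lborel)"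
      unfolding real_norm_def by (rule integral_abs_bound)
    also have "\<dots> \<le> (\<integral>y. B / \<bar>c\<bar> * \<bar>Y y \<bullet> P n y\<bar> \<partial>lborel)"
    proof (rule integral_mono)
      show "integrable lborel (\<lambda>y. \<bar>\<zeta> y / c * (Y y \<bullet> P n y)\<bar>)" using i\<zeta>P by (rule integrable_abs)
      show "integrable lborel (\<lambda>y. B / \<bar>c\<bar> * \<bar>Y y \<bullet> P n y\<bar>)" using intP[of n] by simp
      show "\<bar>\<zeta> y / c * (Y y \<bullet> P n y)\<bar> \<le> B / \<bar>c\<bar> * \<bar>Y y \<bullet> P n y\<bar>" for y
        using B[of y] by (simp only: abs_mult abs_divide) (intro mult_right_mono divide_right_mono; simp)
    qed
    finally show "norm (\<integral>y. \<zeta> y / c * (Y y \<bullet> P n y) \<partial>lborel) \<le> B / \<bar>c\<bar> * (\<integral>y. \<bar>Y y \<bullet> P n y\<bar> \<partial>lborel)" by simp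
  next
    show "(\<lambda>n. B / \<bar>c\<bar> * (\<integral>y. \<bar>Y y \<bullet> P n y\<bar> \<partial>lborel)) \<longlonglongrightarrow> 0"
      using tendsto_mult_left[OF limP, of "B / \<bar>c\<bar>"] by simp
  qed
  have cYZ: "continuous_on UNIV (\<lambda>y. Y y \<bullet> Z y)" by (intro continuous_intros cY Z)
  have "(\<integral>y. Y y \<bullet> W n y \<partial>lborel) = (\<integral>y. (1 - \<psi> n y / c) * (Y y \<bullet> Z y) \<partial>lborel) - (\<integral>y. \<zeta> y / c * (Y y \<bullet> P n y) \<partial>lborel)" for n
  proof -
    have "integrable lborel (\<lambda>y. (1 - \<psi> n y / c) * (Y y \<bullet> Z y))"
      by (rule integrable_continuous_compact_support[where R=R])
         (use Z0 cYZ c\<psi> \<open>c \<noteq> 0\<close> in \<open>auto intro!: continuous_intros\<close>)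
    then show ?thesis
      unfolding W_def using i\<zeta>P[of n]
      by (subst Bochner_Integration.integral_diff[symmetric]) (auto simp: inner_diff_right)
  qed
  moreover have "(\<lambda>n. \<integral>y. (1 - \<psi> n y / c) * (Y y \<bullet> Z y) \<partial>lborel) \<longlonglongrightarrow> (\<integral>y. indicator (- \<Omega>) y * (Y y \<bullet> Z y) \<partial>lborel)"
    by (rule lim_mult(2)[OF cYZ]) (simp add: Z0)
  ultimately have "(\<lambda>n. \<integral>y. Y y \<bullet> W n y \<partial>lborel) \<longlonglongrightarrow> (\<integral>y. indicator (- \<Omega>) y * (Y y \<bullet> Z y) \<partial>lborel)"
    using tendsto_diff[OF _ lim\<zeta>P] by fastforce
  moreover have "(\<lambda>n. DIM('a) * L * (\<integral>y. \<bar>w n y\<bar> \<partial>lborel)) \<longlonglongrightarrow> DIM('a) * L * (\<integral>y. indicator (- \<Omega>) y * \<zeta> y \<partial>lborel)"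
  proof -
    have "(\<lambda>n. \<integral>y. \<bar>w n y\<bar> \<partial>lborel) \<longlonglongrightarrow> (\<integral>y. indicator (- \<Omega>) y * \<zeta> y \<partial>lborel)"
      using lim_mult(1)[OF c\<zeta> \<zeta>R] \<zeta>pos by (simp add: w_def abs_mult)
    then show ?thesis by (rule tendsto_mult_left)
  qed
  ultimately show ?thesis
    by (rule LIMSEQ_le[OF tendsto_rabs]) (use main in blast)
qed

section \<open>Calculus of test functions\<close>

definition gradient :: "(real ^ 'n \<Rightarrow> real) \<Rightarrow> real ^ 'n \<Rightarrow> real ^ 'n" where
  "gradient u x = (\<chi> k. frechet_derivative u (at x) (axis k 1))"

lemma has_derivative_gradient:
  fixes u :: "real ^ 'n \<Rightarrow> real"
  assumes "u differentiable (at x)"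
  shows "(u has_derivative (\<lambda>h. gradient u x \<bullet> h)) (at x)"
proof -
  have d: "(u has_derivative frechet_derivative u (at x)) (at x)"
    using assms frechet_derivative_works by blast
  then have lin: "linear (frechet_derivative u (at x))" using has_derivative_linear by blast
  have "frechet_derivative u (at x) h = gradient u x \<bullet> h" for h
  proof -
    have "frechet_derivative u (at x) h = frechet_derivative u (at x) (\<Sum>k\<in>UNIV. h $ k *\<^sub>R axis k 1)"
      using basis_expansion[of h] by (simp add: scalar_mult_eq_scaleR)
    also have "\<dots> = (\<Sum>k\<in>UNIV. h $ k * frechet_derivative u (at x) (axis k 1))"
      by (simp add: linear_sum[OF lin] linear_cmul[OF lin])
    also have "\<dots> = gradient u x \<bullet> h" by (simp add: gradient_def inner_vec_def mult.commute)
    finally show ?thesis .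
  qed
  then have "frechet_derivative u (at x) = (\<lambda>h. gradient u x \<bullet> h)" by (rule ext)
  with d show ?thesis by simp
qed

lemma gradient_unique:
  fixes u :: "real ^ 'n \<Rightarrow> real"
  assumes "(u has_derivative (\<lambda>h. g \<bullet> h)) (at x)"
  shows "gradient u x = g"
  using frechet_derivative_at[OF assms, symmetric] by (simp add: gradient_def vec_eq_iff inner_axis)

lemma X_grad_nth: "X_grad X u x $ j = X j x \<bullet> gradient u x"
  by (simp add: X_grad_def gradient_def inner_vec_def)

lemma Ck_on_UNIV_Suc_iff:
  "Ck_on (Suc k) u UNIV \<longleftrightarrow> (\<forall>x. u differentiable (at x)) \<and> (\<forall>i. Ck_on k (\<lambda>x. gradient u x $ i) UNIV)"
  by (simp add: gradient_def)

lemma Ck_on_Suc_imp_Ck_on: "Ck_on (Suc k) u UNIV \<Longrightarrow> Ck_on k u UNIV"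
proof (induction k arbitrary: u)
  case 0
  then show ?case
    by (auto intro!: continuous_at_imp_continuous_on differentiable_imp_continuous_within)
next
  case (Suc k)
  then show ?case unfolding Ck_on_UNIV_Suc_iff[of "Suc k"] unfolding Ck_on_UNIV_Suc_iff[of k] by (metis Ck_on_UNIV_Suc_iff)
qed

lemma Ck_on_const: "Ck_on k (\<lambda>_. c) UNIV"
proof (induction k arbitrary: c)
  case (Suc k)
  have "gradient (\<lambda>_::real^'a. c) x = 0" for x
    by (rule gradient_unique) simp
  then show ?case using Suc by (simp add: Ck_on_UNIV_Suc_iff del: Ck_on.simps(2))
qed simp

lemma Ck_on_diff:
  assumes "Ck_on k u UNIV" "Ck_on k v UNIV"
  shows "Ck_on k (\<lambda>x. u x - v x) UNIV"
  using assms
proof (induction k arbitrary: u v)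
  case 0
  then show ?case by (auto intro: continuous_intros)
next
  case (Suc k)
  then have d: "\<And>x. u differentiable (at x)" "\<And>x. v differentiable (at x)"
    unfolding Ck_on_UNIV_Suc_iff by auto
  have "gradient (\<lambda>x. u x - v x) x = gradient u x - gradient v x" for x
    by (rule gradient_unique)
       (auto intro!: derivative_eq_intros has_derivative_gradient d simp: inner_diff_left)
  then show ?case using Suc d by (auto simp: Ck_on_UNIV_Suc_iff simp del: Ck_on.simps(2))
qed

lemma Ck_on_add:
  assumes "Ck_on k u UNIV" "Ck_on k v UNIV"
  shows "Ck_on k (\<lambda>x. u x + v x) UNIV"
  using Ck_on_diff[OF assms(1) Ck_on_diff[OF Ck_on_const[of _ 0] assms(2)]] by simp

lemma Ck_on_mult:
  assumes "Ck_on k u UNIV" "Ck_on k v UNIV"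
  shows "Ck_on k (\<lambda>x. u x * v x) UNIV"
  using assms
proof (induction k arbitrary: u v)
  case 0
  then show ?case by (auto intro: continuous_intros)
next
  case (Suc k)
  then have d: "\<And>x. u differentiable (at x)" "\<And>x. v differentiable (at x)"
    unfolding Ck_on_UNIV_Suc_iff by auto
  have g: "gradient (\<lambda>x. u x * v x) x = v x *\<^sub>R gradient u x + u x *\<^sub>R gradient v x" for x
    by (rule gradient_unique)
       (auto intro!: derivative_eq_intros has_derivative_gradient d simp: inner_add_left)
  have "Ck_on k (\<lambda>x. v x * gradient u x $ i + u x * gradient v x $ i) UNIV" for i
    using Ck_on_Suc_imp_Ck_on[OF Suc.prems(1)] Ck_on_Suc_imp_Ck_on[OF Suc.prems(2)]
      Suc.prems[unfolded Ck_on_UNIV_Suc_iff]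
    by (intro Ck_on_add Suc.IH) auto
  then show ?case using d by (auto simp: Ck_on_UNIV_Suc_iff g simp del: Ck_on.simps(2))
qed

lemma has_derivative_tanh_gradient:
  fixes u :: "real ^ 'n \<Rightarrow> real"
  assumes "u differentiable (at x)"
  shows "((\<lambda>x. tanh (u x)) has_derivative (\<lambda>h. ((1 - (tanh (u x))\<^sup>2) *\<^sub>R gradient u x) \<bullet> h)) (at x)"
proof -
  have "(tanh has_real_derivative (1 - (tanh (u x))\<^sup>2)) (at (u x))"
    by (auto intro!: derivative_eq_intros simp: cosh_real_nonzero)
  then have "(tanh has_derivative (*) (1 - (tanh (u x))\<^sup>2)) (at (u x))" by (simp add: has_field_derivative_def)
  from has_derivative_compose[OF has_derivative_gradient[OF assms] this] show ?thesis by simp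
qed

lemma gradient_tanh:
  "u differentiable (at x) \<Longrightarrow> gradient (\<lambda>x. tanh (u x)) x = (1 - (tanh (u x))\<^sup>2) *\<^sub>R gradient u x"
  by (rule gradient_unique has_derivative_tanh_gradient)+

text \<open>
  Since the derivative of \<open>tanh \<circ> u\<close> is a polynomial in \<open>tanh \<circ> u\<close> times that of \<open>u\<close>, closure under products makes
  the induction go through; no other derivatives of \<open>tanh\<close> are involved.
\<close>

lemma Ck_on_tanh:
  assumes "Ck_on k u UNIV"
  shows "Ck_on k (\<lambda>x. tanh (u x)) UNIV"
  using assms
proof (induction k)
  case 0
  then show ?case by (auto intro!: continuous_intros simp: cosh_real_nonzero)
next
  case (Suc k)
  then have d: "\<And>x. u differentiable (at x)" and g: "\<And>i. Ck_on k (\<lambda>x. gradient u x $ i) UNIV"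
    unfolding Ck_on_UNIV_Suc_iff by auto
  have t: "Ck_on k (\<lambda>x. tanh (u x)) UNIV" using Suc Ck_on_Suc_imp_Ck_on by blast
  have "(\<lambda>x. tanh (u x)) differentiable (at x)" for x
    using has_derivative_tanh_gradient[OF d] unfolding differentiable_def by blast
  moreover have "Ck_on k (\<lambda>x. (1 - tanh (u x) * tanh (u x)) * gradient u x $ i) UNIV" for i
    by (intro Ck_on_mult Ck_on_diff Ck_on_const t g)
  ultimately show ?case
    by (auto simp: Ck_on_UNIV_Suc_iff gradient_tanh[OF d] power2_eq_square simp del: Ck_on.simps(2))
qed

lemma test_functions_subset_support:
  assumes "u \<in> test_functions \<Omega>" "v \<in> test_functions \<Omega>" "\<And>k. Ck_on k w UNIV"
    and "\<And>x. u x = 0 \<Longrightarrow> v x = 0 \<Longrightarrow> w x = 0"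
  shows "w \<in> test_functions \<Omega>"
proof -
  define K where "K = closure {x. u x \<noteq> 0} \<union> closure {x. v x \<noteq> 0}"
  have K: "compact K" "K \<subseteq> \<Omega>" using assms(1,2) unfolding K_def test_functions_def by (auto intro: compact_Un)
  have "{x. w x \<noteq> 0} \<subseteq> {x. u x \<noteq> 0} \<union> {x. v x \<noteq> 0}" using assms(4) by auto
  then have sub: "closure {x. w x \<noteq> 0} \<subseteq> K" unfolding K_def closure_Un[symmetric] by (rule closure_mono)
  then have "compact (closure {x. w x \<noteq> 0})"
    using K(1) by (auto simp: compact_eq_bounded_closed intro: bounded_subset)
  then show ?thesis using assms(3) sub K(2) unfolding test_functions_def by blast
qed

lemma diff_mem_test_functions:
  "u \<in> test_functions \<Omega> \<Longrightarrow> v \<in> test_functions \<Omega> \<Longrightarrow> (\<lambda>x. u x - v x) \<in> test_functions \<Omega>"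
  by (rule test_functions_subset_support[of u \<Omega> v]) (auto simp: test_functions_def intro: Ck_on_diff)

lemma tanh_mem_test_functions:
  "u \<in> test_functions \<Omega> \<Longrightarrow> (\<lambda>x. tanh (u x)) \<in> test_functions \<Omega>"
  by (rule test_functions_subset_support[of u \<Omega> u]) (auto simp: test_functions_def intro: Ck_on_tanh)

context
  fixes u :: "real ^ 'n \<Rightarrow> real" and \<Omega>
  assumes u: "u \<in> test_functions \<Omega>"
begin

lemma test_function_Ck_on: "Ck_on k u UNIV"
  using u by (simp add: test_functions_def)

lemma test_function_differentiable: "u differentiable (at x)"
  using test_function_Ck_on[of "Suc 0"] unfolding Ck_on_UNIV_Suc_iff by blast

lemma test_function_has_derivative: "(u has_derivative (\<lambda>h. gradient u x \<bullet> h)) (at x)"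
  by (intro has_derivative_gradient test_function_differentiable)

lemma continuous_on_test_function: "continuous_on UNIV u"
  using test_function_Ck_on[of 0] by simp

lemma continuous_on_gradient_test_function: "continuous_on UNIV (gradient u)"
proof -
  have "continuous_on UNIV (\<lambda>x. gradient u x $ i)" for i
    using test_function_Ck_on[of "Suc 0"] unfolding Ck_on_UNIV_Suc_iff by simp
  then have "continuous_on UNIV (\<lambda>x. \<chi> i. gradient u x $ i)" by (intro continuous_on_vec_lambda)
  then show ?thesis by simp
qed

lemma test_function_eq_0: "x \<notin> \<Omega> \<Longrightarrow> u x = 0"
  using u closure_subset[of "{x. u x \<noteq> 0}"] unfolding test_functions_def by blast

lemma gradient_test_function_eq_0: "x \<notin> \<Omega> \<Longrightarrow> gradient u x = 0"
proof (rule gradient_eq_0_outside_support[OF test_function_has_derivative])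
  assume "x \<notin> \<Omega>"
  then show "x \<in> - closure {x. u x \<noteq> 0}" using u unfolding test_functions_def by blast
  show "u y = 0" if "y \<in> - closure {x. u x \<noteq> 0}" for y
    using that closure_subset[of "{x. u x \<noteq> 0}"] by blast
qed (rule open_Compl[OF closed_closure])

lemma continuous_on_X_grad_test_function:
  assumes "\<And>j. continuous_on UNIV (X j)"
  shows "continuous_on UNIV (X_grad X u)"
proof -
  have "continuous_on UNIV (\<lambda>x. \<chi> j. X_grad X u x $ j)"
    unfolding X_grad_nth by (intro continuous_on_vec_lambda continuous_intros assms continuous_on_gradient_test_function)
  then show ?thesis by simp
qed

end

lemma X_grad_diff:
  assumes "u \<in> test_functions \<Omega>" "v \<in> test_functions \<Omega>"
  shows "X_grad X (\<lambda>x. u x - v x) x = X_grad X u x - X_grad X v x"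
proof -
  have "gradient (\<lambda>x. u x - v x) x = gradient u x - gradient v x"
    by (rule gradient_unique)
       (auto intro!: derivative_eq_intros test_function_has_derivative[OF assms(1)] test_function_has_derivative[OF assms(2)] simp: inner_diff_left)
  then show ?thesis by (subst vec_eq_iff) (simp add: X_grad_nth inner_diff_right)
qed

lemma X_grad_tanh:
  assumes "u \<in> test_functions \<Omega>"
  shows "X_grad X (\<lambda>x. tanh (u x)) x = (1 - (tanh (u x))\<^sup>2) *\<^sub>R X_grad X u x"
  by (simp add: vec_eq_iff X_grad_nth gradient_tanh[OF test_function_differentiable[OF assms]])

section \<open>Transport of balls along subunit paths\<close>

lemma DERIV_max_0_power2: "((\<lambda>x::real. (max 0 x)\<^sup>2) has_real_derivative 2 * max 0 x) (at x)"
  unfolding has_field_derivative_def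
proof (rule has_derivativeI_sandwich[of 1])
  show "bounded_linear ((*) (2 * max 0 x))" by (rule bounded_linear_mult_right)
  fix y :: real assume "y \<noteq> x"
  have "\<bar>(max 0 y)\<^sup>2 - (max 0 x)\<^sup>2 - 2 * max 0 x * (y - x)\<bar> \<le> (y - x)\<^sup>2"
  proof (cases "0 \<le> x"; cases "0 \<le> y")
    assume xy: "0 \<le> x" "\<not> 0 \<le> y"
    then have "x * y \<le> 0" by (simp add: mult_nonneg_nonpos)
    moreover have "(max 0 y)\<^sup>2 - (max 0 x)\<^sup>2 - 2 * max 0 x * (y - x) = x\<^sup>2 - 2 * (x * y)"
      using xy by (simp add: max_def power2_eq_square algebra_simps)
    moreover have "(y - x)\<^sup>2 = y\<^sup>2 + x\<^sup>2 - 2 * (x * y)" by (simp add: power2_eq_square algebra_simps)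
    ultimately show ?thesis by (smt (verit) zero_le_power2)
  next
    assume xy: "\<not> 0 \<le> x" "0 \<le> y"
    then have "x * y \<le> 0" by (simp add: mult_nonpos_nonneg)
    then show ?thesis using xy by (simp add: max_def power2_eq_square algebra_simps)
  next
    assume "0 \<le> x" "0 \<le> y"
    then have "(max 0 y)\<^sup>2 - (max 0 x)\<^sup>2 - 2 * max 0 x * (y - x) = (y - x)\<^sup>2"
      by (simp add: max_def power2_eq_square algebra_simps)
    then show ?thesis by simp
  qed simp
  then have "\<bar>(max 0 y)\<^sup>2 - (max 0 x)\<^sup>2 - 2 * max 0 x * (y - x)\<bar> \<le> \<bar>y - x\<bar> * \<bar>y - x\<bar>"
    by (simp add: power2_eq_square)
  then show "norm ((max 0 y)\<^sup>2 - (max 0 x)\<^sup>2 - 2 * max 0 x * (y - x)) / norm (y - x) \<le> \<bar>y - x\<bar>"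
    using \<open>y \<noteq> x\<close> by (simp add: divide_le_eq)
next
  show "((\<lambda>y. \<bar>y - x\<bar>) \<longlongrightarrow> 0) (at x)"
    using tendsto_rabs[OF tendsto_diff[OF tendsto_ident_at tendsto_const[of x]], of x UNIV] by simp
qed simp

lemma exp_decay_lipschitz:
  fixes a s t :: real
  assumes "a \<ge> 0" "s \<ge> 0" "t \<ge> 0"
  shows "\<bar>exp (- a * s) - exp (- a * t)\<bar> \<le> a * \<bar>s - t\<bar>"
proof -
  have *: "\<bar>exp (- a * s) - exp (- a * t)\<bar> \<le> a * (t - s)" if "s \<ge> 0" "s \<le> t" for s t
  proof -
    have "exp (- a * s) - exp (- a * t) = exp (- a * s) * (1 - exp (- (a * (t - s))))"
      by (simp add: exp_diff exp_minus field_simps exp_add[symmetric])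
    moreover have "0 \<le> 1 - exp (- (a * (t - s)))" "1 - exp (- (a * (t - s))) \<le> a * (t - s)"
      using exp_ge_add_one_self[of "- (a * (t - s))"] \<open>a \<ge> 0\<close> that by auto
    moreover have "exp (- a * s) \<le> 1" using \<open>a \<ge> 0\<close> that by simp
    ultimately show ?thesis
      using mult_left_le_one_le[of "1 - exp (- (a * (t - s)))" "exp (- a * s)"]
      by (simp add: abs_mult)
  qed
  show ?thesis using *[of s t] *[of t s] assms by (cases "s \<le> t") (auto simp: abs_minus_commute)
qed

text \<open>
  A \<open>C\<^sup>1\<close> function that is positive exactly in the ball around \<open>p\<close> of radius \<open>sqrt s\<close> and decreases radially.  Parametrizing it by the
  square \<open>s\<close> of the radius keeps it a polynomial inside the ball.
\<close>

definition bump :: "real \<Rightarrow> 'a::euclidean_space \<Rightarrow> 'a \<Rightarrow> real" where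
  "bump s p y = (max 0 (s - (norm (y - p))\<^sup>2))\<^sup>2"

definition bump_gradient :: "real \<Rightarrow> 'a::euclidean_space \<Rightarrow> 'a \<Rightarrow> 'a" where
  "bump_gradient s p y = - (4 * max 0 (s - (norm (y - p))\<^sup>2)) *\<^sub>R (y - p)"

lemma bump_nonneg: "bump s p y \<ge> 0"
  by (simp add: bump_def)

lemma bump_eq_0: "s \<le> (norm (y - p))\<^sup>2 \<Longrightarrow> bump s p y = 0"
  by (simp add: bump_def)

lemma bump_pos: "(norm (y - p))\<^sup>2 < s \<Longrightarrow> bump s p y > 0"
  by (simp add: bump_def)

lemma has_derivative_bump: "(bump s p has_derivative (\<lambda>h. bump_gradient s p y \<bullet> h)) (at y)"
proof -
  have "((\<lambda>y. s - (norm (y - p))\<^sup>2) has_derivative (\<lambda>h. - 2 * ((y - p) \<bullet> h))) (at y)"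
    unfolding power2_norm_eq_inner
    by (auto intro!: derivative_eq_intros simp: inner_commute)
  from has_derivative_compose[OF this DERIV_max_0_power2[unfolded has_field_derivative_def]]
  show ?thesis unfolding bump_def bump_gradient_def by (simp add: mult.assoc)
qed

lemma continuous_on_bump_gradient: "continuous_on UNIV (bump_gradient s p)"
  unfolding bump_gradient_def by (intro continuous_intros)

lemma continuous_on_bump: "continuous_on UNIV (bump s p)"
  unfolding bump_def by (intro continuous_intros)

lemma bump_time_derivative:
  fixes \<gamma> :: "real \<Rightarrow> 'a::euclidean_space"
  assumes \<gamma>: "(\<gamma> has_vector_derivative v) (at t within S)"
    and \<rho>: "(\<rho> has_real_derivative \<rho>') (at t within S)"
  shows "((\<lambda>t. bump (\<rho> t) (\<gamma> t) y) has_real_derivative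
     2 * max 0 (\<rho> t - (norm (y - \<gamma> t))\<^sup>2) * (\<rho>' + 2 * ((y - \<gamma> t) \<bullet> v))) (at t within S)"
proof -
  have "((\<lambda>t. y - \<gamma> t) has_vector_derivative - v) (at t within S)"
    using \<gamma> by (auto intro!: derivative_eq_intros)
  from bounded_bilinear.has_vector_derivative[OF bounded_bilinear_inner this this]
  have "((\<lambda>t. (y - \<gamma> t) \<bullet> (y - \<gamma> t)) has_real_derivative - 2 * ((y - \<gamma> t) \<bullet> v)) (at t within S)"
    unfolding has_real_derivative_iff_has_vector_derivative by (simp add: inner_commute)
  then have "((\<lambda>t. \<rho> t - (norm (y - \<gamma> t))\<^sup>2) has_real_derivative \<rho>' + 2 * ((y - \<gamma> t) \<bullet> v)) (at t within S)"
    unfolding power2_norm_eq_inner using \<rho> by (auto intro!: derivative_eq_intros)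
  from DERIV_chain2[OF DERIV_max_0_power2 this] show ?thesis unfolding bump_def .
qed

lemma abs_diff_squares: "\<bar>a\<^sup>2 - b\<^sup>2\<bar> = \<bar>a - b\<bar> * \<bar>a + b\<bar>" for a b :: real
  unfolding abs_mult[symmetric] by (simp add: power2_eq_square algebra_simps)

lemma bump_lipschitz:
  assumes "0 \<le> s" "s \<le> 1" "0 \<le> s'" "s' \<le> 1" "norm (y - p) \<le> B" "norm (y - p') \<le> B"
  shows "\<bar>bump s p y - bump s' p' y\<bar> \<le> 2 * (\<bar>s - s'\<bar> + 2 * B * norm (p - p'))"
proof -
  define q q' where "q = s - (norm (y - p))\<^sup>2" and "q' = s' - (norm (y - p'))\<^sup>2"
  have q: "q \<le> 1" "q' \<le> 1" 
    using assms zero_le_power2[of "norm (y - p)"] zero_le_power2[of "norm (y - p')"]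
    unfolding q_def q'_def by linarith+
  have "\<bar>bump s p y - bump s' p' y\<bar> = \<bar>max 0 q - max 0 q'\<bar> * \<bar>max 0 q + max 0 q'\<bar>"
    unfolding bump_def q_def[symmetric] q'_def[symmetric] by (rule abs_diff_squares)
  also have "\<dots> \<le> \<bar>q - q'\<bar> * 2" using q by (intro mult_mono) auto
  also have "\<bar>q - q'\<bar> \<le> \<bar>s - s'\<bar> + \<bar>(norm (y - p))\<^sup>2 - (norm (y - p'))\<^sup>2\<bar>" unfolding q_def q'_def by linarith
  also have "\<bar>(norm (y - p))\<^sup>2 - (norm (y - p'))\<^sup>2\<bar> = \<bar>norm (y - p) - norm (y - p')\<bar> * (norm (y - p) + norm (y - p'))"
    by (simp add: abs_diff_squares)
  also have "\<dots> \<le> norm (p - p') * (B + B)"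
    using assms norm_triangle_ineq3[of "y - p" "y - p'"]
    by (intro mult_mono add_mono) (auto simp: norm_minus_commute)
  finally show ?thesis by (simp add: algebra_simps)
qed

text \<open>
  Composing with the projection onto a ball turns fields that are Lipschitz on that ball into globally Lipschitz
  fields, as integration by parts requires, and does not change them on the ball.
\<close>

lemma subunit_field_lipschitz:
  fixes X :: "'m::finite \<Rightarrow> real ^ 'n \<Rightarrow> real ^ 'n" and L :: real
  assumes X: "\<And>j. L-lipschitz_on (cball 0 R) (X j)" and "R \<ge> 0"
    and \<theta>: "(\<Sum>j\<in>UNIV. (\<theta> j)\<^sup>2) \<le> 1"
  shows "(CARD('m) * L)-lipschitz_on UNIV (\<lambda>y. \<Sum>j\<in>UNIV. \<theta> j *\<^sub>R X j (closest_point (cball 0 R) y))"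
proof (rule lipschitz_onI)
  define c where "c = closest_point (cball (0 :: real ^ 'n) R)"
  have "L \<ge> 0" using X lipschitz_on_nonneg by blast
  have c: "c y \<in> cball 0 R" "dist (c x) (c y) \<le> dist x y" for x y
    unfolding c_def using \<open>R \<ge> 0\<close>
    by (intro closest_point_in_set closest_point_lipschitz; simp)+
  fix x y :: "real ^ 'n"
  have "dist (\<Sum>j\<in>UNIV. \<theta> j *\<^sub>R X j (c x)) (\<Sum>j\<in>UNIV. \<theta> j *\<^sub>R X j (c y)) = norm (\<Sum>j\<in>UNIV. \<theta> j *\<^sub>R (X j (c x) - X j (c y)))"
    by (simp add: dist_norm sum_subtractf scaleR_right_diff_distrib)
  also have "\<dots> \<le> (\<Sum>j\<in>(UNIV :: 'm set). L * dist x y)"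
  proof (rule sum_norm_le)
    fix j
    have "norm (\<theta> j *\<^sub>R (X j (c x) - X j (c y))) \<le> 1 * norm (X j (c x) - X j (c y))"
      unfolding norm_scaleR using subunit_coefficient_le_1[OF \<theta>] by (intro mult_right_mono) auto
    also have "\<dots> \<le> L * dist (c x) (c y)" using lipschitz_onD[OF X c(1) c(1)] by (simp add: dist_norm)
    also have "\<dots> \<le> L * dist x y" using c(2) \<open>L \<ge> 0\<close> by (intro mult_left_mono)
    finally show "norm (\<theta> j *\<^sub>R (X j (c x) - X j (c y))) \<le> L * dist x y" .
  qed
  finally show "dist (\<Sum>j\<in>UNIV. \<theta> j *\<^sub>R X j (closest_point (cball 0 R) x)) (\<Sum>j\<in>UNIV. \<theta> j *\<^sub>R X j (closest_point (cball 0 R) y)) \<le> CARD('m) * L * dist x y"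
    by (simp add: c_def)
next
  show "0 \<le> CARD('m) * L" using X lipschitz_on_nonneg by fastforce
qed

lemma subunit_combination_le_norm:
  fixes \<theta> :: "'m::finite \<Rightarrow> real" and g :: "real ^ 'm"
  assumes "(\<Sum>j\<in>UNIV. (\<theta> j)\<^sup>2) \<le> 1"
  shows "\<bar>\<Sum>j\<in>UNIV. \<theta> j * g $ j\<bar> \<le> norm g"
proof -
  have "\<bar>(\<chi> j. \<theta> j) \<bullet> g\<bar> \<le> norm (\<chi> j. \<theta> j) * norm g" by (rule Cauchy_Schwarz_ineq2)
  also have "\<dots> \<le> 1 * norm g"
    using assms by (intro mult_right_mono) (auto simp: norm_vec_def L2_set_def intro: sum_nonneg)
  finally show ?thesis by (simp add: inner_vec_def)
qed

lemma integrable_indicator_mult_continuous: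
  fixes f :: "'a::euclidean_space \<Rightarrow> real"
  assumes "continuous_on UNIV f" "bounded S" "S \<in> sets borel"
  shows "integrable lborel (\<lambda>y. indicator S y * f y)"
proof -
  obtain R where "S \<subseteq> cball 0 R" using bounded_subset_ballD[OF \<open>bounded S\<close>, of 0] ball_subset_cball by blast
  have "integrable lborel (\<lambda>x. indicator (cball 0 R) x *\<^sub>R f x)"
    using assms(1) by (intro borel_integrable_compact) (auto intro: continuous_on_subset)
  then have "integrable lborel (\<lambda>x. indicator S x *\<^sub>R (indicator (cball 0 R) x *\<^sub>R f x))"
    by (rule integrable_mult_indicator[rotated]) (use assms(3) in simp)
  moreover have "(\<lambda>x. indicator S x *\<^sub>R (indicator (cball 0 R) x *\<^sub>R f x)) = (\<lambda>x. indicator S x * f x)"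
    using \<open>S \<subseteq> _\<close> by (intro ext) (auto simp: indicator_def)
  ultimately show ?thesis by (simp only:)
qed

lemma integral_lebesgue_on_eq_lborel:
  fixes f :: "'a::euclidean_space \<Rightarrow> real"
  assumes "f \<in> borel_measurable borel" "S \<in> sets borel"
  shows "(\<integral>y. f y \<partial>lebesgue_on S) = (\<integral>y. indicator S y * f y \<partial>lborel)"
proof -
  have "(\<integral>y. f y \<partial>lebesgue_on S) = (\<integral>y. indicator S y *\<^sub>R f y \<partial>lebesgue)"
    using assms(2) by (intro integral_restrict_space) auto
  also have "\<dots> = (\<integral>y. indicator S y *\<^sub>R f y \<partial>lborel)"
    using assms by (intro integral_completion) (auto intro!: borel_measurable_indicator)
  finally show ?thesis by simp
qed

text \<open>
  The situation to be excluded: a nonzero constant is the \<open>L\<^sup>1\<close> limit of test functions whose \<open>X\<close>-gradients tend to \<open>0\<close>.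
  Informally, the boundary of \<open>\<Omega>\<close> has zero capacity.
\<close>

locale zero_energy_constant =
  fixes \<Omega> :: "(real ^ 'n) set" and X :: "'m::finite \<Rightarrow> real ^ 'n \<Rightarrow> real ^ 'n"
    and \<psi> :: "nat \<Rightarrow> real ^ 'n \<Rightarrow> real" and c :: real
  assumes open_\<Omega>: "open \<Omega>" and bounded_\<Omega>: "bounded \<Omega>"
    and cont_X: "\<And>j. continuous_on UNIV (X j)"
    and test: "\<And>n. \<psi> n \<in> test_functions \<Omega>"
    and c_nonzero: "c \<noteq> 0"
    and lim_\<psi>: "(\<lambda>n. \<integral>x. \<bar>\<psi> n x - c\<bar> \<partial>lebesgue_on \<Omega>) \<longlonglongrightarrow> 0"
    and lim_X_grad: "(\<lambda>n. \<integral>x. norm (X_grad X (\<psi> n) x) \<partial>lebesgue_on \<Omega>) \<longlonglongrightarrow> 0"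
begin

text \<open>
  Inside \<open>\<Omega>\<close> the derivative of \<open>\<psi> n\<close> along \<open>Y\<close> is the combination of the components of its \<open>X\<close>-gradient with the
  coefficients \<open>\<theta>\<close>, outside \<open>\<Omega>\<close> it is \<open>0\<close>; so it tends to \<open>0\<close> in \<open>L\<^sup>1\<close> on the whole space and the weak transport inequality applies.
\<close>

lemma subunit_field_transport:
  fixes L :: real
  assumes X: "\<And>j. L-lipschitz_on (cball 0 R) (X j)" and "R \<ge> 0" and \<Omega>R: "\<Omega> \<subseteq> cball 0 R"
    and \<theta>: "(\<Sum>j\<in>UNIV. (\<theta> j)\<^sup>2) \<le> 1"
    and Y: "Y = (\<lambda>y. \<Sum>j\<in>UNIV. \<theta> j *\<^sub>R X j (closest_point (cball 0 R) y))"
    and \<zeta>: "\<And>x. (\<zeta> has_derivative (\<lambda>h. Z x \<bullet> h)) (at x)" and Z: "continuous_on UNIV Z"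
    and \<zeta>R: "\<And>y. norm y > R \<Longrightarrow> \<zeta> y = 0" and \<zeta>pos: "\<And>y. \<zeta> y \<ge> 0"
  shows "\<bar>\<integral>y. indicator (- \<Omega>) y * (Y y \<bullet> Z y) \<partial>lborel\<bar>
     \<le> CARD('n) * (CARD('m) * L) * (\<integral>y. indicator (- \<Omega>) y * \<zeta> y \<partial>lborel)"
proof -
  have Ylip: "(CARD('m) * L)-lipschitz_on UNIV Y"
    unfolding Y by (rule subunit_field_lipschitz[OF X \<open>R \<ge> 0\<close> \<theta>])
  have cY: "continuous_on UNIV Y" using Ylip by (rule lipschitz_on_continuous_on)
  have \<Omega>b: "\<Omega> \<in> sets borel" using open_\<Omega> by simp
  have cXg: "continuous_on UNIV (X_grad X (\<psi> n))" for n
    by (rule continuous_on_X_grad_test_function[OF test cont_X])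
  have le: "\<bar>Y y \<bullet> gradient (\<psi> n) y\<bar> \<le> indicator \<Omega> y * norm (X_grad X (\<psi> n) y)" for n y
  proof (cases "y \<in> \<Omega>")
    case True
    then have "closest_point (cball 0 R) y = y" using \<Omega>R by (intro closest_point_self) auto
    then have "Y y \<bullet> gradient (\<psi> n) y = (\<Sum>j\<in>UNIV. \<theta> j * X_grad X (\<psi> n) y $ j)"
      by (simp add: Y inner_sum_left X_grad_nth)
    then show ?thesis using subunit_combination_le_norm[OF \<theta>] True by simp
  next
    case False
    then show ?thesis using gradient_test_function_eq_0[OF test] by simp
  qed
  have i: "integrable lborel (\<lambda>y. indicator \<Omega> y * norm (X_grad X (\<psi> n) y))" for n
    by (rule integrable_indicator_mult_continuous[OF _ bounded_\<Omega> \<Omega>b]) (intro continuous_intros cXg)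
  have intP: "integrable lborel (\<lambda>y. \<bar>Y y \<bullet> gradient (\<psi> n) y\<bar>)" for n
  proof (rule Bochner_Integration.integrable_bound[OF i[of n]])
    have "(\<lambda>y. \<bar>Y y \<bullet> gradient (\<psi> n) y\<bar>) \<in> borel_measurable borel"
      by (intro borel_measurable_continuous_onI continuous_intros cY continuous_on_gradient_test_function[OF test])
    then show "(\<lambda>y. \<bar>Y y \<bullet> gradient (\<psi> n) y\<bar>) \<in> borel_measurable lborel" by simp
    show "AE y in lborel. norm \<bar>Y y \<bullet> gradient (\<psi> n) y\<bar> \<le> norm (indicator \<Omega> y * norm (X_grad X (\<psi> n) y))"
      using le[of _ n] by (intro AE_I2) (auto intro: order_trans)
  qed
  have limP: "(\<lambda>n. \<integral>y. \<bar>Y y \<bullet> gradient (\<psi> n) y\<bar> \<partial>lborel) \<longlonglongrightarrow> 0"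
  proof (rule Lim_null_comparison, intro always_eventually allI)
    fix n
    have "(\<integral>y. \<bar>Y y \<bullet> gradient (\<psi> n) y\<bar> \<partial>lborel) \<le> (\<integral>y. indicator \<Omega> y * norm (X_grad X (\<psi> n) y) \<partial>lborel)"
      using intP[of n] i[of n] le by (intro integral_mono)
    then show "norm (\<integral>y. \<bar>Y y \<bullet> gradient (\<psi> n) y\<bar> \<partial>lborel) \<le> (\<integral>y. indicator \<Omega> y * norm (X_grad X (\<psi> n) y) \<partial>lborel)"
      by simp
  next
    have "(\<integral>x. norm (X_grad X (\<psi> n) x) \<partial>lebesgue_on \<Omega>) = (\<integral>y. indicator \<Omega> y * norm (X_grad X (\<psi> n) y) \<partial>lborel)" for n
      by (rule integral_lebesgue_on_eq_lborel[OF _ \<Omega>b]) (intro borel_measurable_continuous_onI continuous_intros cXg)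
    then show "(\<lambda>n. \<integral>y. indicator \<Omega> y * norm (X_grad X (\<psi> n) y) \<partial>lborel) \<longlonglongrightarrow> 0"
      using lim_X_grad by simp
  qed
  have int\<psi>: "integrable lborel (\<lambda>y. indicator \<Omega> y * \<bar>\<psi> n y - c\<bar>)" for n
    by (rule integrable_indicator_mult_continuous[OF _ bounded_\<Omega> \<Omega>b])
       (intro continuous_intros continuous_on_test_function[OF test])
  have "(\<integral>x. \<bar>\<psi> n x - c\<bar> \<partial>lebesgue_on \<Omega>) = (\<integral>y. indicator \<Omega> y * \<bar>\<psi> n y - c\<bar> \<partial>lborel)" for n
    by (rule integral_lebesgue_on_eq_lborel[OF _ \<Omega>b])
       (intro borel_measurable_continuous_onI continuous_intros continuous_on_test_function[OF test])
  then have lim\<psi>: "(\<lambda>n. \<integral>y. indicator \<Omega> y * \<bar>\<psi> n y - c\<bar> \<partial>lborel) \<longlonglongrightarrow> 0"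
    using lim_\<psi> by simp
  show ?thesis
    using weak_transport_complement[OF Ylip open_\<Omega> test_function_has_derivative[OF test]
        continuous_on_gradient_test_function[OF test] test_function_eq_0[OF test] c_nonzero
        int\<psi> lim\<psi> intP limP \<zeta> Z \<zeta>R \<zeta>pos]
    by simp
qed

text \<open>
  Let \<open>m(t)\<close> be the integral over the complement of \<open>\<Omega>\<close> of a bump \<open>F t\<close> centred at \<open>\<gamma> t\<close> with support in a ball
  of radius \<open>r exp (-K t)\<close>, where \<open>K\<close> is a Lipschitz constant of all subunit fields.  The exponential shrinking absorbs the
  difference between the velocity \<open>Y (\<gamma> t)\<close> of the centre and \<open>Y y\<close>, where \<open>Y\<close> is the combination of the fields
  with the coefficients used by the path at time \<open>t\<close>, so that the time derivative of \<open>F\<close> is at most \<open>- Y(F)\<close>.  With the weak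
  invariance of the complement this yields \<open>m' \<le> A m\<close>, and \<open>m(0) = 0\<close> because the initial ball lies in \<open>\<Omega>\<close>; so
  \<open>m\<close> vanishes by Gronwall's inequality.
\<close>

lemma path_keeps_ball:
  fixes L :: real
  assumes X: "\<And>j. L-lipschitz_on (cball 0 R) (X j)" and \<Omega>R: "\<Omega> \<subseteq> cball 0 R"
    and lip: "C-lipschitz_on {0..T} \<gamma>" and "T \<ge> 0" and N: "negligible N"
    and deriv: "\<And>t. t \<in> {0..T} - N \<Longrightarrow> \<exists>v\<in>subunit_vectors X (\<gamma> t). (\<gamma> has_vector_derivative v) (at t within {0..T})"
    and inside: "\<And>t. t \<in> {0..T} \<Longrightarrow> norm (\<gamma> t) \<le> R - 1"
    and r: "0 < r" "r \<le> 1" and start: "ball (\<gamma> 0) r \<subseteq> \<Omega>"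
  shows "negligible (ball (\<gamma> T) (r * exp (- (CARD('m) * L) * T)) - \<Omega>)"
proof -
  define K where "K = CARD('m) * L"
  define A where "A = CARD('n) * K"
  have "L \<ge> 0" using X lipschitz_on_nonneg by blast
  then have "K \<ge> 0" "A \<ge> 0" by (auto simp: K_def A_def)
  have "C \<ge> 0" using lip lipschitz_on_nonneg by blast
  have "R \<ge> 1" using inside[of 0] \<open>T \<ge> 0\<close> norm_ge_zero[of "\<gamma> 0"] by (simp del: norm_ge_zero)
  define \<rho> where "\<rho> t = r\<^sup>2 * exp (- (2 * K) * t)" for t
  have \<rho>_sq: "\<rho> t = (r * exp (- K * t))\<^sup>2" for t
    by (simp add: \<rho>_def power_mult_distrib exp_double[symmetric] algebra_simps)
  have "r\<^sup>2 \<le> 1" using r by (simp add: power_le_one)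
  have \<rho>: "0 \<le> \<rho> t" "\<rho> t \<le> 1" if "t \<ge> 0" for t
  proof -
    have "exp (- (2 * K) * t) \<le> 1" using that \<open>K \<ge> 0\<close> by simp
    then have "r\<^sup>2 * exp (- (2 * K) * t) \<le> 1 * 1" using \<open>r\<^sup>2 \<le> 1\<close> by (intro mult_mono) auto
    then show "0 \<le> \<rho> t" "\<rho> t \<le> 1" by (auto simp: \<rho>_def)
  qed
  define F where "F t = bump (\<rho> t) (\<gamma> t)" for t
  have F0: "F t y = 0" if "norm y > R" "t \<in> {0..T}" for t y
    unfolding F_def
  proof (rule bump_eq_0)
    have "norm (y - \<gamma> t) \<ge> 1"
      using norm_triangle_ineq2[of y "\<gamma> t"] inside[OF that(2)] that(1) by linarith
    then have "(norm (y - \<gamma> t))\<^sup>2 \<ge> 1" by (simp add: one_le_power)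
    then show "\<rho> t \<le> (norm (y - \<gamma> t))\<^sup>2" using \<rho>(2)[of t] that(2) by auto
  qed
  \<comment> \<open>The Lipschitz constant of \<open>F\<close> in time: points and centres in \<open>cball 0 R\<close> have distance at most \<open>2 * R\<close>.\<close>
  define M where "M = 2 * (2 * K + 2 * (2 * R) * C)"
  have F_lip: "\<bar>F s y - F t y\<bar> \<le> indicator (cball 0 R) y *\<^sub>R M * \<bar>s - t\<bar>" if st: "s \<in> {0..T}" "t \<in> {0..T}" for s t y
  proof (cases "norm y > R")
    case True
    then show ?thesis using F0 st by simp
  next
    case False
    have "\<bar>\<rho> s - \<rho> t\<bar> = r\<^sup>2 * \<bar>exp (- (2 * K) * s) - exp (- (2 * K) * t)\<bar>"
      by (simp add: \<rho>_def right_diff_distrib[symmetric] abs_mult)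
    also have "\<dots> \<le> 1 * (2 * K * \<bar>s - t\<bar>)"
      using \<open>r\<^sup>2 \<le> 1\<close> \<open>K \<ge> 0\<close> exp_decay_lipschitz[of "2 * K" s t] st by (intro mult_mono) auto
    finally have 1: "\<bar>\<rho> s - \<rho> t\<bar> \<le> 2 * K * \<bar>s - t\<bar>" by simp
    have 2: "norm (\<gamma> s - \<gamma> t) \<le> C * \<bar>s - t\<bar>"
      using lipschitz_onD[OF lip st] by (simp add: dist_norm)
    have 3: "norm (y - \<gamma> u) \<le> 2 * R" if "u \<in> {0..T}" for u
      using norm_triangle_ineq4[of y "\<gamma> u"] inside[OF that] False by linarith
    have "\<bar>F s y - F t y\<bar> \<le> 2 * (\<bar>\<rho> s - \<rho> t\<bar> + 2 * (2 * R) * norm (\<gamma> s - \<gamma> t))"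
      unfolding F_def using st by (intro bump_lipschitz \<rho> 3) auto
    also have "\<dots> \<le> 2 * (2 * K * \<bar>s - t\<bar> + 2 * (2 * R) * (C * \<bar>s - t\<bar>))"
      using 1 2 \<open>R \<ge> 1\<close> by (intro mult_left_mono add_mono) auto
    also have "\<dots> = M * \<bar>s - t\<bar>" by (simp add: M_def algebra_simps)
    finally show ?thesis using False by simp
  qed
  define m where "m t = (\<integral>y. indicator (- \<Omega>) y * F t y \<partial>lborel)" for t
  have intF: "integrable lborel (\<lambda>y. indicator (- \<Omega>) y * F t y)" if "t \<in> {0..T}" for t
  proof -
    have "integrable lborel (F t)"
      by (rule integrable_continuous_compact_support[of _ R]) (use F0 that in \<open>auto simp: F_def continuous_on_bump\<close>)
    then show ?thesis
      using integrable_real_mult_indicator[of "- \<Omega>" lborel "F t"] open_\<Omega> by (simp add: mult.commute)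
  qed
  have intM: "integrable lborel (\<lambda>y. indicator (cball 0 R) y *\<^sub>R M :: real)"
    by (rule borel_integrable_compact) auto
  have ind_lip: "\<bar>indicator (- \<Omega>) y * F s y - indicator (- \<Omega>) y * F t y\<bar> \<le> indicator (cball 0 R) y *\<^sub>R M * \<bar>s - t\<bar>"
    if "s \<in> {0..T}" "t \<in> {0..T}" for s t y
  proof -
    have "\<bar>indicator (- \<Omega>) y * F s y - indicator (- \<Omega>) y * F t y\<bar> \<le> \<bar>F s y - F t y\<bar>"
      by (simp add: indicator_def)
    then show ?thesis using F_lip[OF that, of y] by linarith
  qed
  have m_deriv: "\<exists>D \<le> A * m t. (m has_real_derivative D) (at t within {0..T})" if t: "t \<in> {0..T} - N" for t
  proof -
    obtain v where v: "v \<in> subunit_vectors X (\<gamma> t)" "(\<gamma> has_vector_derivative v) (at t within {0..T})"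
      using deriv[OF t] by blast
    obtain \<theta> :: "'m \<Rightarrow> real" where \<theta>: "(\<Sum>j\<in>UNIV. (\<theta> j)\<^sup>2) \<le> 1" and v_eq: "v = (\<Sum>j\<in>UNIV. \<theta> j *\<^sub>R X j (\<gamma> t))"
      using v(1) unfolding subunit_vectors_def by auto
    define Y where "Y = (\<lambda>y. \<Sum>j\<in>UNIV. \<theta> j *\<^sub>R X j (closest_point (cball 0 R) y))"
    have Ylip: "K-lipschitz_on UNIV Y"
      unfolding Y_def K_def using \<open>R \<ge> 1\<close> by (intro subunit_field_lipschitz X \<theta>) auto
    have "closest_point (cball 0 R) (\<gamma> t) = \<gamma> t" using inside[of t] t by (intro closest_point_self) auto
    then have Yv: "Y (\<gamma> t) = v" by (simp add: Y_def v_eq)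
    define \<rho>' where "\<rho>' = - (2 * K) * \<rho> t"
    have d\<rho>: "(\<rho> has_real_derivative \<rho>') (at t within {0..T})"
      unfolding \<rho>_def \<rho>'_def by (auto intro!: derivative_eq_intros)
    define F' where "F' y = 2 * max 0 (\<rho> t - (norm (y - \<gamma> t))\<^sup>2) * (\<rho>' + 2 * ((y - \<gamma> t) \<bullet> v))" for y
    have dF: "((\<lambda>s. F s y) has_real_derivative F' y) (at t within {0..T})" for y
      unfolding F_def F'_def by (rule bump_time_derivative[OF v(2) d\<rho>])
    define D where "D = (\<integral>y. indicator (- \<Omega>) y * F' y \<partial>lborel)"
    have cF': "continuous_on UNIV F'" unfolding F'_def by (intro continuous_intros)
    have F'0: "F' y = 0" if "norm y > R" for y
    proof -
      have "F t y = 0" using F0[OF that] t by auto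
      then show ?thesis by (simp add: F_def bump_def F'_def)
    qed
    have intF': "integrable lborel (\<lambda>y. indicator (- \<Omega>) y * F' y)"
      using integrable_real_mult_indicator[OF _ integrable_continuous_compact_support[OF cF' F'0], of "- \<Omega>"] open_\<Omega>
      by (simp add: mult.commute)
    have "(m has_real_derivative D) (at t within {0..T})"
      unfolding m_def D_def
    proof (rule has_real_derivative_integral[OF intF _ _ _ intM ind_lip])
      show "((\<lambda>s. indicator (- \<Omega>) y * F s y) has_real_derivative indicator (- \<Omega>) y * F' y) (at t within {0..T})" for y
        by (rule DERIV_cmult[OF dF])
    qed (use t intF' in \<open>auto intro: borel_measurable_integrable\<close>)
    moreover have "D \<le> A * m t"
    proof -
      define Z where "Z = bump_gradient (\<rho> t) (\<gamma> t)"
      have le: "F' y \<le> - (Y y \<bullet> Z y)" for y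
      proof -
        define q where "q = \<rho> t - (norm (y - \<gamma> t))\<^sup>2"
        have "(y - \<gamma> t) \<bullet> (Y (\<gamma> t) - Y y) \<le> norm (y - \<gamma> t) * (K * norm (y - \<gamma> t))"
        proof -
          have "(y - \<gamma> t) \<bullet> (Y (\<gamma> t) - Y y) \<le> norm (y - \<gamma> t) * norm (Y (\<gamma> t) - Y y)" by (rule norm_cauchy_schwarz)
          also have "\<dots> \<le> norm (y - \<gamma> t) * (K * norm (y - \<gamma> t))"
            using lipschitz_onD[OF Ylip, of "\<gamma> t" y] by (intro mult_left_mono) (auto simp: dist_norm norm_minus_commute)
          finally show ?thesis .
        qed
        then have a: "(y - \<gamma> t) \<bullet> v - (y - \<gamma> t) \<bullet> Y y \<le> K * (norm (y - \<gamma> t))\<^sup>2"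
          by (simp add: Yv inner_diff_right power2_eq_square mult_ac)
        have "max 0 q * (\<rho>' + 2 * ((y - \<gamma> t) \<bullet> v)) \<le> max 0 q * (2 * ((y - \<gamma> t) \<bullet> Y y))"
        proof (cases "q > 0")
          case True
          then have "K * (norm (y - \<gamma> t))\<^sup>2 \<le> K * \<rho> t" using \<open>K \<ge> 0\<close> by (intro mult_left_mono) (auto simp: q_def)
          with a have "\<rho>' + 2 * ((y - \<gamma> t) \<bullet> v) \<le> 2 * ((y - \<gamma> t) \<bullet> Y y)"
            unfolding \<rho>'_def by linarith
          then show ?thesis by (intro mult_left_mono) auto
        qed simp
        then have "F' y \<le> 4 * max 0 q * ((y - \<gamma> t) \<bullet> Y y)" unfolding F'_def q_def by linarith
        also have "\<dots> = - (Y y \<bullet> Z y)"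
          unfolding Z_def bump_gradient_def q_def by (simp add: inner_commute)
        finally show ?thesis .
      qed
      have Z0: "Z y = 0" if "norm y > R" for y
      proof -
        have "F t y = 0" using F0[OF that] t by auto
        then show ?thesis by (simp add: F_def bump_def Z_def bump_gradient_def)
      qed
      have cYZ: "continuous_on UNIV (\<lambda>y. Y y \<bullet> Z y)"
        unfolding Z_def by (intro continuous_intros lipschitz_on_continuous_on[OF Ylip] continuous_on_bump_gradient)
      have intYZ: "integrable lborel (\<lambda>y. indicator (- \<Omega>) y * (Y y \<bullet> Z y))"
        using integrable_real_mult_indicator[OF _ integrable_continuous_compact_support[OF cYZ, of R], of "- \<Omega>"] open_\<Omega> Z0
        by (simp add: mult.commute)
      have "D \<le> (\<integral>y. - (indicator (- \<Omega>) y * (Y y \<bullet> Z y)) \<partial>lborel)"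
        unfolding D_def
      proof (rule integral_mono)
        show "indicator (- \<Omega>) y * F' y \<le> - (indicator (- \<Omega>) y * (Y y \<bullet> Z y))" for y
          using le[of y] by (simp add: indicator_def)
      qed (use intF' intYZ in auto)
      also have "\<dots> \<le> \<bar>\<integral>y. indicator (- \<Omega>) y * (Y y \<bullet> Z y) \<partial>lborel\<bar>" by simp
      also have "\<dots> \<le> A * m t"
        unfolding m_def A_def K_def
      proof (rule subunit_field_transport[OF X _ \<Omega>R \<theta> Y_def])
        show "(F t has_derivative (\<lambda>h. Z x \<bullet> h)) (at x)" for x
          unfolding F_def Z_def by (rule has_derivative_bump)
      qed (use F0 t \<open>R \<ge> 1\<close> in \<open>auto simp: F_def bump_nonneg Z_def continuous_on_bump_gradient\<close>)
      finally show ?thesis .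
    qed
    ultimately show ?thesis by blast
  qed
  have m_nonneg: "m t \<ge> 0" for t
    unfolding m_def F_def by (intro integral_nonneg_AE AE_I2 mult_nonneg_nonneg bump_nonneg) auto
  have "m 0 = 0"
  proof -
    have "indicator (- \<Omega>) y * F 0 y = 0" for y
    proof (cases "y \<in> \<Omega>")
      case False
      then have "r \<le> norm (y - \<gamma> 0)" using start by (auto simp: dist_norm norm_minus_commute not_less)
      then have "\<rho> 0 \<le> (norm (y - \<gamma> 0))\<^sup>2" using r by (simp add: \<rho>_def power_mono)
      then show ?thesis by (simp add: F_def bump_eq_0)
    qed simp
    then show ?thesis unfolding m_def by (simp only: Bochner_Integration.integral_zero)
  qed
  define M1 where "M1 = (\<integral>y. indicator (cball 0 R) y *\<^sub>R M \<partial>(lborel :: (real ^ 'n) measure))"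
  have m_lip: "\<bar>m s - m t\<bar> \<le> M1 * \<bar>s - t\<bar>" if st: "s \<in> {0..T}" "t \<in> {0..T}" for s t
  proof -
    have "\<bar>m s - m t\<bar> = \<bar>\<integral>y. indicator (- \<Omega>) y * F s y - indicator (- \<Omega>) y * F t y \<partial>lborel\<bar>"
      unfolding m_def using intF[OF st(1)] intF[OF st(2)] by (simp add: Bochner_Integration.integral_diff)
    also have "\<dots> \<le> (\<integral>y. \<bar>indicator (- \<Omega>) y * F s y - indicator (- \<Omega>) y * F t y\<bar> \<partial>lborel)"
      by (rule integral_abs_bound)
    also have "\<dots> \<le> (\<integral>y. indicator (cball 0 R) y *\<^sub>R M * \<bar>s - t\<bar> \<partial>(lborel :: (real ^ 'n) measure))"
    proof (rule integral_mono)
      show "integrable lborel (\<lambda>y. \<bar>indicator (- \<Omega>) y * F s y - indicator (- \<Omega>) y * F t y\<bar>)"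
        using intF[OF st(1)] intF[OF st(2)] by (intro integrable_abs Bochner_Integration.integrable_diff)
      show "integrable lborel (\<lambda>y::real ^ 'n. indicator (cball 0 R) y *\<^sub>R M * \<bar>s - t\<bar>)"
        using intM by (rule integrable_mult_left)
    qed (rule ind_lip[OF st])
    also have "\<dots> = M1 * \<bar>s - t\<bar>" unfolding M1_def by (rule integral_mult_left_zero)
    finally show ?thesis .
  qed
  have "M1 \<ge> 0"
    unfolding M1_def M_def using \<open>K \<ge> 0\<close> \<open>R \<ge> 1\<close> \<open>C \<ge> 0\<close> by (intro integral_nonneg_AE AE_I2 scaleR_nonneg_nonneg) auto
  define h where "h t = exp (- A * t) * m t" for t
  \<comment> \<open>Products of Lipschitz functions on a bounded interval: \<open>m \<le> M1 * T\<close> there, as \<open>m 0 = 0\<close>.\<close>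
  have "absolutely_continuous_path 0 T h"
  proof (rule absolutely_continuous_path_dominated)
    have l1: "M1-lipschitz_on {0..T} m"
      using m_lip \<open>M1 \<ge> 0\<close> by (intro lipschitz_onI) (auto simp: dist_real_def)
    show "absolutely_continuous_path 0 T m" by (rule lipschitz_imp_absolutely_continuous_path[OF l1])
    have l2: "(M1 * T * A)-lipschitz_on {0..T} (\<lambda>t. M1 * T * exp (- A * t))"
    proof (rule lipschitz_onI)
      fix s t assume "s \<in> {0..T}" "t \<in> {0..T}"
      then have "\<bar>exp (- A * s) - exp (- A * t)\<bar> \<le> A * \<bar>s - t\<bar>" using \<open>A \<ge> 0\<close> by (intro exp_decay_lipschitz) auto
      then have "M1 * T * \<bar>exp (- A * s) - exp (- A * t)\<bar> \<le> M1 * T * (A * \<bar>s - t\<bar>)"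
        using \<open>M1 \<ge> 0\<close> \<open>T \<ge> 0\<close> by (intro mult_left_mono) auto
      moreover have "\<bar>M1 * T * exp (- A * s) - M1 * T * exp (- A * t)\<bar> = M1 * T * \<bar>exp (- A * s) - exp (- A * t)\<bar>"
        using \<open>M1 \<ge> 0\<close> \<open>T \<ge> 0\<close> by (simp add: right_diff_distrib[symmetric] abs_mult)
      ultimately show "dist (M1 * T * exp (- A * s)) (M1 * T * exp (- A * t)) \<le> M1 * T * A * dist s t"
        by (simp add: dist_real_def mult.assoc)
    qed (use \<open>M1 \<ge> 0\<close> \<open>T \<ge> 0\<close> \<open>A \<ge> 0\<close> in auto)
    show "absolutely_continuous_path 0 T (\<lambda>t. M1 * T * exp (- A * t))"
      by (rule lipschitz_imp_absolutely_continuous_path[OF l2])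
    fix s t assume st: "0 \<le> s" "s \<le> t" "t \<le> T"
    have "m s \<le> M1 * T"
    proof -
      have "m s \<le> M1 * s" using m_lip[of s 0] \<open>m 0 = 0\<close> st m_nonneg[of s] by simp
      also have "\<dots> \<le> M1 * T" using st \<open>M1 \<ge> 0\<close> by (intro mult_left_mono) auto
      finally show ?thesis .
    qed
    have "h t - h s = exp (- A * t) * (m t - m s) + m s * (exp (- A * t) - exp (- A * s))"
      by (simp add: h_def algebra_simps)
    then have "\<bar>h t - h s\<bar> \<le> exp (- A * t) * \<bar>m t - m s\<bar> + m s * \<bar>exp (- A * t) - exp (- A * s)\<bar>"
      using abs_triangle_ineq[of "exp (- A * t) * (m t - m s)" "m s * (exp (- A * t) - exp (- A * s))"] m_nonneg[of s]
      by (simp add: abs_mult)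
    also have "\<dots> \<le> 1 * \<bar>m t - m s\<bar> + M1 * T * \<bar>exp (- A * t) - exp (- A * s)\<bar>"
      using \<open>A \<ge> 0\<close> st \<open>m s \<le> M1 * T\<close> by (intro add_mono mult_right_mono) auto
    also have "M1 * T * \<bar>exp (- A * t) - exp (- A * s)\<bar> = \<bar>M1 * T * exp (- A * t) - M1 * T * exp (- A * s)\<bar>"
      using \<open>M1 \<ge> 0\<close> \<open>T \<ge> 0\<close> by (simp add: right_diff_distrib[symmetric] abs_mult)
    finally show "norm (h t - h s) \<le> norm (m t - m s) + norm (M1 * T * exp (- A * t) - M1 * T * exp (- A * s))" by simp
  qed
  moreover have "AE t in lebesgue_on {0..T}. \<exists>D\<le>0. (h has_vector_derivative D) (at t within {0..T})"
  proof -
    have "\<exists>D\<le>0. (h has_vector_derivative D) (at t within {0..T})" if t: "t \<in> {0..T} - N" for t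
    proof -
      obtain D where D: "D \<le> A * m t" "(m has_real_derivative D) (at t within {0..T})" using m_deriv[OF t] by blast
      have "(h has_real_derivative exp (- A * t) * (D - A * m t)) (at t within {0..T})"
        unfolding h_def by (auto intro!: derivative_eq_intros D(2) simp: algebra_simps)
      moreover have "exp (- A * t) * (D - A * m t) \<le> 0" using D(1) by (intro mult_nonneg_nonpos) auto
      ultimately show ?thesis unfolding has_real_derivative_iff_has_vector_derivative by blast
    qed
    then have "AE t in lebesgue. t \<in> {0..T} \<longrightarrow> (\<exists>D\<le>0. (h has_vector_derivative D) (at t within {0..T}))"
      unfolding eventually_ae_filter_negligible using N by blast
    then show ?thesis by (subst AE_restrict_space_iff) auto
  qed
  ultimately have "h T \<le> h 0" using absolutely_continuous_path_nonincreasing \<open>T \<ge> 0\<close> by blast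
  then have "m T \<le> 0" by (simp add: h_def \<open>m 0 = 0\<close> mult_le_0_iff)
  then have "m T = 0" using m_nonneg[of T] by simp
  then have "AE y in lborel. indicator (- \<Omega>) y * F T y = 0"
    unfolding m_def using intF[of T] \<open>T \<ge> 0\<close>
    by (subst (asm) integral_nonneg_eq_0_iff_AE) (auto simp: F_def bump_nonneg)
  then have "AE y in lebesgue. indicator (- \<Omega>) y * F T y = 0" by (rule AE_completion)
  then obtain N' where N': "negligible N'" "{y. indicator (- \<Omega>) y * F T y \<noteq> 0} \<subseteq> N'"
    unfolding eventually_ae_filter_negligible by blast
  have "ball (\<gamma> T) (r * exp (- K * T)) - \<Omega> \<subseteq> {y. indicator (- \<Omega>) y * F T y \<noteq> 0}"
  proof
    fix y assume y: "y \<in> ball (\<gamma> T) (r * exp (- K * T)) - \<Omega>"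
    then have "norm (y - \<gamma> T) < r * exp (- K * T)" by (simp add: dist_norm norm_minus_commute)
    then have "(norm (y - \<gamma> T))\<^sup>2 < \<rho> T" unfolding \<rho>_sq by (intro power_strict_mono) auto
    then have "F T y > 0" unfolding F_def by (rule bump_pos)
    then show "y \<in> {y. indicator (- \<Omega>) y * F T y \<noteq> 0}" using y by simp
  qed
  then show ?thesis using N' unfolding K_def by (meson negligible_subset order_trans)
qed

end

lemma integrable_lebesgue_on_continuous:
  fixes f :: "'a::euclidean_space \<Rightarrow> real"
  assumes "continuous_on UNIV f" "bounded S" "S \<in> sets borel"
  shows "integrable (lebesgue_on S) f"
proof -
  have "integrable lebesgue (\<lambda>y. indicator S y *\<^sub>R f y)"
    using integrable_completion[of "\<lambda>y. indicator S y * f y" lborel] integrable_indicator_mult_continuous[OF assms]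
    by (auto dest: borel_measurable_integrable)
  then show ?thesis using assms(3) by (subst integrable_restrict_space) auto
qed

lemma local_lipschitz_imp_lipschitz_on_cball:
  fixes f :: "'m::finite \<Rightarrow> 'a::euclidean_space \<Rightarrow> 'a"
  assumes "\<And>j. local_lipschitz (UNIV :: real set) UNIV (\<lambda>_. f j)"
  obtains L where "\<And>j. L-lipschitz_on (cball 0 R) (f j)"
proof -
  have "\<exists>L. L-lipschitz_on (cball 0 R) (f j)" for j
  proof -
    have "local_lipschitz {0::real} (cball 0 R) (\<lambda>_. f j)"
      by (rule local_lipschitz_subset[OF assms[of j]]) auto
    then obtain L where "\<And>t. t \<in> {0::real} \<Longrightarrow> L-lipschitz_on (cball 0 R) (f j)"
      by (rule local_lipschitz_compact_implies_lipschitz) auto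
    then show ?thesis by auto
  qed
  then obtain L where L: "\<And>j. (L j)-lipschitz_on (cball 0 R) (f j)" by metis
  have "(Max (range L))-lipschitz_on (cball 0 R) (f j)" for j
    by (rule lipschitz_on_le[OF L]) auto
  then show ?thesis by (rule that)
qed

context zero_energy_constant
begin

text \<open>
  A subunit path may leave \<open>\<Omega>\<close>, and a bound for \<open>\<gamma>\<close> that depends on the path would give a Lipschitz constant
  that depends on it.  However, up to the first time at which \<open>norm (\<gamma> t) = R + 1\<close> the lemma \<open>path_keeps_ball\<close> applies, and
  at that time a ball of radius at most \<open>1\<close> around \<open>\<gamma> t\<close> would lie in \<open>\<Omega>\<close> up to a null set, although it is
  disjoint from \<open>ball 0 R\<close>.  So that time does not come.
\<close>

lemma subunit_path_keeps_ball:
  fixes L :: real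
  assumes X: "\<And>j. L-lipschitz_on (cball 0 (R + 2)) (X j)" and \<Omega>R: "\<Omega> \<subseteq> ball 0 R"
    and su: "subunit_path X T \<gamma>" and "T \<ge> 0"
    and r: "0 < r" "r \<le> 1" and start: "ball (\<gamma> 0) r \<subseteq> \<Omega>"
  shows "negligible (ball (\<gamma> T) (r * exp (- (CARD('m) * L) * T)) - \<Omega>)"
proof -
  obtain C N where lip: "C-lipschitz_on {0..T} \<gamma>" and N: "negligible N"
    and deriv: "\<And>t. t \<in> {0..T} - N \<Longrightarrow> \<exists>v\<in>subunit_vectors X (\<gamma> t). (\<gamma> has_vector_derivative v) (at t within {0..T})"
    using su unfolding subunit_path_iff[where X=X, OF cont_X] by blast
  have cont: "continuous_on {0..T} \<gamma>" using lip by (rule lipschitz_on_continuous_on)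
  have upto: "negligible (ball (\<gamma> s) (r * exp (- (CARD('m) * L) * s)) - \<Omega>)"
    if s: "0 \<le> s" "s \<le> T" and inside: "\<And>t. t \<in> {0..s} \<Longrightarrow> norm (\<gamma> t) \<le> R + 1" for s
  proof (rule path_keeps_ball[where R="R + 2" and \<gamma>=\<gamma> and C=C and N=N, OF X _ _ s(1) N _ _ r start])
    show "\<Omega> \<subseteq> cball 0 (R + 2)" using \<Omega>R by auto
    show "C-lipschitz_on {0..s} \<gamma>" using lip s by (auto intro: lipschitz_on_subset)
    show "\<exists>v\<in>subunit_vectors X (\<gamma> t). (\<gamma> has_vector_derivative v) (at t within {0..s})" if t: "t \<in> {0..s} - N" for t
    proof -
      obtain v where v: "v \<in> subunit_vectors X (\<gamma> t)" "(\<gamma> has_vector_derivative v) (at t within {0..T})"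
        using deriv[of t] t s by auto
      have "(\<gamma> has_vector_derivative v) (at t within {0..s})"
        by (rule has_vector_derivative_within_subset[OF v(2)]) (use s in auto)
      then show ?thesis using v(1) by blast
    qed
    show "norm (\<gamma> t) \<le> R + 2 - 1" if "t \<in> {0..s}" for t using inside[OF that] by simp
  qed
  have "norm (\<gamma> t) \<le> R + 1" if t: "t \<in> {0..T}" for t
  proof (rule ccontr)
    assume nt: "\<not> norm (\<gamma> t) \<le> R + 1"
    define S where "S = {0..T} \<inter> (\<lambda>t. norm (\<gamma> t)) -` {R + 1..}"
    have "closed S"
      unfolding S_def by (intro continuous_closed_preimage continuous_on_norm cont closed_real_atLeastAtMost closed_atLeast)
    moreover have "bounded S" by (rule bounded_subset[of "{0..T}"]) (auto simp: S_def)
    ultimately have "compact S" by (simp add: compact_eq_bounded_closed)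
    have "S \<noteq> {}" using nt t by (auto simp: S_def)
    from compact_attains_inf[OF \<open>compact S\<close> this]
    obtain s where s: "s \<in> S" "\<And>u. u \<in> S \<Longrightarrow> s \<le> u" by blast
    have s0: "0 \<le> s" "s \<le> T" "norm (\<gamma> s) \<ge> R + 1" using s(1) by (auto simp: S_def)
    have "norm (\<gamma> 0) \<le> R + 1"
    proof -
      have "\<gamma> 0 \<in> \<Omega>" using start r by auto
      then have "\<gamma> 0 \<in> ball 0 R" using \<Omega>R by blast
      then show ?thesis by simp
    qed
    then obtain u where u: "0 \<le> u" "u \<le> s" "norm (\<gamma> u) = R + 1"
      using IVT'[of "\<lambda>t. norm (\<gamma> t)" 0 "R + 1" s] s0 continuous_on_subset[OF continuous_on_norm[OF cont], of "{0..s}"] by auto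
    then have "u \<in> S" using s0 by (auto simp: S_def)
    then have us: "norm (\<gamma> s) = R + 1" using s(2)[of u] u by simp
    have before: "norm (\<gamma> t') \<le> R + 1" if "t' \<in> {0..s}" for t'
    proof (cases "t' = s")
      case False
      then have "t' \<notin> S" using s(2)[of t'] that by auto
      then show ?thesis using that s0 by (auto simp: S_def)
    qed (simp add: us)
    define \<delta> where "\<delta> = r * exp (- (CARD('m) * L) * s)"
    have "L \<ge> 0" using X lipschitz_on_nonneg by blast
    then have "exp (- (CARD('m) * L) * s) \<le> 1" using s0 by simp
    then have "\<delta> \<le> 1 * 1" unfolding \<delta>_def using r by (intro mult_mono) auto
    have "ball (\<gamma> s) \<delta> \<inter> \<Omega> = {}"
    proof -
      have "z \<notin> \<Omega>" if "z \<in> ball (\<gamma> s) \<delta>" for z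
      proof
        assume "z \<in> \<Omega>"
        then have "z \<in> ball 0 R" using \<Omega>R by blast
        then have "norm z < R" by simp
        then show False using that us \<open>\<delta> \<le> 1 * 1\<close> norm_triangle_ineq2[of "\<gamma> s" z] by (simp add: dist_norm)
      qed
      then show ?thesis by blast
    qed
    then have "ball (\<gamma> s) \<delta> - \<Omega> = ball (\<gamma> s) \<delta>" by blast
    then have "negligible (ball (\<gamma> s) \<delta>)"
      using upto[OF s0(1,2) before] unfolding \<delta>_def by simp
    moreover have "\<delta> > 0" using r by (simp add: \<delta>_def)
    ultimately show False using open_not_negligible[of "ball (\<gamma> s) \<delta>"] by simp
  qed
  then show ?thesis using upto[of T] \<open>T \<ge> 0\<close> by simp
qed

text \<open>
  All points of \<open>\<Omega>\<close> are reached from \<open>x\<close> before time \<open>D\<close>, so there is \<open>\<delta>\<close> such that every ball of radius \<open>\<delta>\<close> centred in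
  \<open>\<Omega>\<close> is contained in \<open>\<Omega>\<close> up to a null set.  This fails for a centre whose \<open>i\<close>-th coordinate is close to its
  supremum over \<open>\<Omega>\<close>.
\<close>

lemma contradiction_if_bounded_cc_dist:
  assumes lip: "\<And>j. local_lipschitz (UNIV :: real set) UNIV (\<lambda>_. X j)"
    and conn: "X_connected \<Omega> X" and x: "x \<in> \<Omega>" and D: "\<And>y. y \<in> \<Omega> \<Longrightarrow> cc_dist X x y < D"
  shows False
proof -
  obtain R where \<Omega>R: "\<Omega> \<subseteq> ball 0 R" using bounded_subset_ballD[OF bounded_\<Omega>, of 0] by blast
  obtain L where L: "\<And>j. L-lipschitz_on (cball 0 (R + 2)) (X j)"
    using local_lipschitz_imp_lipschitz_on_cball[of X, OF lip] by blast
  have "L \<ge> 0" using L lipschitz_on_nonneg by blast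
  obtain r0 where "r0 > 0" "ball x r0 \<subseteq> \<Omega>" using open_\<Omega> x open_contains_ball by blast
  then obtain r where r: "0 < r" "r \<le> 1" "ball x r \<subseteq> \<Omega>"
    using subset_ball[of "min r0 1" r0 x] by (intro that[of "min r0 1"]) auto
  define \<delta> where "\<delta> = r * exp (- (CARD('m) * L) * D)"
  have "\<delta> > 0" using r by (simp add: \<delta>_def)
  have small: "negligible (ball y \<delta> - \<Omega>)" if y: "y \<in> \<Omega>" for y
  proof -
    obtain T \<gamma> where T: "0 < T" "T < D" "subunit_path X T \<gamma>" "\<gamma> 0 = x" "\<gamma> T = y"
      using cc_dist_lessE[OF conn x y D[OF y]] by blast
    have "negligible (ball y (r * exp (- (CARD('m) * L) * T)) - \<Omega>)"
      using subunit_path_keeps_ball[OF L \<Omega>R T(3) _ r(1,2)] T r(3) by simp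
    moreover have "\<delta> \<le> r * exp (- (CARD('m) * L) * T)"
      unfolding \<delta>_def using r T \<open>L \<ge> 0\<close> by (auto intro!: mult_left_mono)
    then have "ball y \<delta> - \<Omega> \<subseteq> ball y (r * exp (- (CARD('m) * L) * T)) - \<Omega>" by auto
    ultimately show ?thesis using negligible_subset by blast
  qed
  \<comment> \<open>The choice of the coordinate does not matter.\<close>
  obtain i :: 'n where True by simp
  define H where "H = (\<lambda>y::real ^ 'n. y $ i) ` \<Omega>"
  have H: "H \<noteq> {}" "bdd_above H"
  proof -
    show "H \<noteq> {}" using x by (auto simp: H_def)
    have "y $ i \<le> R" if "y \<in> \<Omega>" for y
      using that \<Omega>R component_le_norm_cart[of y i] by (force simp: subset_iff)
    then show "bdd_above H" by (auto simp: H_def bdd_above_def)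
  qed
  obtain y where y: "y \<in> \<Omega>" "Sup H - \<delta> / 2 < y $ i"
    using less_cSup_iff[OF H, of "Sup H - \<delta> / 2"] \<open>\<delta> > 0\<close> by (auto simp: H_def)
  define U where "U = ball y \<delta> \<inter> {z. z $ i > Sup H}"
  have "open U" unfolding U_def by (intro open_Int open_ball open_Collect_less continuous_intros)
  moreover have "y + (\<delta> / 2) *\<^sub>R axis i 1 \<in> U"
    using y(2) \<open>\<delta> > 0\<close> by (simp add: U_def dist_norm)
  moreover have "U \<subseteq> ball y \<delta> - \<Omega>"
  proof -
    have "z $ i \<le> Sup H" if "z \<in> \<Omega>" for z using that H(2) by (auto simp: H_def intro: cSup_upper)
    then show ?thesis unfolding U_def by force
  qed
  ultimately show False
    using open_not_negligible[of U] negligible_subset[OF small[OF y(1)], of U] by blast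
qed

end

section \<open>The Liouville property\<close>

text \<open>
  For a large radius the ball is all of \<open>\<Omega>\<close>, and the Poincare inequality forces \<open>z\<close> to be equal to its average.  A nonzero average
  is ruled out by the transport of balls.
\<close>

lemma vanishing_X_grad_limit_eq_0:
  fixes X :: "'m::finite \<Rightarrow> real ^ 'n \<Rightarrow> real ^ 'n"
  assumes \<Omega>: "open \<Omega>" "bounded \<Omega>"
    and lip: "\<And>j. local_lipschitz (UNIV :: real set) UNIV (\<lambda>_. X j)"
    and conn: "X_connected \<Omega> X" and dbl: "cc_doubling \<Omega> X Q"
    and poin: "cc_poincare \<Omega> X C\<^sub>P \<nu>" and "\<nu> > 0"
    and test: "\<And>n. \<psi> n \<in> test_functions \<Omega>" and z: "integrable (lebesgue_on \<Omega>) z"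
    and lim_\<psi>: "(\<lambda>n. \<integral>x. \<bar>\<psi> n x - z x\<bar> \<partial>lebesgue_on \<Omega>) \<longlonglongrightarrow> 0"
    and lim_X: "(\<lambda>n. \<integral>x. norm (X_grad X (\<psi> n) x) \<partial>lebesgue_on \<Omega>) \<longlonglongrightarrow> 0"
  shows "AE x in lebesgue_on \<Omega>. z x = 0"
proof (cases "\<Omega> = {}")
  case True
  then show ?thesis by (intro AE_I2) simp
next
  case False
  then obtain x where x: "x \<in> \<Omega>" by blast
  have cont: "continuous_on UNIV (X j)" for j
    using local_lipschitz_continuous_on[OF lip, of 0] by simp
  have \<Omega>m: "\<Omega> \<in> lmeasurable" using \<Omega> by (simp add: lmeasurable_open)
  obtain D where "D > 0" and D: "\<And>y. y \<in> \<Omega> \<Longrightarrow> cc_dist X x y < D"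
    using cc_doubling_imp_bounded_cc_dist[where X=X, OF cont conn dbl \<Omega>m x] by blast
  \<comment> \<open>Both balls in the Poincare inequality, of radius \<open>r\<close> and of radius \<open>\<nu> * r\<close>, are then \<open>\<Omega>\<close>.\<close>
  define r where "r = max D (D / \<nu>)"
  have r: "r > 0" "r \<ge> D" "\<nu> * r \<ge> D"
  proof -
    show "r > 0" "r \<ge> D" using \<open>D > 0\<close> by (auto simp: r_def)
    have "\<nu> * r \<ge> \<nu> * (D / \<nu>)" using \<open>\<nu> > 0\<close> by (intro mult_left_mono) (auto simp: r_def)
    then show "\<nu> * r \<ge> D" using \<open>\<nu> > 0\<close> by simp
  qed
  have balls: "cc_ball \<Omega> X x r = \<Omega>" "cc_ball \<Omega> X x (\<nu> * r) = \<Omega>"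
    using D r by (force simp: cc_ball_def)+
  define V where "V = measure lebesgue \<Omega>"
  have "V > 0" using cc_doubling_imp_lmeasurable(2)[OF dbl x r(1)] by (simp add: V_def balls)
  interpret finite_measure "lebesgue_on \<Omega>"
    using \<Omega>m by (rule finite_measure_lebesgue_on)
  have space: "measure (lebesgue_on \<Omega>) \<Omega> = V"
    using \<Omega>m by (simp add: V_def measure_restrict_space fmeasurableD)
  have i\<psi>: "integrable (lebesgue_on \<Omega>) (\<psi> n)" for n
    by (intro integrable_lebesgue_on_continuous continuous_on_test_function[OF test] \<Omega> borel_open)
  define a where "a n = average \<Omega> (\<psi> n)" for n
  define c where "c = average \<Omega> z"
  have poin_n: "(\<integral>x. \<bar>\<psi> n x - a n\<bar> \<partial>lebesgue_on \<Omega>) \<le> C\<^sub>P * r * (\<integral>x. norm (X_grad X (\<psi> n) x) \<partial>lebesgue_on \<Omega>)" for n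
  proof -
    have "average \<Omega> (\<lambda>y. \<bar>\<psi> n y - average \<Omega> (\<psi> n)\<bar>) \<le> C\<^sub>P * r * average \<Omega> (\<lambda>y. norm (X_grad X (\<psi> n) y))"
      using poin[unfolded cc_poincare_def, rule_format, OF x r(1), of UNIV "\<psi> n"] test_function_Ck_on[OF test, of 1 n]
      by (simp add: balls)
    then show ?thesis using \<open>V > 0\<close> by (simp add: average_def a_def V_def[symmetric] field_simps)
  qed
  have "(\<integral>x. \<bar>z x - c\<bar> \<partial>lebesgue_on \<Omega>) \<le> 2 * (\<integral>x. \<bar>\<psi> n x - z x\<bar> \<partial>lebesgue_on \<Omega>)
      + C\<^sub>P * r * (\<integral>x. norm (X_grad X (\<psi> n) x) \<partial>lebesgue_on \<Omega>)" for n
  proof -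
    have "a n - c = 1 / V * (\<integral>x. \<psi> n x - z x \<partial>lebesgue_on \<Omega>)"
      using i\<psi>[of n] z by (simp add: a_def c_def average_def V_def right_diff_distrib Bochner_Integration.integral_diff)
    then have "V * \<bar>a n - c\<bar> = \<bar>\<integral>x. \<psi> n x - z x \<partial>lebesgue_on \<Omega>\<bar>"
      using \<open>V > 0\<close> by (simp add: abs_mult)
    also have "\<dots> \<le> (\<integral>x. \<bar>\<psi> n x - z x\<bar> \<partial>lebesgue_on \<Omega>)" by (rule integral_abs_bound)
    finally have ac: "V * \<bar>a n - c\<bar> \<le> (\<integral>x. \<bar>\<psi> n x - z x\<bar> \<partial>lebesgue_on \<Omega>)" .
    have "(\<integral>x. \<bar>z x - c\<bar> \<partial>lebesgue_on \<Omega>) \<le> (\<integral>x. \<bar>\<psi> n x - z x\<bar> + \<bar>\<psi> n x - a n\<bar> + \<bar>a n - c\<bar> \<partial>lebesgue_on \<Omega>)"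
      using i\<psi>[of n] z by (intro integral_mono) auto
    also have "\<dots> = (\<integral>x. \<bar>\<psi> n x - z x\<bar> \<partial>lebesgue_on \<Omega>) + (\<integral>x. \<bar>\<psi> n x - a n\<bar> \<partial>lebesgue_on \<Omega>) + V * \<bar>a n - c\<bar>"
      using i\<psi>[of n] z by (simp add: Bochner_Integration.integral_add space)
    finally show ?thesis using ac poin_n[of n] by linarith
  qed
  moreover have "(\<lambda>n. 2 * (\<integral>x. \<bar>\<psi> n x - z x\<bar> \<partial>lebesgue_on \<Omega>)
      + C\<^sub>P * r * (\<integral>x. norm (X_grad X (\<psi> n) x) \<partial>lebesgue_on \<Omega>)) \<longlonglongrightarrow> 2 * 0 + C\<^sub>P * r * 0"
    by (intro tendsto_intros lim_\<psi> lim_X)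
  ultimately have "(\<integral>x. \<bar>z x - c\<bar> \<partial>lebesgue_on \<Omega>) \<le> 0"
    using LIMSEQ_le_const[of _ "2 * 0 + C\<^sub>P * r * 0"] by fastforce
  moreover have "(\<integral>x. \<bar>z x - c\<bar> \<partial>lebesgue_on \<Omega>) \<ge> 0" by simp
  ultimately have "(\<integral>x. \<bar>z x - c\<bar> \<partial>lebesgue_on \<Omega>) = 0" by linarith
  then have zc: "AE x in lebesgue_on \<Omega>. z x = c"
    using z by (subst (asm) integral_nonneg_eq_0_iff_AE) auto
  have "c = 0"
  proof (rule ccontr)
    assume "c \<noteq> 0"
    have "(\<integral>x. \<bar>\<psi> n x - c\<bar> \<partial>lebesgue_on \<Omega>) = (\<integral>x. \<bar>\<psi> n x - z x\<bar> \<partial>lebesgue_on \<Omega>)" for n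
      using zc i\<psi>[of n] z by (intro integral_cong_AE) (auto dest: borel_measurable_integrable)
    then interpret zero_energy_constant \<Omega> X \<psi> c
      using \<Omega> cont test \<open>c \<noteq> 0\<close> lim_\<psi> lim_X by unfold_locales auto
    show False by (rule contradiction_if_bounded_cc_dist[OF lip conn x D])
  qed
  then show ?thesis using zc by simp
qed

section \<open>Convergence in Lebesgue spaces\<close>

lemma Lp_tendsto_imp_integral_tendsto_0:
  assumes "Lp_tendsto p \<Omega> fs f" "p > 0"
  shows "(\<lambda>n. \<integral>x. norm (fs n x - f x) powr p \<partial>lebesgue_on \<Omega>) \<longlonglongrightarrow> 0"
proof -
  define I where "I n = (\<integral>x. norm (fs n x - f x) powr p \<partial>lebesgue_on \<Omega>)" for n
  have "I n \<ge> 0" for n unfolding I_def by simp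
  then have eq: "(I n powr (1 / p)) powr p = I n" for n using \<open>p > 0\<close> by (simp add: powr_powr)
  have "(\<lambda>n. I n powr (1 / p)) \<longlonglongrightarrow> 0" using assms(1) by (simp add: Lp_tendsto_def Lp_norm_def I_def)
  then have "(\<lambda>n. (I n powr (1 / p)) powr p) \<longlonglongrightarrow> 0 powr p"
    by (rule tendsto_powr') (use \<open>p > 0\<close> in auto)
  then show ?thesis using eq by (simp add: I_def)
qed

lemma Lp_space_1_iff: "f \<in> Lp_space 1 \<Omega> \<longleftrightarrow> f \<in> borel_measurable (lebesgue_on \<Omega>) \<and> integrable (lebesgue_on \<Omega>) (\<lambda>x. norm (f x))"
  by (simp add: Lp_space_def)

lemma Lp_space_2_iff: "f \<in> Lp_space 2 \<Omega> \<longleftrightarrow> f \<in> borel_measurable (lebesgue_on \<Omega>) \<and> integrable (lebesgue_on \<Omega>) (\<lambda>x. (norm (f x))\<^sup>2)"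
  by (simp add: Lp_space_def)

lemma Lp_tendsto_1D:
  fixes f :: "'a::euclidean_space \<Rightarrow> real"
  assumes "Lp_tendsto 1 \<Omega> fs f"
  shows "\<And>n. integrable (lebesgue_on \<Omega>) (fs n)" "integrable (lebesgue_on \<Omega>) f"
    "(\<lambda>n. \<integral>x. \<bar>fs n x - f x\<bar> \<partial>lebesgue_on \<Omega>) \<longlonglongrightarrow> 0"
proof -
  have "h \<in> Lp_space 1 \<Omega> \<Longrightarrow> integrable (lebesgue_on \<Omega>) h" for h :: "'a \<Rightarrow> real"
    using integrable_norm_cancel[of "lebesgue_on \<Omega>" h] by (simp add: Lp_space_1_iff)
  then show "\<And>n. integrable (lebesgue_on \<Omega>) (fs n)" "integrable (lebesgue_on \<Omega>) f"
    using assms by (auto simp: Lp_tendsto_def)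
  show "(\<lambda>n. \<integral>x. \<bar>fs n x - f x\<bar> \<partial>lebesgue_on \<Omega>) \<longlonglongrightarrow> 0"
    using Lp_tendsto_imp_integral_tendsto_0[OF assms] by simp
qed

lemma Lp_tendsto_2D:
  assumes "Lp_tendsto 2 \<Omega> fs f"
  shows "\<And>n. fs n \<in> borel_measurable (lebesgue_on \<Omega>)" "f \<in> borel_measurable (lebesgue_on \<Omega>)"
    "\<And>n. integrable (lebesgue_on \<Omega>) (\<lambda>x. (norm (fs n x))\<^sup>2)" "integrable (lebesgue_on \<Omega>) (\<lambda>x. (norm (f x))\<^sup>2)"
    "(\<lambda>n. \<integral>x. (norm (fs n x - f x))\<^sup>2 \<partial>lebesgue_on \<Omega>) \<longlonglongrightarrow> 0"
  using assms Lp_tendsto_imp_integral_tendsto_0[OF assms]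
  by (auto simp: Lp_tendsto_def Lp_space_2_iff)

lemma norm_diff_power2_le: "(norm (a - b))\<^sup>2 \<le> 2 * (norm a)\<^sup>2 + 2 * (norm b)\<^sup>2"
  for a b :: "'a::real_normed_vector"
proof -
  have "(norm (a - b))\<^sup>2 \<le> (norm a + norm b)\<^sup>2" using norm_triangle_ineq4 by (intro power_mono) auto
  also have "\<dots> \<le> 2 * (norm a)\<^sup>2 + 2 * (norm b)\<^sup>2"
    using zero_le_power2[of "norm a - norm b"] by (simp add: power2_sum power2_diff)
  finally show ?thesis .
qed

lemma integrable_norm_diff_power2:
  fixes f g :: "'a \<Rightarrow> 'b::euclidean_space"
  assumes "f \<in> borel_measurable M" "g \<in> borel_measurable M"
    and "integrable M (\<lambda>x. (norm (f x))\<^sup>2)" "integrable M (\<lambda>x. (norm (g x))\<^sup>2)"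
  shows "integrable M (\<lambda>x. (norm (f x - g x))\<^sup>2)"
proof (rule Bochner_Integration.integrable_bound)
  show "integrable M (\<lambda>x. 2 * (norm (f x))\<^sup>2 + 2 * (norm (g x))\<^sup>2)" using assms by simp
  show "(\<lambda>x. (norm (f x - g x))\<^sup>2) \<in> borel_measurable M" using assms by measurable
qed (use norm_diff_power2_le in \<open>auto intro!: AE_I2\<close>)

lemma integrable_inner_L2:
  fixes f g :: "'a \<Rightarrow> 'b::euclidean_space"
  assumes "f \<in> borel_measurable M" "g \<in> borel_measurable M"
    and "integrable M (\<lambda>x. (norm (f x))\<^sup>2)" "integrable M (\<lambda>x. (norm (g x))\<^sup>2)"
  shows "integrable M (\<lambda>x. f x \<bullet> g x)"
proof (rule Bochner_Integration.integrable_bound)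
  show "integrable M (\<lambda>x. (norm (f x))\<^sup>2 + (norm (g x))\<^sup>2)" using assms by simp
  show "(\<lambda>x. f x \<bullet> g x) \<in> borel_measurable M" using assms by measurable
  have "\<bar>f x \<bullet> g x\<bar> \<le> (norm (f x))\<^sup>2 + (norm (g x))\<^sup>2" for x
  proof -
    have "\<bar>f x \<bullet> g x\<bar> \<le> norm (f x) * norm (g x)" by (rule Cauchy_Schwarz_ineq2)
    also have "\<dots> \<le> (norm (f x))\<^sup>2 + (norm (g x))\<^sup>2"
      using zero_le_power2[of "norm (f x) - norm (g x)"] zero_le_power2[of "norm (f x)"] zero_le_power2[of "norm (g x)"]
      by (simp only: power2_diff)
    finally show ?thesis .
  qed
  then show "AE x in M. norm (f x \<bullet> g x) \<le> norm ((norm (f x))\<^sup>2 + (norm (g x))\<^sup>2)"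
    by (intro AE_I2) auto
qed

text \<open>
  Young's inequality \<open>t \<le> d + t\<^sup>2 / d\<close>, with \<open>d\<close> slightly larger than the \<open>L\<^sup>2\<close> norm.
\<close>

lemma (in finite_measure) L2_tendsto_0_imp_L1_tendsto_0:
  fixes f :: "nat \<Rightarrow> 'a \<Rightarrow> 'b::euclidean_space"
  assumes meas: "\<And>n. f n \<in> borel_measurable M" and int: "\<And>n. integrable M (\<lambda>x. (norm (f n x))\<^sup>2)"
    and lim: "(\<lambda>n. \<integral>x. (norm (f n x))\<^sup>2 \<partial>M) \<longlonglongrightarrow> 0"
  shows "integrable M (\<lambda>x. norm (f n x))" "(\<lambda>n. \<integral>x. norm (f n x) \<partial>M) \<longlonglongrightarrow> 0"
proof -
  define V where "V = measure M (space M)"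
  define I where "I n = (\<integral>x. (norm (f n x))\<^sup>2 \<partial>M)" for n
  have I0: "I n \<ge> 0" for n unfolding I_def by simp
  have young: "t \<le> d + t\<^sup>2 / d" if "d > 0" for t d :: real
  proof (cases "t \<le> d")
    case False
    then have "t * d \<le> t * t" using that by (intro mult_left_mono) auto
    then have "t \<le> t\<^sup>2 / d" using that by (simp add: pos_le_divide_eq power2_eq_square)
    then show ?thesis using that by linarith
  qed (use that in \<open>simp add: add_increasing2\<close>)
  show int1: "integrable M (\<lambda>x. norm (f n x))" for n
  proof (rule Bochner_Integration.integrable_bound)
    show "integrable M (\<lambda>x. 1 + (norm (f n x))\<^sup>2)" using int[of n] by simp
    show "(\<lambda>x. norm (f n x)) \<in> borel_measurable M" using meas[of n] by measurable
    show "AE x in M. norm (norm (f n x)) \<le> norm (1 + (norm (f n x))\<^sup>2)"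
      using young[of 1] by (intro AE_I2) (auto intro: order_trans)
  qed
  show "(\<lambda>n. \<integral>x. norm (f n x) \<partial>M) \<longlonglongrightarrow> 0"
  proof (rule Lim_null_comparison, intro always_eventually allI)
    fix n
    \<comment> \<open>The second summand keeps \<open>d\<close> positive when the norm vanishes.\<close>
    define d where "d = sqrt (I n) + inverse (real (Suc n))"
    have "d > 0" using I0[of n] by (simp add: d_def add_nonneg_pos)
    have "(\<integral>x. norm (f n x) \<partial>M) \<le> (\<integral>x. d + (norm (f n x))\<^sup>2 / d \<partial>M)"
      using int1[of n] int[of n] young[OF \<open>d > 0\<close>] by (intro integral_mono) auto
    also have "\<dots> = V * d + I n / d"
      using int[of n] by (simp add: V_def I_def)
    also have "I n / d \<le> sqrt (I n)"
    proof -
      have "I n = sqrt (I n) * sqrt (I n)" using I0[of n] by simp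
      also have "\<dots> \<le> sqrt (I n) * d" using I0[of n] by (intro mult_left_mono) (auto simp: d_def)
      finally show ?thesis using \<open>d > 0\<close> by (simp add: pos_divide_le_eq)
    qed
    finally show "norm (\<integral>x. norm (f n x) \<partial>M) \<le> V * (sqrt (I n) + inverse (real (Suc n))) + sqrt (I n)"
      by (simp add: d_def)
  next
    have "(\<lambda>n. sqrt (I n)) \<longlonglongrightarrow> 0" using tendsto_real_sqrt[OF lim] by (simp add: I_def)
    then have "(\<lambda>n. V * (sqrt (I n) + inverse (real (Suc n))) + sqrt (I n)) \<longlonglongrightarrow> V * (0 + 0) + 0"
      by (intro tendsto_intros LIMSEQ_inverse_real_of_nat)
    then show "(\<lambda>n. V * (sqrt (I n) + inverse (real (Suc n))) + sqrt (I n)) \<longlonglongrightarrow> 0" by simp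
  qed
qed

section \<open>The energy estimate\<close>

lemma tanh_lipschitz: "\<bar>tanh a - tanh b\<bar> \<le> \<bar>a - b\<bar>" for a b :: real
proof -
  have "norm (tanh a - tanh b) \<le> 1 * norm (a - b)"
  proof (rule field_differentiable_bound[of UNIV])
    show "(tanh has_field_derivative (1 - (tanh z)\<^sup>2)) (at z within UNIV)" for z :: real
      by (auto intro!: derivative_eq_intros simp: cosh_real_nonzero)
    show "norm (1 - (tanh z)\<^sup>2) \<le> 1" for z :: real
      using abs_square_le_1[of "tanh z"] tanh_real_bounds[of z] by auto
  qed auto
  then show ?thesis by simp
qed

lemma one_minus_tanh_power2_bounds: "0 \<le> 1 - (tanh a)\<^sup>2" "1 - (tanh a)\<^sup>2 \<le> 1" for a :: real
  using abs_square_le_1[of "tanh a"] tanh_real_bounds[of a] by auto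

lemma borel_measurable_matrix_vector_mult:
  fixes A :: "'a \<Rightarrow> real ^ 'm ^ 'k" and G :: "'a \<Rightarrow> real ^ 'm"
  assumes "A \<in> borel_measurable M" "G \<in> borel_measurable M"
  shows "(\<lambda>x. A x *v G x) \<in> borel_measurable M"
proof (rule borel_measurable_continuous_Pair[OF assms])
  show "continuous_on UNIV (\<lambda>x. fst x *v snd x :: real ^ 'k)"
    unfolding matrix_vector_mult_def by (intro continuous_on_vec_lambda continuous_intros)
qed

lemma W0_grad_test_function:
  fixes X :: "'m::finite \<Rightarrow> real ^ 'n \<Rightarrow> real ^ 'n"
  assumes \<Omega>: "open \<Omega>" "bounded \<Omega>" and X: "\<And>j. continuous_on UNIV (X j)" and u: "u \<in> test_functions \<Omega>"
  shows "W0_grad 2 \<Omega> X u (X_grad X u)" "integrable (lebesgue_on \<Omega>) u"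
    "X_grad X u \<in> borel_measurable (lebesgue_on \<Omega>)" "integrable (lebesgue_on \<Omega>) (\<lambda>x. (norm (X_grad X u x))\<^sup>2)"
proof -
  have c: "continuous_on UNIV u" "continuous_on UNIV (X_grad X u)"
    by (rule continuous_on_test_function[OF u], rule continuous_on_X_grad_test_function[OF u X])
  have m: "u \<in> borel_measurable (lebesgue_on \<Omega>)" "X_grad X u \<in> borel_measurable (lebesgue_on \<Omega>)"
    by (intro measurable_restrict_space1 measurable_completion; use c in \<open>simp add: borel_measurable_continuous_onI\<close>)+
  have i: "integrable (lebesgue_on \<Omega>) u" "integrable (lebesgue_on \<Omega>) (\<lambda>x. (norm (u x))\<^sup>2)"
    "integrable (lebesgue_on \<Omega>) (\<lambda>x. (norm (X_grad X u x))\<^sup>2)"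
    using \<Omega> by (intro integrable_lebesgue_on_continuous continuous_intros c; simp)+
  have "Lp_tendsto 2 \<Omega> (\<lambda>_. u) u" "Lp_tendsto 2 \<Omega> (\<lambda>_. X_grad X u) (X_grad X u)"
    using m i by (simp_all add: Lp_tendsto_def Lp_space_2_iff Lp_norm_def)
  then show "W0_grad 2 \<Omega> X u (X_grad X u)" unfolding W0_grad_def using u by (intro exI[of _ "\<lambda>_. u"]) auto
  show "integrable (lebesgue_on \<Omega>) u" "X_grad X u \<in> borel_measurable (lebesgue_on \<Omega>)"
    "integrable (lebesgue_on \<Omega>) (\<lambda>x. (norm (X_grad X u x))\<^sup>2)" using m i by auto
qed

text \<open>
  Let \<open>\<phi>\<close> be a test function close to \<open>u - v\<close> in the Sobolev space and \<open>G\<close> the \<open>X\<close>-gradient of \<open>u - v\<close>.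
  The weak formulation for \<open>u - v\<close> is tested with \<open>\<psi> = tanh \<phi>\<close>, whose \<open>X\<close>-gradient is \<open>s X\<phi>\<close> with
  \<open>s = 1 - \<psi>\<^sup>2 \<in> [0, 1]\<close>.  Ellipticity gives
  \<open>\<alpha> |X\<psi>|\<^sup>2 \<le> s AX\<phi> \<bullet> X\<phi> = A(X\<phi> - G) \<bullet> X\<psi> + AG \<bullet> X\<psi>\<close>, where Young's
  inequality bounds the first summand by half of the left-hand side and a multiple of \<open>|X\<phi> - G|\<^sup>2\<close>, which is small,
  and the integral of the second one is at most
  \<open>\<integral> |f - g|\<close> as \<open>|\<psi>| \<le> 1\<close>.  Replacing \<open>u - v\<close> by the smooth \<open>\<phi>\<close> before composing with \<open>tanh\<close> avoids
  a chain rule in the Sobolev space, and the boundedness of \<open>\<psi>\<close> makes the pairing with data in \<open>L\<^sup>1\<close>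
  meaningful.
\<close>

lemma tanh_energy_estimate:
  fixes X :: "'m::finite \<Rightarrow> real ^ 'n \<Rightarrow> real ^ 'n" and A :: "real ^ 'n \<Rightarrow> real ^ 'm ^ 'm"
  assumes \<Omega>: "open \<Omega>" "bounded \<Omega>" and X: "\<And>j. continuous_on UNIV (X j)"
    and A: "elliptic_matrix \<Omega> A \<alpha> \<beta>" and "\<alpha> > 0"
    and f: "integrable (lebesgue_on \<Omega>) f" "integrable (lebesgue_on \<Omega>) g"
    and u: "weak_solution \<Omega> X A f u" and v: "weak_solution \<Omega> X A g v" and "\<epsilon> > 0"
  shows "\<exists>\<psi>\<in>test_functions \<Omega>. (\<integral>x. \<bar>\<psi> x - tanh (u x - v x)\<bar> \<partial>lebesgue_on \<Omega>) \<le> \<epsilon> \<and>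
    \<alpha> / 2 * (\<integral>x. (norm (X_grad X \<psi> x))\<^sup>2 \<partial>lebesgue_on \<Omega>) \<le> (\<integral>x. \<bar>f x - g x\<bar> \<partial>lebesgue_on \<Omega>) + \<epsilon>"
proof -
  define M where "M = lebesgue_on \<Omega>"
  have \<Omega>m: "\<Omega> \<in> lmeasurable" using \<Omega> by (simp add: lmeasurable_open)
  interpret finite_measure M
    unfolding M_def using \<Omega>m by (rule finite_measure_lebesgue_on)
  have spM: "space M = \<Omega>" by (simp add: M_def)
  obtain G1 \<phi>1 where weak1: "\<And>\<psi> H. W0_grad 2 \<Omega> X \<psi> H \<Longrightarrow> (\<integral>x. (A x *v G1 x) \<bullet> H x \<partial>M) = (\<integral>x. f x * \<psi> x \<partial>M)"
    and \<phi>1: "\<And>k. \<phi>1 k \<in> test_functions \<Omega>" and t1: "Lp_tendsto 2 \<Omega> \<phi>1 u" and T1: "Lp_tendsto 2 \<Omega> (\<lambda>k. X_grad X (\<phi>1 k)) G1"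
    using u unfolding weak_solution_def W0_grad_def M_def by blast
  obtain G2 \<phi>2 where weak2: "\<And>\<psi> H. W0_grad 2 \<Omega> X \<psi> H \<Longrightarrow> (\<integral>x. (A x *v G2 x) \<bullet> H x \<partial>M) = (\<integral>x. g x * \<psi> x \<partial>M)"
    and \<phi>2: "\<And>k. \<phi>2 k \<in> test_functions \<Omega>" and t2: "Lp_tendsto 2 \<Omega> \<phi>2 v" and T2: "Lp_tendsto 2 \<Omega> (\<lambda>k. X_grad X (\<phi>2 k)) G2"
    using v unfolding weak_solution_def W0_grad_def M_def by blast
  note t1 = Lp_tendsto_2D[OF t1, folded M_def] and T1 = Lp_tendsto_2D[OF T1, folded M_def]
    and t2 = Lp_tendsto_2D[OF t2, folded M_def] and T2 = Lp_tendsto_2D[OF T2, folded M_def]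
  define G where "G x = G1 x - G2 x" for x
  define \<phi> where "\<phi> k x = \<phi>1 k x - \<phi>2 k x" for k x
  define \<psi> where "\<psi> k x = tanh (\<phi> k x)" for k x
  have \<phi>: "\<phi> k \<in> test_functions \<Omega>" for k
    unfolding \<phi>_def by (intro diff_mem_test_functions \<phi>1 \<phi>2)
  have \<psi>: "\<psi> k \<in> test_functions \<Omega>" for k
    unfolding \<psi>_def by (intro tanh_mem_test_functions \<phi>)
  have X\<phi>: "X_grad X (\<phi> k) x = X_grad X (\<phi>1 k) x - X_grad X (\<phi>2 k) x" for k x
    unfolding \<phi>_def by (rule X_grad_diff[OF \<phi>1 \<phi>2])
  have X\<psi>: "X_grad X (\<psi> k) x = (1 - (\<psi> k x)\<^sup>2) *\<^sub>R X_grad X (\<phi> k) x" for k x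
    unfolding \<psi>_def by (rule X_grad_tanh[OF \<phi>])
  note \<psi>i = W0_grad_test_function[where X=X, OF \<Omega> X \<psi>, folded M_def] and \<phi>i = W0_grad_test_function[where X=X, OF \<Omega> X \<phi>, folded M_def]
  have Gm: "G \<in> borel_measurable M" unfolding G_def using T1(2) T2(2) by measurable
  have Gi: "integrable M (\<lambda>x. (norm (G x))\<^sup>2)"
    unfolding G_def by (intro integrable_norm_diff_power2 T1 T2)
  obtain B where Am: "A \<in> borel_measurable M" and B: "\<And>x i j. x \<in> \<Omega> \<Longrightarrow> \<bar>A x $ i $ j\<bar> \<le> B"
    and ell: "\<And>x \<eta>. x \<in> \<Omega> \<Longrightarrow> \<alpha> * (norm \<eta>)\<^sup>2 \<le> (A x *v \<eta>) \<bullet> \<eta>"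
    using A unfolding elliptic_matrix_def M_def by blast
  define C where "C = real CARD('m) * real CARD('m) * B"
  have C: "norm (A x *v \<eta>) \<le> C * norm \<eta>" if "x \<in> \<Omega>" for x \<eta>
  proof -
    have "norm (A x *v \<eta>) \<le> onorm ((*v) (A x)) * norm \<eta>" by (rule onorm) simp
    also have "\<dots> \<le> C * norm \<eta>"
      unfolding C_def using B[OF that] by (intro mult_right_mono onorm_le_matrix_component) auto
    finally show ?thesis .
  qed
  have flux_int: "integrable M (\<lambda>x. (A x *v H x) \<bullet> K x)"
    if "H \<in> borel_measurable M" "integrable M (\<lambda>x. (norm (H x))\<^sup>2)" "K \<in> borel_measurable M" "integrable M (\<lambda>x. (norm (K x))\<^sup>2)"
    for H K :: "real ^ 'n \<Rightarrow> real ^ 'm"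
  proof (rule integrable_inner_L2)
    show m: "(\<lambda>x. A x *v H x) \<in> borel_measurable M" by (rule borel_measurable_matrix_vector_mult[OF Am that(1)])
    show "integrable M (\<lambda>x. (norm (A x *v H x))\<^sup>2)"
    proof (rule Bochner_Integration.integrable_bound)
      show "integrable M (\<lambda>x. C\<^sup>2 * (norm (H x))\<^sup>2)" using that(2) by simp
      show "(\<lambda>x. (norm (A x *v H x))\<^sup>2) \<in> borel_measurable M" using m by measurable
      show "AE x in M. norm ((norm (A x *v H x))\<^sup>2) \<le> norm (C\<^sup>2 * (norm (H x))\<^sup>2)"
        using C by (intro AE_I2) (auto simp: spM power_mult_distrib[symmetric] intro!: power_mono)
    qed
  qed (use that in auto)
  have energy: "\<alpha> / 2 * (\<integral>x. (norm (X_grad X (\<psi> k) x))\<^sup>2 \<partial>M)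
      \<le> (\<integral>x. \<bar>f x - g x\<bar> \<partial>M) + C\<^sup>2 / (2 * \<alpha>) * (\<integral>x. (norm (X_grad X (\<phi> k) x - G x))\<^sup>2 \<partial>M)" for k
  proof -
    have pointwise: "\<alpha> / 2 * (norm (X_grad X (\<psi> k) x))\<^sup>2
        \<le> C\<^sup>2 / (2 * \<alpha>) * (norm (X_grad X (\<phi> k) x - G x))\<^sup>2 + (A x *v G x) \<bullet> X_grad X (\<psi> k) x" if x: "x \<in> \<Omega>" for x
    proof -
      define s where "s = 1 - (\<psi> k x)\<^sup>2"
      define P where "P = X_grad X (\<phi> k) x"
      have s: "0 \<le> s" "s \<le> 1" unfolding s_def \<psi>_def by (rule one_minus_tanh_power2_bounds)+
      have "\<alpha> * (norm (s *\<^sub>R P))\<^sup>2 = s * (s * (\<alpha> * (norm P)\<^sup>2))" using s by (simp add: power_mult_distrib power2_eq_square)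
      also have "\<dots> \<le> 1 * (s * (\<alpha> * (norm P)\<^sup>2))" using s \<open>\<alpha> > 0\<close> by (intro mult_right_mono) auto
      also have "\<dots> \<le> s * ((A x *v P) \<bullet> P)" using ell[OF x, of P] s by (simp add: mult_left_mono)
      also have "\<dots> = (A x *v (P - G x)) \<bullet> (s *\<^sub>R P) + (A x *v G x) \<bullet> (s *\<^sub>R P)"
        by (simp add: matrix_vector_mult_diff_distrib inner_diff_left algebra_simps)
      also have "(A x *v (P - G x)) \<bullet> (s *\<^sub>R P) \<le> (C * norm (P - G x)) * norm (s *\<^sub>R P)"
        by (rule order_trans[OF norm_cauchy_schwarz]) (intro mult_right_mono C x norm_ge_zero)
      also have "\<dots> \<le> C\<^sup>2 / (2 * \<alpha>) * (norm (P - G x))\<^sup>2 + \<alpha> / 2 * (norm (s *\<^sub>R P))\<^sup>2"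
      proof -
        define p q where "p = C * norm (P - G x)" and "q = norm (s *\<^sub>R P)"
        have "0 \<le> (p - \<alpha> * q)\<^sup>2 / (2 * \<alpha>)" using \<open>\<alpha> > 0\<close> by simp
        also have "\<dots> = p\<^sup>2 / (2 * \<alpha>) + \<alpha> / 2 * q\<^sup>2 - p * q"
          using \<open>\<alpha> > 0\<close> by (simp add: power2_eq_square field_simps)
        finally show ?thesis by (simp add: p_def q_def power_mult_distrib)
      qed
      finally show ?thesis by (simp add: X\<psi> s_def[symmetric] P_def[symmetric])
    qed
    have iD: "integrable M (\<lambda>x. (norm (X_grad X (\<phi> k) x - G x))\<^sup>2)"
      by (intro integrable_norm_diff_power2 \<phi>i Gm Gi)
    have iG: "integrable M (\<lambda>x. (A x *v G x) \<bullet> X_grad X (\<psi> k) x)"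
      by (intro flux_int Gm Gi \<psi>i)
    have "(\<integral>x. \<alpha> / 2 * (norm (X_grad X (\<psi> k) x))\<^sup>2 \<partial>M)
        \<le> (\<integral>x. C\<^sup>2 / (2 * \<alpha>) * (norm (X_grad X (\<phi> k) x - G x))\<^sup>2 + (A x *v G x) \<bullet> X_grad X (\<psi> k) x \<partial>M)"
      using \<psi>i(4)[of k] iD iG pointwise by (intro integral_mono) (auto simp: spM)
    also have "\<dots> = C\<^sup>2 / (2 * \<alpha>) * (\<integral>x. (norm (X_grad X (\<phi> k) x - G x))\<^sup>2 \<partial>M) + (\<integral>x. (A x *v G x) \<bullet> X_grad X (\<psi> k) x \<partial>M)"
      using iD iG by (simp add: Bochner_Integration.integral_add)
    also have "(\<integral>x. (A x *v G x) \<bullet> X_grad X (\<psi> k) x \<partial>M) \<le> (\<integral>x. \<bar>f x - g x\<bar> \<partial>M)"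
    proof -
      have \<psi>1: "\<bar>\<psi> k x\<bar> \<le> 1" for x
        unfolding \<psi>_def using tanh_real_bounds[of "\<phi> k x"] by auto
      have mult: "integrable M (\<lambda>x. h x * \<psi> k x)" if "integrable M h" for h :: "real ^ 'n \<Rightarrow> real"
      proof (rule Bochner_Integration.integrable_bound[OF that])
        show "(\<lambda>x. h x * \<psi> k x) \<in> borel_measurable M"
          using borel_measurable_integrable[OF that] borel_measurable_integrable[OF \<psi>i(2)[of k]] by (rule borel_measurable_times)
        show "AE x in M. norm (h x * \<psi> k x) \<le> norm (h x)"
          using \<psi>1 by (intro AE_I2) (simp add: abs_mult mult_left_le)
      qed
      note f' = f[folded M_def]
      have "(\<integral>x. (A x *v G x) \<bullet> X_grad X (\<psi> k) x \<partial>M)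
          = (\<integral>x. (A x *v G1 x) \<bullet> X_grad X (\<psi> k) x - (A x *v G2 x) \<bullet> X_grad X (\<psi> k) x \<partial>M)"
        by (simp add: G_def matrix_vector_mult_diff_distrib inner_diff_left)
      also have "\<dots> = (\<integral>x. (A x *v G1 x) \<bullet> X_grad X (\<psi> k) x \<partial>M) - (\<integral>x. (A x *v G2 x) \<bullet> X_grad X (\<psi> k) x \<partial>M)"
        by (intro Bochner_Integration.integral_diff flux_int T1 T2 \<psi>i)
      also have "\<dots> = (\<integral>x. f x * \<psi> k x \<partial>M) - (\<integral>x. g x * \<psi> k x \<partial>M)"
        by (simp add: weak1[OF \<psi>i(1)] weak2[OF \<psi>i(1)])
      also have "\<dots> = (\<integral>x. f x * \<psi> k x - g x * \<psi> k x \<partial>M)"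
        by (intro Bochner_Integration.integral_diff[symmetric] mult f')
      also have "\<dots> \<le> (\<integral>x. \<bar>f x - g x\<bar> \<partial>M)"
      proof (rule integral_mono)
        show "integrable M (\<lambda>x. f x * \<psi> k x - g x * \<psi> k x)" by (intro Bochner_Integration.integrable_diff mult f')
        show "integrable M (\<lambda>x. \<bar>f x - g x\<bar>)" by (intro integrable_abs Bochner_Integration.integrable_diff f')
        fix x
        have "f x * \<psi> k x - g x * \<psi> k x \<le> \<bar>f x - g x\<bar> * \<bar>\<psi> k x\<bar>"
          by (simp add: left_diff_distrib[symmetric] abs_mult[symmetric])
        also have "\<dots> \<le> \<bar>f x - g x\<bar>" using \<psi>1 by (simp add: mult_left_le)
        finally show "f x * \<psi> k x - g x * \<psi> k x \<le> \<bar>f x - g x\<bar>" .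
      qed
      finally show ?thesis .
    qed
    finally show ?thesis by simp
  qed
  have lim_grad: "(\<lambda>k. C\<^sup>2 / (2 * \<alpha>) * (\<integral>x. (norm (X_grad X (\<phi> k) x - G x))\<^sup>2 \<partial>M)) \<longlonglongrightarrow> 0"
  proof -
    let ?D1 = "\<lambda>k x. X_grad X (\<phi>1 k) x - G1 x" and ?D2 = "\<lambda>k x. X_grad X (\<phi>2 k) x - G2 x"
    have i1: "integrable M (\<lambda>x. (norm (?D1 k x))\<^sup>2)" for k by (intro integrable_norm_diff_power2 T1)
    have i2: "integrable M (\<lambda>x. (norm (?D2 k x))\<^sup>2)" for k by (intro integrable_norm_diff_power2 T2)
    have "(\<lambda>k. \<integral>x. (norm (X_grad X (\<phi> k) x - G x))\<^sup>2 \<partial>M) \<longlonglongrightarrow> 0"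
    proof (rule Lim_null_comparison, intro always_eventually allI)
      fix k
      have eq: "X_grad X (\<phi> k) x - G x = ?D1 k x - ?D2 k x" for x by (simp add: X\<phi> G_def)
      have "(\<integral>x. (norm (X_grad X (\<phi> k) x - G x))\<^sup>2 \<partial>M) \<le> (\<integral>x. 2 * (norm (?D1 k x))\<^sup>2 + 2 * (norm (?D2 k x))\<^sup>2 \<partial>M)"
      proof (rule integral_mono)
        show "integrable M (\<lambda>x. (norm (X_grad X (\<phi> k) x - G x))\<^sup>2)" by (intro integrable_norm_diff_power2 \<phi>i Gm Gi)
        show "integrable M (\<lambda>x. 2 * (norm (?D1 k x))\<^sup>2 + 2 * (norm (?D2 k x))\<^sup>2)" using i1 i2 by simp
      qed (unfold eq, rule norm_diff_power2_le)
      also have "\<dots> = 2 * (\<integral>x. (norm (?D1 k x))\<^sup>2 \<partial>M) + 2 * (\<integral>x. (norm (?D2 k x))\<^sup>2 \<partial>M)"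
        using i1 i2 by (simp add: Bochner_Integration.integral_add)
      finally show "norm (\<integral>x. (norm (X_grad X (\<phi> k) x - G x))\<^sup>2 \<partial>M)
          \<le> 2 * (\<integral>x. (norm (?D1 k x))\<^sup>2 \<partial>M) + 2 * (\<integral>x. (norm (?D2 k x))\<^sup>2 \<partial>M)" by simp
    next
      show "(\<lambda>k. 2 * (\<integral>x. (norm (?D1 k x))\<^sup>2 \<partial>M) + 2 * (\<integral>x. (norm (?D2 k x))\<^sup>2 \<partial>M)) \<longlonglongrightarrow> 0"
        using tendsto_add[OF tendsto_mult_left[OF T1(5), of 2] tendsto_mult_left[OF T2(5), of 2]] by simp
    qed
    then show ?thesis using tendsto_mult_left[of _ 0 sequentially "C\<^sup>2 / (2 * \<alpha>)"] by fastforce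
  qed
  have lim_val: "(\<lambda>k. \<integral>x. \<bar>\<psi> k x - tanh (u x - v x)\<bar> \<partial>M) \<longlonglongrightarrow> 0"
  proof (rule Lim_null_comparison, intro always_eventually allI)
    fix k
    have m1: "(\<lambda>x. \<phi>1 k x - u x) \<in> borel_measurable M" for k using t1(1)[of k] t1(2) by measurable
    have m2: "(\<lambda>x. \<phi>2 k x - v x) \<in> borel_measurable M" for k using t2(1)[of k] t2(2) by measurable
    have s1: "integrable M (\<lambda>x. (norm (\<phi>1 k x - u x))\<^sup>2)" for k by (intro integrable_norm_diff_power2 t1)
    have s2: "integrable M (\<lambda>x. (norm (\<phi>2 k x - v x))\<^sup>2)" for k by (intro integrable_norm_diff_power2 t2)
    note L1 = L2_tendsto_0_imp_L1_tendsto_0[OF m1 s1 t1(5)] and L2 = L2_tendsto_0_imp_L1_tendsto_0[OF m2 s2 t2(5)]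
    show "(\<lambda>k. (\<integral>x. norm (\<phi>1 k x - u x) \<partial>M) + (\<integral>x. norm (\<phi>2 k x - v x) \<partial>M)) \<longlonglongrightarrow> 0"
      using tendsto_add[OF L1(2) L2(2)] by simp
    have le: "\<bar>\<psi> k x - tanh (u x - v x)\<bar> \<le> norm (\<phi>1 k x - u x) + norm (\<phi>2 k x - v x)" for x
      using tanh_lipschitz[of "\<phi> k x" "u x - v x"] unfolding \<psi>_def \<phi>_def real_norm_def by linarith
    have "(\<lambda>x. tanh (u x - v x)) \<in> borel_measurable M"
    proof -
      have "(tanh :: real \<Rightarrow> real) \<in> borel_measurable borel"
        by (intro borel_measurable_continuous_onI continuous_intros) (simp add: cosh_real_nonzero)
      from measurable_compose[OF borel_measurable_diff[OF t1(2) t2(2)] this] show ?thesis .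
    qed
    then have "(\<lambda>x. \<bar>\<psi> k x - tanh (u x - v x)\<bar>) \<in> borel_measurable M"
      using borel_measurable_integrable[OF \<psi>i(2)[of k]] by measurable
    then have int: "integrable M (\<lambda>x. \<bar>\<psi> k x - tanh (u x - v x)\<bar>)"
      by (rule Bochner_Integration.integrable_bound[OF Bochner_Integration.integrable_add[OF L1(1)[of k] L2(1)[of k]]])
         (use le in auto)
    have "(\<integral>x. \<bar>\<psi> k x - tanh (u x - v x)\<bar> \<partial>M) \<le> (\<integral>x. norm (\<phi>1 k x - u x) + norm (\<phi>2 k x - v x) \<partial>M)"
      by (intro integral_mono int Bochner_Integration.integrable_add L1 L2 le)
    also have "\<dots> = (\<integral>x. norm (\<phi>1 k x - u x) \<partial>M) + (\<integral>x. norm (\<phi>2 k x - v x) \<partial>M)"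
      by (intro Bochner_Integration.integral_add L1 L2)
    finally show "norm (\<integral>x. \<bar>\<psi> k x - tanh (u x - v x)\<bar> \<partial>M) \<le> (\<integral>x. norm (\<phi>1 k x - u x) \<partial>M) + (\<integral>x. norm (\<phi>2 k x - v x) \<partial>M)"
      by simp
  qed
  have "eventually (\<lambda>k. (\<integral>x. \<bar>\<psi> k x - tanh (u x - v x)\<bar> \<partial>M) < \<epsilon> \<and>
      C\<^sup>2 / (2 * \<alpha>) * (\<integral>x. (norm (X_grad X (\<phi> k) x - G x))\<^sup>2 \<partial>M) < \<epsilon>) sequentially"
    using order_tendstoD(2)[OF lim_val \<open>\<epsilon> > 0\<close>] order_tendstoD(2)[OF lim_grad \<open>\<epsilon> > 0\<close>] by (rule eventually_conj)
  then obtain k where "(\<integral>x. \<bar>\<psi> k x - tanh (u x - v x)\<bar> \<partial>M) < \<epsilon>"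
    "C\<^sup>2 / (2 * \<alpha>) * (\<integral>x. (norm (X_grad X (\<phi> k) x - G x))\<^sup>2 \<partial>M) < \<epsilon>"
    using eventually_happens'[OF sequentially_bot] by blast
  then show ?thesis
    using energy[of k] \<psi>[of k] unfolding M_def by (intro bexI[of _ "\<psi> k"] conjI) linarith+
qed

section \<open>Uniqueness of solutions found by approximation\<close>

lemma approx_solutionE:
  assumes "approx_solution \<Omega> X Q A fs u" and "Q > 2"
  obtains us \<sigma> where "\<And>n. weak_solution \<Omega> X A (fs n) (us n)" "strict_mono \<sigma>" "Lp_tendsto 1 \<Omega> (us \<circ> \<sigma>) u"
proof -
  obtain us \<sigma> where *: "\<forall>n. weak_solution \<Omega> X A (fs n) (us n)" "strict_mono \<sigma>"
    "\<forall>s. 1 \<le> s \<and> s < Q / (Q - 2) \<longrightarrow> Lp_tendsto s \<Omega> (us \<circ> \<sigma>) u"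
    using assms(1) unfolding approx_solution_def by blast
  have "1 < Q / (Q - 2)" using \<open>Q > 2\<close> by simp
  then have "Lp_tendsto 1 \<Omega> (us \<circ> \<sigma>) u" using *(3) by simp
  then show ?thesis using that *(1,2) by blast
qed

theorem theorem3p3:
  fixes \<Omega> :: "(real ^ 'n) set"
    and X :: "'m::finite \<Rightarrow> real ^ 'n \<Rightarrow> real ^ 'n"
    and A :: "real ^ 'n \<Rightarrow> real ^ 'm ^ 'm"
    and Q C\<^sub>P \<nu> \<alpha> \<beta> :: real
    and f u v :: "real ^ 'n \<Rightarrow> real"
    and fs gs :: "nat \<Rightarrow> real ^ 'n \<Rightarrow> real"
  assumes "CARD('n) \<ge> 2"
    and "open \<Omega>" and "bounded \<Omega>"
    and "\<And>j. local_lipschitz (UNIV :: real set) UNIV (\<lambda>_. X j)"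
    and "X_connected \<Omega> X"
    and "\<And>x. x \<in> \<Omega> \<Longrightarrow> ((\<lambda>y. cc_dist X x y) \<longlongrightarrow> 0) (at x within \<Omega>)"
    and "Q > 2" and "cc_doubling \<Omega> X Q"
    and "C\<^sub>P > 0" and "\<nu> > 0" and "cc_poincare \<Omega> X C\<^sub>P \<nu>"
    and "0 < \<alpha>" and "\<alpha> < \<beta>" and "elliptic_matrix \<Omega> A \<alpha> \<beta>"
    and "f \<in> Lp_space 1 \<Omega>"
    and "\<And>n. fs n \<in> Lp_space (2 * Q / (Q + 2)) \<Omega>" and "Lp_tendsto 1 \<Omega> fs f"
    and "\<And>n. gs n \<in> Lp_space (2 * Q / (Q + 2)) \<Omega>" and "Lp_tendsto 1 \<Omega> gs f"
    and "approx_solution \<Omega> X Q A fs u"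
    and "approx_solution \<Omega> X Q A gs v"
  shows "AE x in lebesgue_on \<Omega>. u x = v x"
proof -
  note open_\<Omega> = \<open>open \<Omega>\<close> and bounded_\<Omega> = \<open>bounded \<Omega>\<close> and elliptic = \<open>elliptic_matrix \<Omega> A \<alpha> \<beta>\<close>
  have lip: "local_lipschitz (UNIV :: real set) UNIV (\<lambda>_. X j)" for j by fact
  have cont: "continuous_on UNIV (X j)" for j
    using local_lipschitz_continuous_on[OF lip, of 0] by simp
  define M where "M = lebesgue_on \<Omega>"
  have "\<Omega> \<in> lmeasurable" using open_\<Omega> bounded_\<Omega> by (simp add: lmeasurable_open)
  then interpret finite_measure M unfolding M_def by (rule finite_measure_lebesgue_on)
  obtain us \<sigma> where us: "\<And>n. weak_solution \<Omega> X A (fs n) (us n)" and \<sigma>: "strict_mono \<sigma>"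
    and us_lim: "Lp_tendsto 1 \<Omega> (us \<circ> \<sigma>) u"
    using approx_solutionE[OF \<open>approx_solution \<Omega> X Q A fs u\<close> \<open>Q > 2\<close>] by blast
  obtain vs \<tau> where vs: "\<And>n. weak_solution \<Omega> X A (gs n) (vs n)" and \<tau>: "strict_mono \<tau>"
    and vs_lim: "Lp_tendsto 1 \<Omega> (vs \<circ> \<tau>) v"
    using approx_solutionE[OF \<open>approx_solution \<Omega> X Q A gs v\<close> \<open>Q > 2\<close>] by blast
  note f = Lp_tendsto_1D[OF \<open>Lp_tendsto 1 \<Omega> fs f\<close>, folded M_def]
    and g = Lp_tendsto_1D[OF \<open>Lp_tendsto 1 \<Omega> gs f\<close>, folded M_def]
    and us_lim = Lp_tendsto_1D[OF us_lim, folded M_def, unfolded comp_def]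
    and vs_lim = Lp_tendsto_1D[OF vs_lim, folded M_def, unfolded comp_def]
  define z where "z x = tanh (u x - v x)" for x
  have tanh_meas: "(\<lambda>x. tanh (h x)) \<in> borel_measurable M" if "h \<in> borel_measurable M" for h :: "real ^ 'n \<Rightarrow> real"
  proof -
    have "(tanh :: real \<Rightarrow> real) \<in> borel_measurable borel"
      by (intro borel_measurable_continuous_onI continuous_intros) (simp add: cosh_real_nonzero)
    from measurable_compose[OF that this] show ?thesis .
  qed
  have z: "integrable M z"
    unfolding z_def
  proof (rule integrable_const_bound[where B=1])
    show "AE x in M. norm (tanh (u x - v x)) \<le> 1"
      using tanh_real_bounds by (intro AE_I2) (auto simp: abs_le_iff less_imp_le)
    show "(\<lambda>x. tanh (u x - v x)) \<in> borel_measurable M"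
      using us_lim(2) vs_lim(2) by (intro tanh_meas borel_measurable_diff borel_measurable_integrable)
  qed
  define \<epsilon> :: "nat \<Rightarrow> real" where "\<epsilon> n = inverse (real (Suc n))" for n
  have \<epsilon>: "\<epsilon> \<longlonglongrightarrow> 0" "\<epsilon> n > 0" for n
    unfolding \<epsilon>_def by (rule LIMSEQ_inverse_real_of_nat, simp)
  define good where "good n \<psi> \<longleftrightarrow> \<psi> \<in> test_functions \<Omega> \<and>
    (\<integral>x. \<bar>\<psi> x - tanh (us (\<sigma> n) x - vs (\<tau> n) x)\<bar> \<partial>M) \<le> \<epsilon> n \<and>
    \<alpha> / 2 * (\<integral>x. (norm (X_grad X \<psi> x))\<^sup>2 \<partial>M) \<le> (\<integral>x. \<bar>fs (\<sigma> n) x - gs (\<tau> n) x\<bar> \<partial>M) + \<epsilon> n" for n \<psi>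
  have "\<exists>\<psi>. good n \<psi>" for n
    using tanh_energy_estimate[where X=X, OF open_\<Omega> bounded_\<Omega> cont elliptic \<open>0 < \<alpha>\<close>
        f(1)[unfolded M_def] g(1)[unfolded M_def] us vs \<epsilon>(2)]
    unfolding good_def M_def by blast
  then obtain \<psi> where good: "\<And>n. good n (\<psi> n)" by metis
  have \<psi>: "\<psi> n \<in> test_functions \<Omega>"
    and \<psi>_close: "(\<integral>x. \<bar>\<psi> n x - tanh (us (\<sigma> n) x - vs (\<tau> n) x)\<bar> \<partial>M) \<le> \<epsilon> n"
    and \<psi>_energy: "\<alpha> / 2 * (\<integral>x. (norm (X_grad X (\<psi> n) x))\<^sup>2 \<partial>M) \<le> (\<integral>x. \<bar>fs (\<sigma> n) x - gs (\<tau> n) x\<bar> \<partial>M) + \<epsilon> n" for n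
    using good[of n] unfolding good_def by blast+
  note \<psi>i = W0_grad_test_function[where X=X, OF open_\<Omega> bounded_\<Omega> cont \<psi>, folded M_def]
  have lim_\<psi>: "(\<lambda>n. \<integral>x. \<bar>\<psi> n x - z x\<bar> \<partial>M) \<longlonglongrightarrow> 0"
  proof (rule Lim_null_comparison, intro always_eventually allI)
    fix n
    define w where "w x = tanh (us (\<sigma> n) x - vs (\<tau> n) x)" for x
    have iu: "integrable M (\<lambda>x. \<bar>us (\<sigma> n) x - u x\<bar>)" and iv: "integrable M (\<lambda>x. \<bar>vs (\<tau> n) x - v x\<bar>)"
      using us_lim(1)[of n] us_lim(2) vs_lim(1)[of n] vs_lim(2) by auto
    have iw: "integrable M w"
      unfolding w_def
    proof (rule integrable_const_bound[where B=1])
      show "AE x in M. norm (tanh (us (\<sigma> n) x - vs (\<tau> n) x)) \<le> 1"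
        using tanh_real_bounds by (intro AE_I2) (auto simp: abs_le_iff less_imp_le)
      show "(\<lambda>x. tanh (us (\<sigma> n) x - vs (\<tau> n) x)) \<in> borel_measurable M"
        using us_lim(1)[of n] vs_lim(1)[of n] by (intro tanh_meas borel_measurable_diff borel_measurable_integrable)
    qed
    have le: "\<bar>\<psi> n x - z x\<bar> \<le> \<bar>\<psi> n x - w x\<bar> + \<bar>us (\<sigma> n) x - u x\<bar> + \<bar>vs (\<tau> n) x - v x\<bar>" for x
      using tanh_lipschitz[of "us (\<sigma> n) x - vs (\<tau> n) x" "u x - v x"] unfolding w_def z_def by linarith
    have "(\<integral>x. \<bar>\<psi> n x - z x\<bar> \<partial>M) \<le> (\<integral>x. \<bar>\<psi> n x - w x\<bar> + \<bar>us (\<sigma> n) x - u x\<bar> + \<bar>vs (\<tau> n) x - v x\<bar> \<partial>M)"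
      using le z iw \<psi>i(2)[of n] us_lim(1)[of n] us_lim(2) vs_lim(1)[of n] vs_lim(2)
      by (intro integral_mono Bochner_Integration.integrable_add integrable_abs Bochner_Integration.integrable_diff) auto
    also have "\<dots> = (\<integral>x. \<bar>\<psi> n x - w x\<bar> \<partial>M) + (\<integral>x. \<bar>us (\<sigma> n) x - u x\<bar> \<partial>M) + (\<integral>x. \<bar>vs (\<tau> n) x - v x\<bar> \<partial>M)"
      using iw iu iv \<psi>i(2)[of n] by (simp add: Bochner_Integration.integral_add)
    also have "\<dots> \<le> \<epsilon> n + (\<integral>x. \<bar>us (\<sigma> n) x - u x\<bar> \<partial>M) + (\<integral>x. \<bar>vs (\<tau> n) x - v x\<bar> \<partial>M)"
      using \<psi>_close[of n] by (simp add: w_def)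
    finally show "norm (\<integral>x. \<bar>\<psi> n x - z x\<bar> \<partial>M) \<le> \<epsilon> n + (\<integral>x. \<bar>us (\<sigma> n) x - u x\<bar> \<partial>M) + (\<integral>x. \<bar>vs (\<tau> n) x - v x\<bar> \<partial>M)"
      by simp
  next
    show "(\<lambda>n. \<epsilon> n + (\<integral>x. \<bar>us (\<sigma> n) x - u x\<bar> \<partial>M) + (\<integral>x. \<bar>vs (\<tau> n) x - v x\<bar> \<partial>M)) \<longlonglongrightarrow> 0"
      using tendsto_add[OF tendsto_add[OF \<epsilon>(1) us_lim(3)] vs_lim(3)] by simp
  qed
  have lim_data: "(\<lambda>n. \<integral>x. \<bar>fs (\<sigma> n) x - gs (\<tau> n) x\<bar> \<partial>M) \<longlonglongrightarrow> 0"
  proof (rule Lim_null_comparison, intro always_eventually allI)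
    fix n
    have i: "integrable M (\<lambda>x. \<bar>fs (\<sigma> n) x - f x\<bar>)" "integrable M (\<lambda>x. \<bar>gs (\<tau> n) x - f x\<bar>)"
      using f(1)[of "\<sigma> n"] g(1)[of "\<tau> n"] f(2) by auto
    have "(\<integral>x. \<bar>fs (\<sigma> n) x - gs (\<tau> n) x\<bar> \<partial>M) \<le> (\<integral>x. \<bar>fs (\<sigma> n) x - f x\<bar> + \<bar>gs (\<tau> n) x - f x\<bar> \<partial>M)"
      using i f(1)[of "\<sigma> n"] g(1)[of "\<tau> n"] by (intro integral_mono) auto
    also have "\<dots> = (\<integral>x. \<bar>fs (\<sigma> n) x - f x\<bar> \<partial>M) + (\<integral>x. \<bar>gs (\<tau> n) x - f x\<bar> \<partial>M)"
      using i by (rule Bochner_Integration.integral_add)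
    finally show "norm (\<integral>x. \<bar>fs (\<sigma> n) x - gs (\<tau> n) x\<bar> \<partial>M) \<le> (\<integral>x. \<bar>fs (\<sigma> n) x - f x\<bar> \<partial>M) + (\<integral>x. \<bar>gs (\<tau> n) x - f x\<bar> \<partial>M)"
      by simp
  next
    show "(\<lambda>n. (\<integral>x. \<bar>fs (\<sigma> n) x - f x\<bar> \<partial>M) + (\<integral>x. \<bar>gs (\<tau> n) x - f x\<bar> \<partial>M)) \<longlonglongrightarrow> 0"
      using tendsto_add[OF LIMSEQ_subseq_LIMSEQ[OF f(3) \<sigma>] LIMSEQ_subseq_LIMSEQ[OF g(3) \<tau>]]
      by (simp add: comp_def)
  qed
  have "(\<lambda>n. \<integral>x. (norm (X_grad X (\<psi> n) x))\<^sup>2 \<partial>M) \<longlonglongrightarrow> 0"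
  proof (rule Lim_null_comparison, intro always_eventually allI)
    fix n
    show "norm (\<integral>x. (norm (X_grad X (\<psi> n) x))\<^sup>2 \<partial>M) \<le> 2 / \<alpha> * ((\<integral>x. \<bar>fs (\<sigma> n) x - gs (\<tau> n) x\<bar> \<partial>M) + \<epsilon> n)"
      using \<psi>_energy[of n] \<open>0 < \<alpha>\<close> by (simp add: field_simps)
  next
    show "(\<lambda>n. 2 / \<alpha> * ((\<integral>x. \<bar>fs (\<sigma> n) x - gs (\<tau> n) x\<bar> \<partial>M) + \<epsilon> n)) \<longlonglongrightarrow> 0"
      using tendsto_mult_left[OF tendsto_add[OF lim_data \<epsilon>(1)], of "2 / \<alpha>"] by simp
  qed
  then have lim_grad: "(\<lambda>n. \<integral>x. norm (X_grad X (\<psi> n) x) \<partial>M) \<longlonglongrightarrow> 0"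
    by (rule L2_tendsto_0_imp_L1_tendsto_0(2)[OF \<psi>i(3,4)])
  have "AE x in lebesgue_on \<Omega>. z x = 0"
    by (rule vanishing_X_grad_limit_eq_0[OF open_\<Omega> bounded_\<Omega> lip \<open>X_connected \<Omega> X\<close> \<open>cc_doubling \<Omega> X Q\<close>
          \<open>cc_poincare \<Omega> X C\<^sub>P \<nu>\<close> \<open>\<nu> > 0\<close> \<psi> z[unfolded M_def] lim_\<psi>[unfolded M_def] lim_grad[unfolded M_def]])
  then show ?thesis
    by eventually_elim (simp add: z_def)
qed

end
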